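(* Let $r>0$, let $\psi:\mathbb{Y}\to\mathbb{R}$ be a bounded measurable test function with compact support, let $A_r[\psi]=\int_0^r\langle\mu_t^\eta,\psi\rangle\,dt$ be the additive functional of the Poisson-initialized system of random measures $\mu^\eta$ described in the context, let $\sigma_r$ be its standard deviation, and let $\rho_r$ be the law of $Z_r[\psi]=\sigma_r^{-1}(A_r[\psi]-\mathbb{E}[A_r[\psi]])$. Let $\gamma$ be the standard Gaussian law on $\mathbb{R}$. Then $$d_W(\rho_r,\gamma)\le \frac{\sqrt2}{\sigma_r^3}\int_{\mathbb{X}}\mathbb{E}\left[\left|\int_0^r\langle\mu_s^x,\psi\rangle\,ds\right|^3\right]\nu(dx).$$ Moreover, if $\psi\ge 0$, then $$d_W(\rho_r,\gamma)\le\sqrt2\, m_3[\rho_r],\qquad m_3[\rho_r]:=\int_{\mathbb{R}}x^3\,\rho_r(dx).$$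
   Context: Poisson input: $(\mathbb{X},\mathcal{X})$ is a measurable space on which Lebesgue measure makes sense (a Borel subset of a finite-dimensional Euclidean space). $\nu$ is a Radon measure on $\mathbb{X}$, absolutely continuous with respect to Lebesgue measure, with density bounded from above and bounded away from zero. $\mathbf{N}_\sigma(\mathbb{X})$ is the space of nonnegative-integer-valued Radon measures on $\mathbb{X}$, with the smallest $\sigma$-algebra making all maps $\chi\mapsto\chi(B)$, $B\in\mathcal{X}$, measurable. $\vartheta$ is the law on $\mathbf{N}_\sigma(\mathbb{X})$ of a Poisson random measure $\eta$ with intensity $\nu$: for disjoint $B_1,\dots,B_n\in\mathcal{X}$ the variables $\eta(B_i)$ are independent and Poisson with means $\nu(B_i)$. Measure-valued dynamics: $(\mathbb{Y},\mathcal{Y})$ is a second measurable space (with a topology, so that compact support makes sense) and $\mathcal{M}_\sigma(\mathbb{Y})$ is the space of $\sigma$-finite measures on it. $\{\mu^x: x\in\mathbb{X}\}$ is a family of independent $\mathcal{M}_\sigma(\mathbb{Y})$-valued processes $\mu^x=\{\mu^x_t: t\ge0\}$ defined on a probability space $(\Omega,\mathcal{F},\mathbb{Q})$; no structural assumption is made on their dynamics. Given $\eta$, set $\mu_t^\eta(\omega):=\int_{\mathbb{X}}\mu_t^x(\omega)\,\eta(dx)$. The underlying probability space is $\mathbf{N}_\sigma(\mathbb{X})\times\Omega$ with the product measure $\mathbb{P}=\vartheta\otimes\mathbb{Q}$ (so $\eta$ is independent of the family $\{\mu^x\}$), and $\mathbb{E}$ is the corresponding expectation. Notation: $\langle\mu,\psi\rangle:=\int_{\mathbb{Y}}\psi\,d\mu$.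 All the integrals above are assumed to be well defined, $0<\sigma_r<\infty$, and $m_3[\rho_r]$ is considered when $\rho_r$ has a finite third moment. The Wasserstein distance is $d_W(\rho_1,\rho_2):=\sup_h\left|\int h\,d\rho_1-\int h\,d\rho_2\right|$, the supremum being over all $1$-Lipschitz $h:\mathbb{R}\to\mathbb{R}$. *)

theory Defs
  imports "HOL-Probability.Probability"
begin

section \<open>Spaces of measures\<close>

text \<open>The smallest \<open>\<sigma>\<close>-algebra on a set \<open>S\<close> of measures over \<open>M\<close> that makes all evaluations
  \<open>m \<mapsto> m(B)\<close>, \<open>B \<in> sets M\<close>, measurable (the construction of \<^const>\<open>subprob_algebra\<close>, without the
  restriction to subprobabilities).\<close>

definition evaluation_algebra :: "'a measure set \<Rightarrow> 'a measure \<Rightarrow> 'a measure measure" where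
  "evaluation_algebra S M = (SUP B\<in>sets M. vimage_algebra S (\<lambda>m. emeasure m B) borel)"

definition sigma_finite_algebra :: "'a measure \<Rightarrow> 'a measure measure" where
  "sigma_finite_algebra M =
     evaluation_algebra {m. sets m = sets M \<and> sigma_finite_measure m} M"

text \<open>Radon measures on a subspace \<open>X\<close> of a Euclidean space: locally finite in the relative topology
  (hence finite on compact sets) and inner regular.\<close>

definition radon_measure :: "'a::euclidean_space set \<Rightarrow> 'a measure \<Rightarrow> bool" where
  "radon_measure X m \<longleftrightarrow>
     sets m = sets (restrict_space borel X) \<and>
     (\<forall>x\<in>X. \<exists>U. open U \<and> x \<in> U \<and> emeasure m (U \<inter> X) < \<infinity>) \<and>
     (\<forall>B\<in>sets m. emeasure m B = (SUP K\<in>{K. compact K \<and> K \<subseteq> B}. emeasure m K))"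

definition counting_measures :: "'a::euclidean_space set \<Rightarrow> 'a measure set" where
  "counting_measures X =
     {m. radon_measure X m \<and> (\<forall>B\<in>sets m. emeasure m B = \<infinity> \<or> (\<exists>k::nat. emeasure m B = of_nat k))}"

definition counting_measure_algebra :: "'a::euclidean_space set \<Rightarrow> 'a measure measure" where
  "counting_measure_algebra X = evaluation_algebra (counting_measures X) (restrict_space borel X)"


section \<open>Poisson input\<close>

definition bounded_density :: "'a::euclidean_space set \<Rightarrow> 'a measure \<Rightarrow> bool" where
  "bounded_density X \<nu> \<longleftrightarrow>
     (\<exists>f c C. f \<in> borel_measurable (restrict_space borel X) \<and> 0 < c \<and>
        (\<forall>x\<in>X. c \<le> f x \<and> f x \<le> (C::real)) \<and>
        \<nu> = density (restrict_space lborel X) (\<lambda>x. ennreal (f x)))"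

text \<open>The law \<open>\<theta>\<close> of a Poisson random measure, as a measure on the space of counting measures, where
  the random measure is the identity map.  A Poisson variable of mean \<open>\<infinity>\<close> is a.s. equal to \<open>\<infinity>\<close>.\<close>

definition poisson_random_measure_law ::
  "'a::euclidean_space set \<Rightarrow> 'a measure \<Rightarrow> 'a measure measure \<Rightarrow> bool" where
  "poisson_random_measure_law X \<nu> \<theta> \<longleftrightarrow>
     prob_space \<theta> \<and>
     sets \<theta> = sets (counting_measure_algebra X) \<and>
     (\<forall>B\<in>sets \<nu>. emeasure \<nu> B < \<infinity> \<longrightarrow>
        (\<forall>k::nat. measure \<theta> {\<xi>\<in>space \<theta>. emeasure \<xi> B = of_nat k} =
           exp (- measure \<nu> B) * measure \<nu> B ^ k / fact k)) \<and>
     (\<forall>B\<in>sets \<nu>. emeasure \<nu> B = \<infinity> \<longrightarrow> (AE \<xi> in \<theta>. emeasure \<xi> B = \<infinity>)) \<and>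
     (\<forall>n (B :: nat \<Rightarrow> 'a set). (\<forall>i<n. B i \<in> sets \<nu>) \<and> disjoint_family_on B {..<n} \<longrightarrow>
        prob_space.indep_vars \<theta> (\<lambda>_. borel) (\<lambda>i \<xi>. emeasure \<xi> (B i)) {..<n})"


section \<open>The underlying probability space\<close>

text \<open>\<open>P\<close> is the product of \<open>M\<close> and \<open>N\<close>, on the product \<open>\<sigma>\<close>-algebra or on a larger one on which the
  measure is still computed by iterated integration.  By \<open>product_measure_pair\<close> below, the ordinary
  product \<open>M \<Otimes>\<^sub>M N\<close> is a special case.  Larger \<open>\<sigma>\<close>-algebras are admitted because an uncountable
  independent family that is jointly measurable in index and outcome for the ordinary product
  \<open>\<sigma>\<close>-algebra is a.s. constant for almost every index (for an atomless measure on the indices).\<close>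

definition product_measure :: "'a measure \<Rightarrow> 'b measure \<Rightarrow> ('a \<times> 'b) measure \<Rightarrow> bool" where
  "product_measure M N P \<longleftrightarrow>
     space P = space M \<times> space N \<and>
     sets (M \<Otimes>\<^sub>M N) \<subseteq> sets P \<and>
     (\<forall>E\<in>sets P.
        (\<forall>x\<in>space M. Pair x -` E \<in> sets N) \<and>
        (\<lambda>x. emeasure N (Pair x -` E)) \<in> borel_measurable M \<and>
        emeasure P E = (\<integral>\<^sup>+x. emeasure N (Pair x -` E) \<partial>M))"

lemma product_measure_pair:
  assumes "sigma_finite_measure N"
  shows "product_measure M N (M \<Otimes>\<^sub>M N)"
  unfolding product_measure_def
  using sigma_finite_measure.emeasure_pair_measure_alt[OF assms]
    sigma_finite_measure.measurable_emeasure_Pair[OF assms]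
  by (auto simp: space_pair_measure intro: sets_Pair1)

definition std_dev :: "'a measure \<Rightarrow> ('a \<Rightarrow> real) \<Rightarrow> real" where
  "std_dev P Z = sqrt (\<integral>z. (Z z - (\<integral>z'. Z z' \<partial>P))\<^sup>2 \<partial>P)"


section \<open>Measure-valued dynamics\<close>

text \<open>The measure \<open>B \<mapsto> \<integral> \<mu>\<^sup>x(B) \<xi>(dx)\<close> on \<open>Y\<close>.  For a counting measure \<open>\<xi>\<close> the integral is a sum over
  the atoms of \<open>\<xi>\<close>, so no measurability of \<open>x \<mapsto> \<mu>\<^sup>x\<close> is needed for this to be a measure.\<close>

definition superposition :: "'y measure \<Rightarrow> 'a measure \<Rightarrow> ('a \<Rightarrow> 'y measure) \<Rightarrow> 'y measure" where
  "superposition Y \<xi> \<mu> = measure_of (space Y) (sets Y) (\<lambda>B. \<integral>\<^sup>+x. emeasure (\<mu> x) B \<partial>\<xi>)"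

text \<open>\<open>\<integral>\<^sub>0\<^sup>r \<langle>m\<^sub>t, \<psi>\<rangle> dt\<close> for a path \<open>m\<close> of measures.\<close>

definition time_integral :: "real \<Rightarrow> ('y \<Rightarrow> real) \<Rightarrow> (real \<Rightarrow> 'y measure) \<Rightarrow> real" where
  "time_integral r \<psi> m = (LBINT t:{0..r}. (\<integral>y. \<psi> y \<partial>m t))"

text \<open>Well-definedness of \<open>\<integral>\<^sub>0\<^sup>r \<langle>m\<^sub>t, \<psi>\<rangle> dt\<close> as a Lebesgue integral, i.e. with
  \<open>\<integral>\<^sub>0\<^sup>r \<langle>m\<^sub>t, \<bar>\<psi>\<bar>\<rangle> dt\<close> finite.\<close>

definition time_integrable :: "real \<Rightarrow> ('y \<Rightarrow> real) \<Rightarrow> (real \<Rightarrow> 'y measure) \<Rightarrow> bool" where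
  "time_integrable r \<psi> m \<longleftrightarrow>
     (AE t in lborel. t \<in> {0..r} \<longrightarrow> integrable (m t) \<psi>) \<and>
     set_integrable lborel {0..r} (\<lambda>t. \<integral>y. \<bar>\<psi> y\<bar> \<partial>m t)"

text \<open>Independent processes with values in the \<open>\<sigma>\<close>-finite measures on \<open>Y\<close>.  Each process is jointly
  measurable in time and outcome, so that its time integrals are random variables; independence is
  that of the processes as random elements of the path space.\<close>

definition independent_measure_processes ::
  "'w measure \<Rightarrow> 'y measure \<Rightarrow> 'x set \<Rightarrow> ('x \<Rightarrow> real \<Rightarrow> 'w \<Rightarrow> 'y measure) \<Rightarrow> bool" where
  "independent_measure_processes Q Y X \<mu> \<longleftrightarrow>
     (\<forall>x\<in>X. (\<lambda>(t, \<omega>). \<mu> x t \<omega>) \<in>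
        restrict_space borel {0..} \<Otimes>\<^sub>M Q \<rightarrow>\<^sub>M sigma_finite_algebra Y) \<and>
     prob_space.indep_vars Q (\<lambda>_. PiM {0..} (\<lambda>_. sigma_finite_algebra Y))
       (\<lambda>x \<omega>. \<lambda>t\<in>{0..}. \<mu> x t \<omega>) X"

definition poisson_additive_functional ::
  "'y measure \<Rightarrow> ('x \<Rightarrow> real \<Rightarrow> 'w \<Rightarrow> 'y measure) \<Rightarrow> real \<Rightarrow> ('y \<Rightarrow> real) \<Rightarrow> 'x measure \<times> 'w \<Rightarrow> real"
where
  "poisson_additive_functional Y \<mu> r \<psi> =
     (\<lambda>(\<xi>, \<omega>). time_integral r \<psi> (\<lambda>t. superposition Y \<xi> (\<lambda>x. \<mu> x t \<omega>)))"


section \<open>Wasserstein distance\<close>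

text \<open>Intended for laws on the line with finite first moment, so that Lipschitz functions are
  integrable.\<close>

definition wasserstein :: "real measure \<Rightarrow> real measure \<Rightarrow> ennreal" where
  "wasserstein \<rho>1 \<rho>2 =
     (SUP h\<in>{h::real \<Rightarrow> real. lipschitz_on 1 UNIV h}.
        ennreal \<bar>(\<integral>x. h x \<partial>\<rho>1) - (\<integral>x. h x \<partial>\<rho>2)\<bar>)"

end

theory Submission
  imports Defs "HOL-Real_Asymp.Real_Asymp"
begin

text \<open>For a point \<open>x\<close> let \<open>a\<^sub>x\<close> be the time integral of its own process.  Given the configuration
  \<open>\<xi>\<close>, the additive functional \<open>A\<close> is the sum of the independent variables \<open>a\<^sub>x\<close> over the atoms of
  \<open>\<xi>\<close>, so that the characteristic function of \<open>A\<close> given \<open>\<xi>\<close> is a product over these atoms.  The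
  expectation of such a product under a Poisson law is explicit (\<open>product_functional_limit\<close>), and
  \<open>E exp(iuA) = exp(\<integral> (exp(iua) - 1) \<lambda>(da))\<close> results (\<open>char_total_law\<close>), where \<open>\<lambda>\<close> is the
  \<open>\<nu>\<close>-mixture of the laws of the \<open>a\<^sub>x\<close> (\<open>Levy_measure\<close>).  All the geometry is gone at this point:
  the two claims are about a law on the line with Levy measure \<open>\<lambda>\<close>, and the integral in the first
  one is \<open>\<integral> \<bar>a\<bar>\<^sup>3 \<lambda>(da)\<close>.

  Differentiating the formula in \<open>u\<close>, and using that characteristic functions determine signed
  measures, gives the identity \<open>E (A f(A)) = \<integral> a E (f(A + a)) \<lambda>(da)\<close> (\<open>stein_identity\<close>).  It shows
  that the variance of \<open>A\<close> is \<open>\<integral> a\<^sup>2 \<lambda>(da)\<close>.  With \<open>Z\<close> for the standardization of \<open>A\<close> it then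
  compares \<open>E (Z f(Z))\<close> with \<open>E (f'(Z))\<close> up to a second order Taylor remainder, of size at most
  \<open>sup \<bar>f''\<bar> / 2\<close> times \<open>\<sigma>\<^sup>-\<^sup>3 \<integral> \<bar>a\<bar>\<^sup>3 \<lambda>(da)\<close>.  For the solution \<open>f\<close> of Stein's equation of a
  1-Lipschitz function, \<open>\<bar>f''\<bar> \<le> 2\<close> (\<open>stein_solution_bounds\<close>).  This is the first claim, with
  \<open>1 \<le> sqrt 2\<close> to spare.  If \<open>\<psi> \<ge> 0\<close>, then \<open>\<lambda>\<close> lives on the positive half line, and the identity for
  quadratic \<open>f\<close> evaluates the third central moment of \<open>A\<close> as \<open>\<integral> a\<^sup>3 \<lambda>(da)\<close>
  (\<open>third_central_moment\<close>).  This is the second claim.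

  Three points need care.  The laws of the \<open>a\<^sub>x\<close> depend measurably on \<open>x\<close> because \<open>a\<^sub>x\<close> is the value of
  \<open>A\<close> at the configuration with the single point \<open>x\<close> (\<open>total_dirac\<close>, \<open>point_law_kernel\<close>).  A time
  integral is not a measurable function on the path space, so its independence from the other ones
  comes from a version that is measurable with respect to the path, namely a conditional expectation
  (\<open>time_integral_version\<close>).  Finally \<open>\<integral> \<bar>a\<bar> \<lambda>(da) < \<infinity>\<close>, without which the identity makes no sense,
  is extracted from the almost sure absolute convergence of the sum of the \<open>a\<^sub>x\<close> through its Laplace
  transform (\<open>laplace_functional\<close>).\<close>

section \<open>Stein's equation for the Gaussian law\<close>

abbreviation (input) \<phi> :: "real \<Rightarrow> real" where "\<phi> \<equiv> std_normal_density"

abbreviation (input) \<gamma> :: "real measure" where "\<gamma> \<equiv> std_normal_distribution"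

lemma phi_pos: "0 < \<phi> x" by (simp add: normal_density_pos)

lemma phi_deriv: "(\<phi> has_real_derivative - x * \<phi> x) (at x)"
proof -
  have "((\<lambda>x. exp (- x\<^sup>2 / 2)) has_real_derivative - x * exp (- x\<^sup>2 / 2)) (at x)"
    by (auto intro!: derivative_eq_intros)
  from DERIV_cmult[OF this, of "1 / sqrt (2 * pi)"] show ?thesis
    unfolding std_normal_density_def [abs_def] by (simp only: mult.left_commute)
qed

lemma phi_cont: "continuous_on S \<phi>"
  unfolding std_normal_density_def by (auto intro!: continuous_intros)

lemma phi_linear_top: "((\<lambda>x. (c + d * \<bar>x\<bar>) * \<phi> x) \<longlongrightarrow> 0) at_top"
proof -
  have "((\<lambda>x. (c + d * x) * \<phi> x) \<longlongrightarrow> 0) at_top"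
    unfolding std_normal_density_def by real_asymp
  then show ?thesis
    by (rule Lim_transform_eventually) (use eventually_ge_at_top[of 0] in eventually_elim, simp)
qed

lemma phi_linear_bot: "((\<lambda>x. (c + d * \<bar>x\<bar>) * \<phi> x) \<longlongrightarrow> 0) at_bot"
proof -
  have "((\<lambda>x. (c + d * \<bar>- x\<bar>) * \<phi> (- x)) \<longlongrightarrow> 0) at_top"
    using phi_linear_top[of c d] by (simp add: std_normal_density_def)
  then show ?thesis
    by (simp add: filterlim_at_bot_mirror)
qed

definition normal_partial :: "(real \<Rightarrow> real) \<Rightarrow> real \<Rightarrow> real" where
  "normal_partial h x = (\<integral>y. indicator {..x} y * ((h y - (\<integral>z. h z \<partial>\<gamma>)) * \<phi> y) \<partial>lborel)"

text \<open>The solution of Stein's equation \<open>f'(x) - x f(x) = h(x) - \<gamma>(h)\<close> that stays bounded: the factor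
  \<open>1 / \<phi>\<close> solves the homogeneous equation, and \<open>\<integral> (h - \<gamma>(h)) \<phi> = 0\<close> makes the partial
  integral vanish at both ends of the line.\<close>

definition stein_solution :: "(real \<Rightarrow> real) \<Rightarrow> real \<Rightarrow> real" where
  "stein_solution h x = normal_partial h x / \<phi> x"

locale smooth_test =
  fixes h h' :: "real \<Rightarrow> real" and c d :: real
  assumes deriv: "\<And>x. (h has_real_derivative h' x) (at x)"
    and cont': "continuous_on UNIV h'"
    and growth: "\<And>x. \<bar>h x\<bar> \<le> c + d * \<bar>x\<bar>"
begin

abbreviation E :: real where "E \<equiv> (\<integral>z. h z \<partial>\<gamma>)"

lemma cont: "continuous_on S h"
  using deriv by (meson DERIV_isCont continuous_at_imp_continuous_on)

lemma meas[measurable]: "h \<in> borel_measurable borel"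
  by (rule borel_measurable_continuous_onI[OF cont])

lemma int_phi: "integrable lborel (\<lambda>x. h x * \<phi> x)"
proof (rule Bochner_Integration.integrable_bound)
  show "integrable lborel (\<lambda>x. c * \<phi> x + d * (\<bar>x\<bar> * \<phi> x))"
    using std_normal_moment_abs_odd[of 0] integrable_std_normal_moment_abs[of 1]
    by (auto intro!: Bochner_Integration.integrable_add integrable_mult_right
        simp: mult.commute)
  show "AE x in lborel. norm (h x * \<phi> x) \<le> norm (c * \<phi> x + d * (\<bar>x\<bar> * \<phi> x))"
  proof (rule AE_I2)
    fix x
    have "\<bar>h x\<bar> * \<phi> x \<le> (c + d * \<bar>x\<bar>) * \<phi> x"
      by (intro mult_right_mono growth) simp
    then show "norm (h x * \<phi> x) \<le> norm (c * \<phi> x + d * (\<bar>x\<bar> * \<phi> x))"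
      by (simp add: abs_mult algebra_simps)
  qed
qed measurable

definition centred :: "real \<Rightarrow> real" where "centred y = (h y - E) * \<phi> y"

lemma centred_int: "integrable lborel centred"
  unfolding centred_def left_diff_distrib using int_phi by auto

lemma centred_cont: "continuous_on S centred"
  unfolding centred_def by (intro continuous_intros cont phi_cont)

lemma centred_total: "(\<integral>y. centred y \<partial>lborel) = 0"
proof -
  have "E = (\<integral>y. h y * \<phi> y \<partial>lborel)"
    by (subst integral_density) (auto simp: mult.commute)
  then show ?thesis
    unfolding centred_def left_diff_distrib using int_phi
    by (subst Bochner_Integration.integral_diff) auto
qed

abbreviation I :: "real \<Rightarrow> real" where "I \<equiv> normal_partial h"

lemma I_eq: "I x = (\<integral>y. indicator {..x} y * centred y \<partial>lborel)"
  unfolding normal_partial_def centred_def by simp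

lemma centred_set_int: "S \<in> sets borel \<Longrightarrow> integrable lborel (\<lambda>y. indicator S y * centred y)"
  using integrable_mult_indicator[OF _ centred_int, of S] by simp

lemma I_diff: assumes "x \<le> y" shows "I y - I x = integral {x..y} centred"
proof -
  have "I y - I x = (\<integral>z. indicator {..y} z * centred z - indicator {..x} z * centred z \<partial>lborel)"
    unfolding I_eq by (subst Bochner_Integration.integral_diff) (auto intro: centred_set_int)
  also have "\<dots> = (\<integral>z. indicator {x<..y} z * centred z \<partial>lborel)"
    using assms by (intro Bochner_Integration.integral_cong) (auto simp: indicator_def)
  also have "\<dots> = (\<integral>z. indicator {x..y} z * centred z \<partial>lborel)"
    by (intro integral_cong_AE borel_measurable_integrable centred_set_int)
      (use AE_lborel_singleton[of x] in \<open>auto simp: indicator_def elim!: eventually_mono\<close>)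
  also have "\<dots> = (LINT z:{x..y}|lborel. centred z)"
    by (simp add: set_lebesgue_integral_def)
  also have "\<dots> = integral {x..y} centred"
    by (intro set_borel_integral_eq_integral(2)) (simp add: set_integrable_def centred_set_int)
  finally show ?thesis .
qed

text \<open>The set integral over \<open>{..x}\<close> is reduced to a Henstock-Kurzweil integral over a compact interval, for
  which the fundamental theorem of calculus is available.\<close>

lemma I_deriv: "(I has_real_derivative centred x) (at x)"
proof -
  have "((\<lambda>u. I (x - 1) + integral {x-1..u} centred) has_real_derivative centred x) (at x within {x-1..x+1})"
    by (auto intro!: derivative_eq_intros integral_has_real_derivative centred_cont)
  then have "(I has_real_derivative centred x) (at x within {x-1..x+1})"
    by (rule has_field_derivative_transform_within[where d=1])
      (auto simp: I_diff[symmetric])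
  then show ?thesis
    by (simp add: at_within_Icc_at)
qed

lemma I_bot: "(I \<longlongrightarrow> 0) at_bot"
proof -
  have "((\<lambda>x. \<integral>y. indicator {..-x} y * centred y \<partial>lborel) \<longlongrightarrow> integral\<^sup>L (lborel :: real measure) (\<lambda>y. 0)) at_top"
  proof (rule integral_dominated_convergence_at_top[where w="\<lambda>y. norm (centred y)"])
    show "AE y in lborel. ((\<lambda>x. indicator {..-x} y * centred y) \<longlongrightarrow> 0) at_top"
    proof (rule AE_I2)
      fix y
      have "eventually (\<lambda>x. 0 = indicator {..-x} y * centred y) at_top"
        using eventually_gt_at_top[of "-y"] by eventually_elim auto
      then show "((\<lambda>x. indicator {..-x} y * centred y) \<longlongrightarrow> 0) at_top"
        by (rule Lim_transform_eventually[OF tendsto_const])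
    qed
    show "integrable lborel (\<lambda>y. norm (centred y))" using centred_int by auto
    show "(\<lambda>y. indicator {..-x} y * centred y) \<in> borel_measurable lborel" for x
      by (intro borel_measurable_integrable centred_set_int) auto
    show "\<forall>\<^sub>F x in at_top. AE y in lborel. norm (indicator {..-x} y * centred y) \<le> norm (centred y)"
      by (auto simp: indicator_def)
  qed auto
  then show ?thesis
    by (simp add: filterlim_at_bot_mirror I_eq)
qed

lemma I_top: "(I \<longlongrightarrow> 0) at_top"
proof -
  have "((\<lambda>x. \<integral>y. indicator {..x} y * centred y \<partial>lborel) \<longlongrightarrow> (\<integral>y. centred y \<partial>lborel)) at_top"
  proof (rule integral_dominated_convergence_at_top[where w="\<lambda>y. norm (centred y)"])
    show "AE y in lborel. ((\<lambda>x. indicator {..x} y * centred y) \<longlongrightarrow> centred y) at_top"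
    proof (rule AE_I2)
      fix y
      have "eventually (\<lambda>x. centred y = indicator {..x} y * centred y) at_top"
        using eventually_ge_at_top[of "y"] by eventually_elim auto
      then show "((\<lambda>x. indicator {..x} y * centred y) \<longlongrightarrow> centred y) at_top"
        by (rule Lim_transform_eventually[OF tendsto_const])
    qed
    show "integrable lborel (\<lambda>y. norm (centred y))" using centred_int by auto
    show "(\<lambda>y. indicator {..x} y * centred y) \<in> borel_measurable lborel" for x
      by (intro borel_measurable_integrable centred_set_int) auto
    show "\<forall>\<^sub>F x in at_top. AE y in lborel. norm (indicator {..x} y * centred y) \<le> norm (centred y)"
      by (auto simp: indicator_def)
    show "centred \<in> borel_measurable lborel" using centred_int by auto
  qed
  then show ?thesis
    by (simp add: centred_total I_eq [symmetric])
qed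

lemma stein_deriv:
  "(stein_solution h has_real_derivative x * stein_solution h x + (h x - E)) (at x)"
  unfolding stein_solution_def [abs_def]
  by (rule derivative_eq_intros I_deriv phi_deriv phi_pos[THEN less_imp_neq, symmetric] refl)+
     (use phi_pos[of x] in \<open>auto simp: field_simps centred_def\<close>)

lemma stein_deriv2:
  "((\<lambda>x. x * stein_solution h x + (h x - E)) has_real_derivative
     stein_solution h x + x * (x * stein_solution h x + (h x - E)) + h' x) (at x)"
  by (rule derivative_eq_intros stein_deriv deriv refl)+ (simp add: field_simps)

text \<open>The quantity \<open>f + x f' = (1 + x\<^sup>2) f + x (h - E)\<close>, divided by \<open>1 + x\<^sup>2\<close> and multiplied by \<open>\<phi>\<close>.  In
  this normalization its derivative has a sign that can be read off when \<open>h\<close> is monotone, because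
  \<open>(x \<phi>(x) / (1 + x\<^sup>2))' = - \<phi>(x) + 2 \<phi>(x) / (1 + x\<^sup>2)\<^sup>2\<close> cancels the derivative of \<open>I\<close>.\<close>

definition sign_primitive :: "real \<Rightarrow> real" where "sign_primitive x = I x + (x / (1 + x\<^sup>2)) * centred x"

lemma one_plus_sq: "1 + (x::real)\<^sup>2 \<noteq> 0" "0 < 1 + (x::real)\<^sup>2"
  by (smt (verit) zero_le_power2)+

lemma centred_deriv: "(centred has_real_derivative (h' x - x * (h x - E)) * \<phi> x) (at x)"
  unfolding centred_def [abs_def]
  by (rule derivative_eq_intros deriv phi_deriv refl)+ (simp add: field_simps)

lemma sign_primitive_deriv:
  "(sign_primitive has_real_derivative (2 * (h x - E) / (1 + x\<^sup>2)\<^sup>2 + x / (1 + x\<^sup>2) * h' x) * \<phi> x) (at x)"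
proof -
  have "(sign_primitive has_real_derivative
     centred x + ((1 * (1 + x\<^sup>2) - x * (2 * x)) / ((1 + x\<^sup>2) * (1 + x\<^sup>2)) * centred x
       + (h' x - x * (h x - E)) * \<phi> x * (x / (1 + x\<^sup>2)))) (at x)"
    unfolding sign_primitive_def [abs_def]
    by (rule derivative_eq_intros centred_deriv I_deriv one_plus_sq refl)+ (simp add: one_plus_sq)
  also have "centred x + ((1 * (1 + x\<^sup>2) - x * (2 * x)) / ((1 + x\<^sup>2) * (1 + x\<^sup>2)) * centred x
       + (h' x - x * (h x - E)) * \<phi> x * (x / (1 + x\<^sup>2)))
     = (2 * (h x - E) / (1 + x\<^sup>2)\<^sup>2 + x / (1 + x\<^sup>2) * h' x) * \<phi> x"
    unfolding centred_def
    apply (simp add: divide_simps one_plus_sq)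
    apply (simp add: power2_eq_square algebra_simps)
    done
  finally show ?thesis .
qed

lemma sign_primitive_lim: "(sign_primitive \<longlongrightarrow> 0) at_top" "(sign_primitive \<longlongrightarrow> 0) at_bot"
proof -
  have bd: "norm ((x / (1 + x\<^sup>2)) * centred x) \<le> ((c + \<bar>E\<bar>) + d * \<bar>x\<bar>) * \<phi> x" for x
  proof -
    have "\<bar>x\<bar> \<le> 1 + x\<^sup>2"
      using zero_le_power2[of "\<bar>x\<bar> - 1"] abs_ge_zero[of x] by (simp add: power2_diff)
    then have 1: "\<bar>x / (1 + x\<^sup>2)\<bar> \<le> 1"
      using one_plus_sq[of x] by (simp add: abs_divide)
    have "\<bar>h x - E\<bar> \<le> c + \<bar>E\<bar> + d * \<bar>x\<bar>" using growth[of x] by linarith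
    then have 2: "\<bar>centred x\<bar> \<le> ((c + \<bar>E\<bar>) + d * \<bar>x\<bar>) * \<phi> x"
      unfolding centred_def abs_mult by (simp add: mult_right_mono)
    show ?thesis
      using mult_mono[OF 1 2] by (simp add: abs_mult)
  qed
  have "((\<lambda>x. (x / (1 + x\<^sup>2)) * centred x) \<longlongrightarrow> 0) at_top"
    by (rule Lim_null_comparison[OF always_eventually phi_linear_top]) (use bd in auto)
  from tendsto_add[OF I_top this] show "(sign_primitive \<longlongrightarrow> 0) at_top" by (simp add: sign_primitive_def[abs_def])
  have "((\<lambda>x. (x / (1 + x\<^sup>2)) * centred x) \<longlongrightarrow> 0) at_bot"
    by (rule Lim_null_comparison[OF always_eventually phi_linear_bot]) (use bd in auto)
  from tendsto_add[OF I_bot this] show "(sign_primitive \<longlongrightarrow> 0) at_bot" by (simp add: sign_primitive_def[abs_def])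
qed

end

text \<open>Estimates for Lipschitz \<open>h\<close> reduce to sign statements for monotone \<open>h\<close>: the functions \<open>x + h\<close> and
  \<open>x - h\<close> are monotone, the solution is linear in \<open>h\<close>, and for \<open>h(x) = x\<close> it is the constant \<open>-1\<close>.\<close>

locale monotone_test = smooth_test +
  assumes nonneg': "\<And>x. 0 \<le> h' x"
begin

lemma h_mono: "x \<le> y \<Longrightarrow> h x \<le> h y"
  using deriv nonneg' by (metis DERIV_nonneg_imp_nondecreasing)

text \<open>Left of the point where \<open>h\<close> crosses its mean the integrand is nonpositive; right of it, the integral
  increases to its limit \<open>0\<close>.\<close>

lemma I_nonpos: "I x \<le> 0"
proof (cases "h x \<le> E")
  case True
  have "h y \<le> E" if "y \<le> x" for y using h_mono[OF that] True by simp
  note * = this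
  have "(\<integral>y. indicator {..x} y * centred y \<partial>lborel) \<le> integral\<^sup>L (lborel :: real measure) (\<lambda>y. 0)"
    by (intro integral_mono centred_set_int)
      (use * in \<open>auto simp: centred_def indicator_def mult_nonpos_nonneg\<close>)
  then show ?thesis by (simp add: I_eq)
next
  case False
  then have *: "h y \<ge> E" if "x \<le> y" for y using h_mono[OF that] by simp
  have "0 \<le> centred y" if "x \<le> y" for y
    using *[OF that] by (simp add: centred_def)
  then have "I x \<le> I y" if "x \<le> y" for y
    using DERIV_nonneg_imp_nondecreasing[OF that, of I] I_deriv by (meson)
  then show ?thesis
    by (intro tendsto_lowerbound[OF I_top] eventually_mono[OF eventually_ge_at_top[of x]]) auto
qed

text \<open>If \<open>x\<close> and \<open>h(x) - E\<close> have opposite signs, both summands are nonpositive.  Otherwise they keep their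
  common sign on the whole half line that starts at \<open>x\<close> and leads away from \<open>0\<close>; there the primitive is
  monotone, and it vanishes at infinity.\<close>

lemma sign_primitive_nonpos: "sign_primitive x \<le> 0"
proof -
  consider "0 \<le> x \<and> h x \<le> E \<or> x \<le> 0 \<and> E \<le> h x" | "0 \<le> x" "E \<le> h x" | "x \<le> 0" "h x \<le> E"
    by linarith
  then show ?thesis
  proof cases
    case 1
    then have "x * (h x - E) \<le> 0"
      by (auto intro: mult_nonneg_nonpos mult_nonpos_nonneg)
    then have "x / (1 + x\<^sup>2) * centred x \<le> 0"
      using one_plus_sq[of x]
      by (simp add: centred_def divide_le_0_iff mult_le_0_iff zero_le_mult_iff) auto
    then show ?thesis using I_nonpos[of x] by (simp add: sign_primitive_def)
  next
    case 2
    have "sign_primitive x \<le> sign_primitive y" if "x \<le> y" for y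
    proof (rule DERIV_nonneg_imp_nondecreasing[OF that])
      fix z assume z: "x \<le> z" "z \<le> y"
      then have "0 \<le> (2 * (h z - E) / (1 + z\<^sup>2)\<^sup>2 + z / (1 + z\<^sup>2) * h' z) * \<phi> z"
        using 2 h_mono[of x z] nonneg'[of z] one_plus_sq[of z] by auto
      then show "\<exists>D. (sign_primitive has_real_derivative D) (at z) \<and> 0 \<le> D" using sign_primitive_deriv by blast
    qed
    then show ?thesis
      by (intro tendsto_lowerbound[OF sign_primitive_lim(1)] eventually_mono[OF eventually_ge_at_top[of x]]) auto
  next
    case 3
    have "sign_primitive x \<le> sign_primitive y" if "y \<le> x" for y
    proof (rule DERIV_nonpos_imp_nonincreasing[OF that])
      fix z assume z: "y \<le> z" "z \<le> x"
      have "2 * (h z - E) / (1 + z\<^sup>2)\<^sup>2 \<le> 0" "z / (1 + z\<^sup>2) * h' z \<le> 0"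
        using 3 z h_mono[of z x] nonneg'[of z] one_plus_sq[of z]
        by (auto simp: divide_le_0_iff mult_le_0_iff)
      then have "(2 * (h z - E) / (1 + z\<^sup>2)\<^sup>2 + z / (1 + z\<^sup>2) * h' z) * \<phi> z \<le> 0"
        by (simp add: mult_nonpos_nonneg)
      then show "\<exists>D. (sign_primitive has_real_derivative D) (at z) \<and> D \<le> 0" using sign_primitive_deriv by blast
    qed
    then show ?thesis
      by (intro tendsto_lowerbound[OF sign_primitive_lim(2)] eventually_mono[OF eventually_le_at_bot[of x]]) auto
  qed
qed

lemma stein_nonpos: "stein_solution h x \<le> 0"
  unfolding stein_solution_def using I_nonpos[of x] by (simp add: divide_le_0_iff)

lemma stein_xprime_nonpos: "stein_solution h x + x * (x * stein_solution h x + (h x - E)) \<le> 0"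
proof -
  have "stein_solution h x + x * (x * stein_solution h x + (h x - E)) = (1 + x\<^sup>2) * sign_primitive x / \<phi> x"
  proof -
    have "sign_primitive x = \<phi> x * (stein_solution h x + x / (1 + x\<^sup>2) * (h x - E))"
      unfolding stein_solution_def sign_primitive_def centred_def using phi_pos[of x] by (simp add: field_simps)
    then have "(1 + x\<^sup>2) * sign_primitive x / \<phi> x = (1 + x\<^sup>2) * (stein_solution h x + x / (1 + x\<^sup>2) * (h x - E))"
      using phi_pos[of x] by simp
    also have "\<dots> = (1 + x\<^sup>2) * stein_solution h x + x * (h x - E)"
      using one_plus_sq[of x] by (simp add: distrib_left)
    finally show ?thesis by (simp add: power2_eq_square algebra_simps)
  qed
  also have "\<dots> \<le> 0"
    using sign_primitive_nonpos[of x] one_plus_sq[of x] phi_pos[of x] by (simp add: divide_le_0_iff mult_le_0_iff)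
  finally show ?thesis .
qed

end

lemma normal_partial_id: "normal_partial (\<lambda>x. x) x = - \<phi> x"
proof -
  interpret smooth_test "\<lambda>x. x" "\<lambda>x. 1" 0 1
    by unfold_locales (auto intro!: derivative_eq_intros)
  have E0: "E = 0"
    by (subst integral_density) (use std_normal_moment_odd[of 0] in \<open>auto dest: has_bochner_integral_integral_eq\<close>)
  have "((\<lambda>x. I x + \<phi> x) has_real_derivative 0) (at y)" for y
    by (rule derivative_eq_intros I_deriv phi_deriv)+ (simp add: centred_def E0)
  then obtain C where C: "\<And>x. I x + \<phi> x = C"
    using DERIV_isconst_all by metis
  have "((\<lambda>x. I x + \<phi> x) \<longlongrightarrow> 0 + 0) at_top"
    using tendsto_add[OF I_top phi_linear_top[of 1 0]] by simp
  then have "C = 0" unfolding C by (simp add: tendsto_const_iff)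
  then show ?thesis using C[of x] by simp
qed

lemma normal_partial_add:
  assumes "smooth_test h h' c d" "smooth_test g g' c' d'"
  shows "normal_partial (\<lambda>x. h x + g x) x = normal_partial h x + normal_partial g x"
    and "(\<integral>z. h z + g z \<partial>\<gamma>) = (\<integral>z. h z \<partial>\<gamma>) + (\<integral>z. g z \<partial>\<gamma>)"
proof -
  interpret h: smooth_test h h' c d by fact
  interpret g: smooth_test g g' c' d' by fact
  show 1: "(\<integral>z. h z + g z \<partial>\<gamma>) = (\<integral>z. h z \<partial>\<gamma>) + (\<integral>z. g z \<partial>\<gamma>)"
    using h.int_phi g.int_phi
    by (subst Bochner_Integration.integral_add) (auto simp: integrable_density mult.commute)
  have "normal_partial (\<lambda>x. h x + g x) x =
      (\<integral>y. indicator {..x} y * h.centred y + indicator {..x} y * g.centred y \<partial>lborel)"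
    unfolding normal_partial_def 1 h.centred_def g.centred_def
    by (intro Bochner_Integration.integral_cong) (auto simp: algebra_simps)
  also have "\<dots> = normal_partial h x + normal_partial g x"
    unfolding h.I_eq g.I_eq
    by (intro Bochner_Integration.integral_add h.centred_set_int g.centred_set_int) auto
  finally show "normal_partial (\<lambda>x. h x + g x) x = normal_partial h x + normal_partial g x" .
qed

lemma normal_partial_minus:
  "normal_partial (\<lambda>x. - h x) x = - normal_partial h x"
proof -
  have "(\<integral>y. indicator {..x} y * ((- h y - (\<integral>z. - h z \<partial>\<gamma>)) * \<phi> y) \<partial>lborel)
      = (\<integral>y. - (indicator {..x} y * ((h y - (\<integral>z. h z \<partial>\<gamma>)) * \<phi> y)) \<partial>lborel)"
    by (intro Bochner_Integration.integral_cong refl, subst Bochner_Integration.integral_minus)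
      (simp only: algebra_simps mult_minus_left mult_minus_right minus_diff_eq)
  then show ?thesis
    unfolding normal_partial_def by simp
qed

text \<open>Both bounds come from the sign statements for \<open>x + h\<close> and \<open>x - h\<close>, whose solutions are \<open>-1 + f\<close> and
  \<open>-1 - f\<close>: these give \<open>\<bar>f\<bar> \<le> 1\<close> and \<open>\<bar>f + x f'\<bar> \<le> 1\<close>, and \<open>f'' = f + x f' + h'\<close>.\<close>

lemma stein_solution_bounds:
  fixes h h' :: "real \<Rightarrow> real"
  assumes deriv: "\<And>x. (h has_real_derivative h' x) (at x)"
    and cont': "continuous_on UNIV h'"
    and bound: "\<And>x. \<bar>h' x\<bar> \<le> 1"
  obtains f f' f'' :: "real \<Rightarrow> real"
  where "\<And>x. (f has_real_derivative f' x) (at x)" "\<And>x. (f' has_real_derivative f'' x) (at x)"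
    "\<And>x. \<bar>f x\<bar> \<le> 1" "\<And>x. \<bar>f'' x\<bar> \<le> 2"
    "\<And>x. f' x - x * f x = h x - (\<integral>z. h z \<partial>\<gamma>)"
proof -
  have lip: "\<bar>h x - h y\<bar> \<le> \<bar>x - y\<bar>" for x y
    using field_differentiable_bound[of UNIV h h' 1 x y] deriv bound by auto
  have growth: "\<bar>h x\<bar> \<le> \<bar>h 0\<bar> + 1 * \<bar>x\<bar>" for x
    using lip[of x 0] by simp
  interpret h: smooth_test h h' "\<bar>h 0\<bar>" 1
    by unfold_locales (use deriv cont' growth in auto)
  interpret id: smooth_test "\<lambda>x. x" "\<lambda>x. 1" 0 1
    by unfold_locales (auto intro!: derivative_eq_intros)
  interpret m: smooth_test "\<lambda>x. - h x" "\<lambda>x. - h' x" "\<bar>h 0\<bar>" 1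
    by unfold_locales (use growth cont' deriv in \<open>auto intro!: derivative_eq_intros continuous_intros\<close>)
  have bd: "\<bar>x + h x\<bar> \<le> \<bar>h 0\<bar> + 2 * \<bar>x\<bar>" "\<bar>x + - h x\<bar> \<le> \<bar>h 0\<bar> + 2 * \<bar>x\<bar>" for x
    using growth[of x] by linarith+
  have nn: "0 \<le> 1 + h' x" "0 \<le> 1 - h' x" for x
    using bound[of x] by linarith+
  interpret p: monotone_test "\<lambda>x. x + h x" "\<lambda>x. 1 + h' x" "\<bar>h 0\<bar>" 2
    by unfold_locales (use bd cont' deriv nn in \<open>auto intro!: derivative_eq_intros continuous_intros\<close>)
  interpret q: monotone_test "\<lambda>x. x + - h x" "\<lambda>x. 1 - h' x" "\<bar>h 0\<bar>" 2
    by unfold_locales (use bd cont' deriv nn in \<open>auto intro!: derivative_eq_intros continuous_intros\<close>)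
  let ?f = "stein_solution h"
  let ?E = "\<integral>z. h z \<partial>\<gamma>"
  have E0: "(\<integral>z. z \<partial>\<gamma>) = 0"
    by (subst integral_density) (use std_normal_moment_odd[of 0] in \<open>auto dest: has_bochner_integral_integral_eq\<close>)
  have Em: "(\<integral>z. - h z \<partial>\<gamma>) = - ?E" by simp
  have sp: "stein_solution (\<lambda>x. x + h x) x = - 1 + ?f x" for x
    using normal_partial_add(1)[OF id.smooth_test_axioms h.smooth_test_axioms, of x] phi_pos[of x]
    by (simp add: stein_solution_def normal_partial_id field_simps)
  have sq: "stein_solution (\<lambda>x. x + - h x) x = - 1 - ?f x" for x
    using normal_partial_add(1)[OF id.smooth_test_axioms m.smooth_test_axioms, of x] phi_pos[of x]
      normal_partial_minus[of h x]
    by (simp add: stein_solution_def normal_partial_id field_simps)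
  have Ep: "p.E = ?E"
    using normal_partial_add(2)[OF id.smooth_test_axioms h.smooth_test_axioms] E0 by simp
  have Eq: "q.E = - ?E"
    using normal_partial_add(2)[OF id.smooth_test_axioms m.smooth_test_axioms] E0 by simp
  let ?f' = "\<lambda>x. x * ?f x + (h x - ?E)"
  have f1: "\<bar>?f x\<bar> \<le> 1" for x
    using p.stein_nonpos[of x] q.stein_nonpos[of x] unfolding sp sq by linarith
  have v: "\<bar>?f x + x * ?f' x\<bar> \<le> 1" for x
  proof -
    have "- 1 + (?f x + x * ?f' x) \<le> 0"
      using p.stein_xprime_nonpos[of x] by (simp only: sp Ep) (simp add: algebra_simps)
    moreover have "- 1 - (?f x + x * ?f' x) \<le> 0"
      using q.stein_xprime_nonpos[of x] by (simp only: sq Eq) (simp add: algebra_simps)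
    ultimately show ?thesis by linarith
  qed
  show thesis
  proof (rule that[of ?f ?f' "\<lambda>x. ?f x + x * ?f' x + h' x"])
    show "\<bar>?f x + x * ?f' x + h' x\<bar> \<le> 2" for x
      using v[of x] bound[of x] by linarith
  qed (use h.stein_deriv h.stein_deriv2 f1 in auto)
qed

text \<open>Moving averages \<open>(H(x + e) - H(x - e)) / (2 e)\<close>, with \<open>H\<close> a primitive of \<open>h\<close>.\<close>

lemma lipschitz_smoothing:
  fixes h :: "real \<Rightarrow> real"
  assumes h: "1-lipschitz_on UNIV h" and e: "0 < e"
  obtains g g' where "\<And>x. (g has_real_derivative g' x) (at x)" "continuous_on UNIV g'"
    "\<And>x. \<bar>g' x\<bar> \<le> 1" "\<And>x. \<bar>g x - h x\<bar> \<le> e"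
proof -
  have lip: "\<bar>h x - h y\<bar> \<le> \<bar>x - y\<bar>" for x y
    using lipschitz_onD[OF h, of x y] by (simp add: dist_real_def)
  have cont: "continuous_on UNIV h" using h by (rule lipschitz_on_continuous_on)
  then have "isCont h x" for x by (simp add: continuous_on_eq_continuous_at)
  then obtain H where H: "\<And>x. (H has_real_derivative h x) (at x)"
    using einterval_antiderivative[of "-\<infinity>" "\<infinity>" h]
    by (auto simp: has_real_derivative_iff_has_vector_derivative)
  let ?g = "\<lambda>x. (H (x + e) - H (x - e)) / (2 * e)"
  let ?g' = "\<lambda>x. (h (x + e) - h (x - e)) / (2 * e)"
  show thesis
  proof (rule that[of ?g ?g'])
    fix x
    have 1: "((\<lambda>x. H (x + e)) has_real_derivative h (x + e)) (at x)"
      using DERIV_shift[of H "h (x + e)" x e] H by simp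
    have 2: "((\<lambda>x. H (x - e)) has_real_derivative h (x - e)) (at x)"
      using DERIV_shift[of H "h (x - e)" x "-e"] H by simp
    show "(?g has_real_derivative ?g' x) (at x)"
      by (rule DERIV_cdivide DERIV_diff 1 2)+
    show "\<bar>?g' x\<bar> \<le> 1"
      using lip[of "x + e" "x - e"] e by (simp add: abs_divide)
    obtain z where z: "x - e < z" "z < x + e" "H (x + e) - H (x - e) = (x + e - (x - e)) * h z"
      using MVT2[of "x - e" "x + e" H h] e H by auto
    have "?g x = h z" using z e by simp
    then show "\<bar>?g x - h x\<bar> \<le> e" using lip[of z x] z by simp
  next
    show "continuous_on UNIV ?g'"
      by (intro continuous_intros continuous_on_compose2[OF cont]) (use e in auto)
  qed
qed

lemma normal_integrable_id: "integrable \<gamma> (\<lambda>x. x)"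
proof -
  have "integrable lborel (\<lambda>x. \<phi> x * x)"
    using integrable_std_normal_moment[of 1] by simp
  then show ?thesis
    by (intro integrable_density[THEN iffD2]) (auto simp: real_scaleR_def)
qed

lemma integrable_lipschitz:
  fixes h :: "real \<Rightarrow> real"
  assumes "1-lipschitz_on UNIV h" "finite_measure M" "sets M = sets borel" "integrable M (\<lambda>x. x)"
  shows "integrable M h"
proof -
  interpret finite_measure M by fact
  have "h \<in> borel_measurable borel"
    using lipschitz_on_continuous_on[OF assms(1)] by (rule borel_measurable_continuous_onI)
  then have m: "h \<in> borel_measurable M"
    using measurable_cong_sets[OF assms(3) refl] by blast
  show ?thesis
  proof (rule Bochner_Integration.integrable_bound[OF _ m])
    show "integrable M (\<lambda>x. \<bar>h 0\<bar> + \<bar>x\<bar>)"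
      using assms(4) by (intro Bochner_Integration.integrable_add integrable_abs integrable_const)
    show "AE x in M. norm (h x) \<le> norm (\<bar>h 0\<bar> + \<bar>x\<bar>)"
    proof (rule AE_I2)
      fix x
      have "\<bar>h x - h 0\<bar> \<le> \<bar>x\<bar>"
        using lipschitz_onD[OF assms(1), of x 0] by (simp add: dist_real_def)
      then show "norm (h x) \<le> norm (\<bar>h 0\<bar> + \<bar>x\<bar>)" unfolding real_norm_def by linarith
    qed
  qed
qed

text \<open>Stein's method: a bound on \<open>E (f'(Z) - Z f(Z))\<close> that is uniform over functions with the regularity of
  the solutions of Stein's equation bounds the Wasserstein distance of the law of \<open>Z\<close> to \<open>\<gamma>\<close>.\<close>

proposition wasserstein_normal_le:
  fixes M :: "real measure"
  assumes "prob_space M" "sets M = sets borel" "integrable M (\<lambda>x. x\<^sup>2)"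
    and stein: "\<And>f f' f'' :: real \<Rightarrow> real.
      (\<And>x. (f has_real_derivative f' x) (at x)) \<Longrightarrow> (\<And>x. (f' has_real_derivative f'' x) (at x)) \<Longrightarrow>
      (\<And>x. \<bar>f x\<bar> \<le> 1) \<Longrightarrow> (\<And>x. \<bar>f'' x\<bar> \<le> 2) \<Longrightarrow>
      \<bar>\<integral>x. f' x - x * f x \<partial>M\<bar> \<le> c"
  shows "wasserstein M \<gamma> \<le> ennreal c"
  unfolding wasserstein_def
proof (intro SUP_least ennreal_leI, elim CollectE)
  fix h :: "real \<Rightarrow> real" assume h: "1-lipschitz_on UNIV h"
  interpret M: prob_space M by fact
  interpret G: prob_space \<gamma> by (rule prob_space_normal_density) simp
  have [measurable_cong]: "sets M = sets borel" by fact
  have id: "integrable M (\<lambda>x. x)"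
    by (rule M.square_integrable_imp_integrable) (use assms in auto)
  have "\<bar>(\<integral>x. h x \<partial>M) - (\<integral>x. h x \<partial>\<gamma>)\<bar> \<le> c + e" if e: "0 < e" for e
  proof -
    obtain g g' where g: "\<And>x. (g has_real_derivative g' x) (at x)" "continuous_on UNIV g'"
      "\<And>x. \<bar>g' x\<bar> \<le> 1" "\<And>x. \<bar>g x - h x\<bar> \<le> e / 2"
      using lipschitz_smoothing[OF h half_gt_zero[OF e]] by blast
    obtain f f' f'' where f: "\<And>x. (f has_real_derivative f' x) (at x)"
      "\<And>x. (f' has_real_derivative f'' x) (at x)" "\<And>x. \<bar>f x\<bar> \<le> 1" "\<And>x. \<bar>f'' x\<bar> \<le> 2"
      "\<And>x. f' x - x * f x = g x - (\<integral>z. g z \<partial>\<gamma>)"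
      using stein_solution_bounds[OF g(1-3)] by blast
    have "1-lipschitz_on UNIV g"
      using field_differentiable_bound[of UNIV g g' 1] g(1,3)
      by (intro lipschitz_onI) (auto simp: dist_real_def)
    note int = integrable_lipschitz[OF this M.finite_measure_axioms assms(2) id]
      integrable_lipschitz[OF this G.finite_measure_axioms _ normal_integrable_id]
      integrable_lipschitz[OF h M.finite_measure_axioms assms(2) id]
      integrable_lipschitz[OF h G.finite_measure_axioms _ normal_integrable_id]
    have "(\<integral>x. f' x - x * f x \<partial>M) = (\<integral>x. g x \<partial>M) - (\<integral>x. g x \<partial>\<gamma>)"
      unfolding f(5) using int by (subst Bochner_Integration.integral_diff) (auto simp: M.prob_space)
    then have 1: "\<bar>(\<integral>x. g x \<partial>M) - (\<integral>x. g x \<partial>\<gamma>)\<bar> \<le> c"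
      using stein[OF f(1-4)] by simp
    have 2: "\<bar>(\<integral>x. h x \<partial>N) - (\<integral>x. g x \<partial>N)\<bar> \<le> e / 2"
      if "prob_space N" "integrable N g" "integrable N h" for N
    proof -
      interpret N: prob_space N by fact
      have "\<bar>\<integral>x. h x - g x \<partial>N\<bar> \<le> (\<integral>x. \<bar>h x - g x\<bar> \<partial>N)" by (rule integral_abs_bound)
      also have "\<dots> \<le> (\<integral>x. e / 2 \<partial>N)"
        using that g(4) by (intro integral_mono) (auto simp: abs_minus_commute)
      finally show ?thesis using that by (simp add: N.prob_space)
    qed
    show ?thesis
      using 1 2[OF M.prob_space_axioms int(1,3)] 2[OF G.prob_space_axioms int(2,4)] by simp argo
  qed
  then show "\<bar>(\<integral>x. h x \<partial>M) - (\<integral>x. h x \<partial>\<gamma>)\<bar> \<le> c" by (rule field_le_epsilon)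
qed

section \<open>From characteristic functions to a Stein identity\<close>

text \<open>Uniqueness of characteristic functions for the image under \<open>Z\<close> of a finite signed measure with
  density \<open>w\<close>.  The value at \<open>u = 0\<close> shows that the positive and the negative part of \<open>w\<close> have the same
  mass, so that both can be normalized to probability densities, to which Levy's uniqueness theorem
  applies.\<close>

lemma signed_char_unique:
  fixes w Z :: "'a \<Rightarrow> real" and f :: "real \<Rightarrow> real"
  assumes w: "integrable M w" and Z[measurable]: "Z \<in> borel_measurable M"
    and char: "\<And>u. (CLINT x|M. of_real (w x) * iexp (u * Z x)) = 0"
    and f[measurable]: "f \<in> borel_measurable borel" and wf: "integrable M (\<lambda>x. w x * f (Z x))"
  shows "(\<integral>x. w x * f (Z x) \<partial>M) = 0"
proof -
  have [measurable]: "w \<in> borel_measurable M" using w by auto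
  define p n where "p x = max 0 (w x)" and "n x = max 0 (- w x)" for x
  have [measurable]: "p \<in> borel_measurable M" "n \<in> borel_measurable M"
    unfolding p_def n_def by measurable
  have w_eq: "w x = p x - n x" for x unfolding p_def n_def by auto
  have pn: "0 \<le> p x" "0 \<le> n x" "p x \<le> \<bar>w x\<bar>" "n x \<le> \<bar>w x\<bar>" for x
    unfolding p_def n_def by auto
  have int: "integrable M (\<lambda>x. p x *\<^sub>R g (Z x))" "integrable M (\<lambda>x. n x *\<^sub>R g (Z x))"
    if "g \<in> borel_measurable borel" "integrable M (\<lambda>x. w x *\<^sub>R g (Z x))"
    for g :: "real \<Rightarrow> 'b::{banach,second_countable_topology}"
  proof -
    note [measurable] = that(1)
    show "integrable M (\<lambda>x. p x *\<^sub>R g (Z x))" "integrable M (\<lambda>x. n x *\<^sub>R g (Z x))"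
      by (rule Bochner_Integration.integrable_bound[OF that(2)]; use pn in \<open>auto intro!: mult_right_mono\<close>)+
  qed
  have int1: "integrable M p" "integrable M n"
    using int[of "\<lambda>_. 1::real"] w by auto
  define c where "c = (\<integral>x. p x \<partial>M)"
  have c_n: "c = (\<integral>x. n x \<partial>M)"
  proof -
    have "(CLINT x|M. of_real (w x)) = 0" using char[of 0] by simp
    then have "(\<integral>x. w x \<partial>M) = 0" by (simp add: integral_complex_of_real)
    then show ?thesis using int1 by (simp add: w_eq c_def)
  qed
  have c0: "0 \<le> c" unfolding c_def using pn by auto
  show ?thesis
  proof (cases "c = 0")
    case True
    have "AE x in M. p x = 0" "AE x in M. n x = 0"
      using True c_n integral_nonneg_eq_0_iff_AE[OF int1(1)] integral_nonneg_eq_0_iff_AE[OF int1(2)] pn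
      by (auto simp: c_def)
    then have "AE x in M. w x * f (Z x) = 0" by eventually_elim (auto simp: w_eq)
    then show ?thesis by (rule integral_eq_zero_AE)
  next
    case False
    then have c: "0 < c" using c0 by simp
    have law: "real_distribution (distr (density M (\<lambda>x. ennreal (q x / c))) borel Z)"
      and law_int: "\<And>g :: real \<Rightarrow> 'b::{banach,second_countable_topology}. g \<in> borel_measurable borel \<Longrightarrow>
        integral\<^sup>L (distr (density M (\<lambda>x. ennreal (q x / c))) borel Z) g = (\<integral>x. q x *\<^sub>R g (Z x) \<partial>M) /\<^sub>R c"
      if [measurable]: "q \<in> borel_measurable M" and q: "\<And>x. 0 \<le> q x" "integrable M q" "(\<integral>x. q x \<partial>M) = c" for q
    proof -
      have "(\<integral>\<^sup>+x. ennreal (q x / c) \<partial>M) = 1"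
        using q c by (subst nn_integral_eq_integral) auto
      then have "prob_space (density M (\<lambda>x. ennreal (q x / c)))"
        by (intro prob_spaceI) (simp add: emeasure_density cong: nn_integral_cong)
      then show "real_distribution (distr (density M (\<lambda>x. ennreal (q x / c))) borel Z)"
        by (intro prob_space.real_distribution_distr) auto
      show "integral\<^sup>L (distr (density M (\<lambda>x. ennreal (q x / c))) borel Z) g = (\<integral>x. q x *\<^sub>R g (Z x) \<partial>M) /\<^sub>R c"
        if [measurable]: "g \<in> borel_measurable borel" for g :: "real \<Rightarrow> 'b::{banach,second_countable_topology}"
      proof -
        have "integral\<^sup>L (distr (density M (\<lambda>x. ennreal (q x / c))) borel Z) g = (\<integral>x. (q x / c) *\<^sub>R g (Z x) \<partial>M)"
          using q c by (subst integral_distr; simp?) (subst integral_density; simp)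
        also have "\<dots> = (\<integral>x. (1 / c) *\<^sub>R (q x *\<^sub>R g (Z x)) \<partial>M)"
          by (intro Bochner_Integration.integral_cong) (auto simp: field_simps)
        also have "\<dots> = (1 / c) *\<^sub>R (\<integral>x. q x *\<^sub>R g (Z x) \<partial>M)" by (rule integral_scaleR_right)
        finally show ?thesis by (simp only: inverse_eq_divide)
      qed
    qed
    let ?P = "\<lambda>q. distr (density M (\<lambda>x. ennreal (q x / c))) borel Z"
    have "char (?P p) = char (?P n)"
    proof (rule ext)
      fix u
      have "integrable M (\<lambda>x. w x *\<^sub>R iexp (u * Z x))"
        by (rule Bochner_Integration.integrable_bound[OF w]) auto
      have i: "integrable M (\<lambda>x. p x *\<^sub>R iexp (u * Z x))" "integrable M (\<lambda>x. n x *\<^sub>R iexp (u * Z x))"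
        by (rule int[of "\<lambda>z. iexp (u * z)"]; measurable?; fact)+
      have "(\<integral>x. p x *\<^sub>R iexp (u * Z x) \<partial>M) - (\<integral>x. n x *\<^sub>R iexp (u * Z x) \<partial>M) =
          (CLINT x|M. of_real (w x) * iexp (u * Z x))"
        by (subst Bochner_Integration.integral_diff[symmetric, OF i])
          (simp add: w_eq scaleR_conv_of_real left_diff_distrib)
      also have "\<dots> = 0" by (rule char)
      finally have *: "(\<integral>x. p x *\<^sub>R iexp (u * Z x) \<partial>M) = (\<integral>x. n x *\<^sub>R iexp (u * Z x) \<partial>M)" by simp
      show "char (?P p) u = char (?P n) u"
        unfolding char_def using law_int[of p "\<lambda>z. iexp (u * z)"] law_int[of n "\<lambda>z. iexp (u * z)"] pn int1 * c_n
        by (simp add: c_def)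
    qed
    then have "?P p = ?P n"
      using pn int1 c_n by (intro Levy_uniqueness law) (auto simp: c_def)
    then have "integral\<^sup>L (?P p) f = integral\<^sup>L (?P n) f" by simp
    then have "(\<integral>x. p x * f (Z x) \<partial>M) = (\<integral>x. n x * f (Z x) \<partial>M)"
      using law_int[of p f] law_int[of n f] pn int1 c_n c by (simp add: c_def)
    then show ?thesis
      using int[of f] wf by (simp add: w_eq left_diff_distrib)
  qed
qed

lemma norm_iexp_diff: "cmod (iexp a - iexp b) \<le> \<bar>a - b\<bar>"
proof -
  have "iexp a - iexp b = iexp b * (iexp (a - b) - 1)"
    by (simp add: algebra_simps flip: exp_add)
  then show ?thesis
    using iexp_approx1[of "a - b" 0] by (simp add: norm_mult)
qed

lemma has_vector_derivative_iff_quotient: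
  fixes f :: "real \<Rightarrow> 'a::real_normed_vector"
  shows "(f has_vector_derivative D) (at x) \<longleftrightarrow> ((\<lambda>h. (f (x + h) - f x) /\<^sub>R h - D) \<longlongrightarrow> 0) (at 0)"
proof -
  have "norm (f (x + h) - f x - h *\<^sub>R D) / norm h = norm ((f (x + h) - f x) /\<^sub>R h - D)" if "h \<noteq> 0" for h
  proof -
    have "f (x + h) - f x - h *\<^sub>R D = h *\<^sub>R ((f (x + h) - f x) /\<^sub>R h - D)"
      using that by (simp add: scaleR_diff_right)
    then show ?thesis using that by simp
  qed
  then have "((\<lambda>h. norm (f (x + h) - f x - h *\<^sub>R D) / norm h) \<longlongrightarrow> 0) (at 0) \<longleftrightarrow>
      ((\<lambda>h. norm ((f (x + h) - f x) /\<^sub>R h - D)) \<longlongrightarrow> 0) (at 0)"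
    by (intro filterlim_cong refl) (auto simp: eventually_at_filter)
  then show ?thesis
    unfolding has_vector_derivative_def has_derivative_at
    by (simp add: tendsto_norm_zero_iff bounded_linear_scaleR_left)
qed

text \<open>The integrand contains \<open>- 1\<close> so that the statement also covers infinite measures with a first moment,
  such as Levy measures.\<close>

lemma exponent_has_vector_derivative:
  fixes Z :: "'a \<Rightarrow> real"
  assumes Z: "integrable M Z"
  shows "((\<lambda>u. CLINT x|M. (iexp (u * Z x) - 1)) has_vector_derivative
           (CLINT x|M. \<i> * of_real (Z x) * iexp (u * Z x))) (at u)"
proof -
  have [measurable]: "Z \<in> borel_measurable M" using Z by auto
  have i1: "integrable M (\<lambda>x. iexp (v * Z x) - 1)" for v
  proof (rule Bochner_Integration.integrable_bound[of _ "\<lambda>x. v * Z x"])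
    show "AE x in M. cmod (iexp (v * Z x) - 1) \<le> norm (v * Z x)"
      using norm_iexp_diff[of "v * Z _" 0] by simp
  qed (use Z in auto)
  have i2: "integrable M (\<lambda>x. \<i> * of_real (Z x) * iexp (u * Z x))"
    by (rule Bochner_Integration.integrable_bound[OF Z]) (auto simp: norm_mult)
  define r where "r h x = (iexp ((u + h) * Z x) - iexp (u * Z x)) /\<^sub>R h - \<i> * of_real (Z x) * iexp (u * Z x)" for h x
  have r0: "((\<lambda>h. r h x) \<longlongrightarrow> 0) (at 0)" for x
  proof -
    have "((\<lambda>v. iexp (v * Z x)) has_vector_derivative \<i> * of_real (Z x) * iexp (u * Z x)) (at u)"
      by (auto intro!: derivative_eq_intros has_vector_derivative_real_field)
    then show ?thesis
      unfolding has_vector_derivative_iff_quotient r_def by simp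
  qed
  have "((\<lambda>h. CLINT x|M. r h x) \<longlongrightarrow> (CLINT x|M. 0)) (at 0)"
    unfolding tendsto_at_iff_sequentially
  proof (intro allI impI, unfold o_def)
    fix X :: "nat \<Rightarrow> real" assume X: "\<forall>i. X i \<in> UNIV - {0}" "X \<longlonglongrightarrow> 0"
    show "(\<lambda>i. CLINT x|M. r (X i) x) \<longlonglongrightarrow> (CLINT x|M. 0)"
    proof (rule integral_dominated_convergence[where w="\<lambda>x. 2 * \<bar>Z x\<bar>"])
      show "AE x in M. (\<lambda>i. r (X i) x) \<longlonglongrightarrow> 0"
        using r0 X unfolding tendsto_at_iff_sequentially o_def by blast
      show "AE x in M. cmod (r (X i) x) \<le> 2 * \<bar>Z x\<bar>" for i
      proof (rule AE_I2)
        fix x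
        have "cmod ((iexp ((u + X i) * Z x) - iexp (u * Z x)) /\<^sub>R X i) \<le> \<bar>X i * Z x\<bar> / \<bar>X i\<bar>"
        proof -
          have "(u + X i) * Z x - u * Z x = X i * Z x" by (simp add: algebra_simps)
          then show ?thesis
            using norm_iexp_diff[of "(u + X i) * Z x" "u * Z x"] X(1)
            by (simp only: norm_scaleR divide_inverse abs_inverse mult.commute[of _ "inverse _"])
              (intro mult_left_mono, auto)
        qed
        also have "\<dots> = \<bar>Z x\<bar>" using X(1) by (simp add: abs_mult)
        finally have "cmod ((iexp ((u + X i) * Z x) - iexp (u * Z x)) /\<^sub>R X i) \<le> \<bar>Z x\<bar>" .
        moreover have "cmod (\<i> * of_real (Z x) * iexp (u * Z x)) \<le> \<bar>Z x\<bar>" by (simp add: norm_mult)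
        ultimately show "cmod (r (X i) x) \<le> 2 * \<bar>Z x\<bar>"
          unfolding r_def by (intro order_trans[OF norm_triangle_ineq4]) linarith
      qed
      show "(\<lambda>x. r (X i) x) \<in> borel_measurable M" for i unfolding r_def by measurable
    qed (use Z in auto)
  qed
  moreover have "(CLINT x|M. r h x) = ((CLINT x|M. (iexp ((u + h) * Z x) - 1)) - (CLINT x|M. (iexp (u * Z x) - 1))) /\<^sub>R h
      - (CLINT x|M. \<i> * of_real (Z x) * iexp (u * Z x))" for h
  proof -
    have "(CLINT x|M. r h x) = (CLINT x|M. ((iexp ((u + h) * Z x) - 1) - (iexp (u * Z x) - 1)) /\<^sub>R h
        - \<i> * of_real (Z x) * iexp (u * Z x))"
      by (simp add: r_def)
    also have "\<dots> = (CLINT x|M. ((iexp ((u + h) * Z x) - 1) - (iexp (u * Z x) - 1)) /\<^sub>R h)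
        - (CLINT x|M. \<i> * of_real (Z x) * iexp (u * Z x))"
      by (intro Bochner_Integration.integral_diff i2 integrable_scaleR_right
          Bochner_Integration.integrable_diff i1)
    also have "(CLINT x|M. ((iexp ((u + h) * Z x) - 1) - (iexp (u * Z x) - 1)) /\<^sub>R h)
        = ((CLINT x|M. (iexp ((u + h) * Z x) - 1)) - (CLINT x|M. (iexp (u * Z x) - 1))) /\<^sub>R h"
      by (subst Bochner_Integration.integral_diff[symmetric, OF i1 i1]) (rule integral_scaleR_right)
    finally show ?thesis .
  qed
  ultimately show ?thesis
    unfolding has_vector_derivative_iff_quotient by simp
qed

text \<open>The derivative of \<open>char R = exp(\<integral> (iexp(u a) - 1) L(da))\<close> at \<open>u\<close> says that the signed measures
  \<open>x R(dx)\<close> and \<open>(a L(da)) * R\<close>, where \<open>*\<close> is convolution, have the same Fourier transform.  The factor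
  \<open>a = \<bar>a\<bar> sgn(a)\<close> is split so that the product is taken with the finite measure \<open>\<bar>a\<bar> L(da)\<close>; the
  measure \<open>L\<close> itself may have infinite mass at \<open>0\<close>, where Fubini's theorem would fail.\<close>

lemma stein_identity:
  fixes R L :: "real measure" and f :: "real \<Rightarrow> real"
  assumes R: "prob_space R" "sets R = sets borel" "integrable R (\<lambda>x. x)"
    and L: "sets L = sets borel" "integrable L (\<lambda>a. a)"
    and char: "\<And>u. char R u = exp (CLINT a|L. (iexp (u * a) - 1))"
    and f[measurable]: "f \<in> borel_measurable borel" and xf: "integrable R (\<lambda>x. x * f x)"
    and sf: "integrable (density L (\<lambda>a. ennreal \<bar>a\<bar>) \<Otimes>\<^sub>M R) (\<lambda>(a, b). sgn a * f (a + b))"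
  shows "(\<integral>x. x * f x \<partial>R) = (\<integral>(a, b). sgn a * f (a + b) \<partial>(density L (\<lambda>a. ennreal \<bar>a\<bar>) \<Otimes>\<^sub>M R))"
proof -
  interpret R: prob_space R by fact
  note [measurable_cong] = R(2) L(1)
  let ?\<alpha> = "density L (\<lambda>a. ennreal \<bar>a\<bar>)"
  have "(\<integral>\<^sup>+a. ennreal \<bar>a\<bar> \<partial>L) < \<infinity>"
    using L(2) unfolding integrable_iff_bounded by simp
  then interpret A: finite_measure ?\<alpha>
    by (intro finite_measureI) (simp add: emeasure_density cong: nn_integral_cong)
  interpret AR: pair_sigma_finite ?\<alpha> R ..
  interpret AR: finite_measure "?\<alpha> \<Otimes>\<^sub>M R"
    by (rule finite_measure_pair_measure) unfold_locales
  have sgn_int: "integrable (?\<alpha> \<Otimes>\<^sub>M R) (\<lambda>z. of_real (sgn (fst z)) * iexp (u * (fst z + snd z)))" for u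
    by (rule AR.integrable_const_bound[where B=1]) (auto simp: norm_mult sgn_if)
  have key: "(CLINT x|R. of_real x * iexp (u * x)) =
      (CLINT z|?\<alpha> \<Otimes>\<^sub>M R. of_real (sgn (fst z)) * iexp (u * (fst z + snd z)))" for u
  proof -
    let ?D = "CLINT a|L. \<i> * of_real a * iexp (u * a)"
    have "((\<lambda>u. exp (CLINT a|L. (iexp (u * a) - 1))) has_vector_derivative ?D * char R u) (at u)"
      unfolding char
      using field_vector_diff_chain_at[OF exponent_has_vector_derivative[OF L(2), of u] DERIV_exp]
      by (simp add: o_def)
    then have 1: "(char R has_vector_derivative ?D * char R u) (at u)"
      unfolding char[symmetric] by simp
    have "(\<lambda>u. CLINT x|R. (iexp (u * x) - 1)) = (\<lambda>u. char R u - 1)"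
      unfolding char_def
      by (rule ext, subst Bochner_Integration.integral_diff)
        (auto intro!: R.integrable_const_bound[where B=1] simp: R.prob_space)
    then have "((\<lambda>u. char R u - 1) has_vector_derivative (CLINT x|R. \<i> * of_real x * iexp (u * x))) (at u)"
      using exponent_has_vector_derivative[OF R(3), of u] by simp
    then have "((\<lambda>u. (char R u - 1) + 1) has_vector_derivative (CLINT x|R. \<i> * of_real x * iexp (u * x)) + 0) (at u)"
      by (intro derivative_intros)
    then have "(char R has_vector_derivative (CLINT x|R. \<i> * of_real x * iexp (u * x))) (at u)" by simp
    from vector_derivative_unique_at[OF this 1]
    have "(CLINT x|R. \<i> * of_real x * iexp (u * x)) = ?D * char R u" .
    moreover have "(CLINT x|R. \<i> * of_real x * iexp (u * x)) = \<i> * (CLINT x|R. of_real x * iexp (u * x))"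
      by (simp add: mult.assoc)
    moreover have "?D = \<i> * (CLINT a|L. of_real a * iexp (u * a))"
      by (simp add: mult.assoc)
    ultimately have 2: "(CLINT x|R. of_real x * iexp (u * x)) = (CLINT a|L. of_real a * iexp (u * a)) * char R u"
      by simp
    have "(CLINT a|L. of_real a * iexp (u * a)) = (CLINT a|L. \<bar>a\<bar> *\<^sub>R (of_real (sgn a) * iexp (u * a)))"
      by (intro Bochner_Integration.integral_cong) (auto simp: scaleR_conv_of_real abs_sgn sgn_if)
    also have "\<dots> = (CLINT a|?\<alpha>. of_real (sgn a) * iexp (u * a))"
      by (subst integral_density) auto
    finally have 3: "(CLINT a|L. of_real a * iexp (u * a)) = \<dots>" .
    have "(CLINT z|?\<alpha> \<Otimes>\<^sub>M R. of_real (sgn (fst z)) * iexp (u * (fst z + snd z)))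
        = (CLINT a|?\<alpha>. CLINT b|R. of_real (sgn a) * iexp (u * (a + b)))"
      by (subst AR.integral_fst'[OF sgn_int, symmetric]) simp
    also have "\<dots> = (CLINT a|?\<alpha>. CLINT b|R. (of_real (sgn a) * iexp (u * a)) * iexp (u * b))"
      by (simp add: distrib_left exp_add mult.assoc)
    also have "\<dots> = (CLINT a|?\<alpha>. of_real (sgn a) * iexp (u * a)) * char R u"
      by (simp only: char_def integral_mult_right_zero integral_mult_left_zero)
    finally show ?thesis using 2 3 by simp
  qed
  show ?thesis
  proof (cases "measure ?\<alpha> (space ?\<alpha>) = 0")
    case True
    then have "emeasure ?\<alpha> (space ?\<alpha>) = 0" by (simp add: A.emeasure_eq_measure)
    then have "emeasure (?\<alpha> \<Otimes>\<^sub>M R) (space (?\<alpha> \<Otimes>\<^sub>M R)) = 0"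
      by (simp add: space_pair_measure R.emeasure_pair_measure_Times)
    then have null: "space (?\<alpha> \<Otimes>\<^sub>M R) \<in> null_sets (?\<alpha> \<Otimes>\<^sub>M R)"
      by (rule null_setsI) (rule sets.top)
    have AE: "AE z in ?\<alpha> \<Otimes>\<^sub>M R. P z" for P
      by (rule AE_I'[OF null]) (rule Collect_restrict)
    have 0: "(CLINT x|R. of_real x * iexp (u * x)) = 0" for u
      unfolding key by (rule integral_eq_zero_AE[OF AE])
    have id: "(\<lambda>x. x) \<in> borel_measurable R" using R(3) by (rule borel_measurable_integrable)
    have "(\<integral>x. x * f x \<partial>R) = 0"
      by (rule signed_char_unique[where w="\<lambda>x. x" and Z="\<lambda>x. x" and f=f, OF R(3) id 0 f xf])
    moreover have "(\<integral>(a, b). sgn a * f (a + b) \<partial>(?\<alpha> \<Otimes>\<^sub>M R)) = 0"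
      by (rule integral_eq_zero_AE[OF AE])
    ultimately have 1: "(\<integral>x. x * f x \<partial>R) = (\<integral>(a, b). sgn a * f (a + b) \<partial>(?\<alpha> \<Otimes>\<^sub>M R))"
      by (rule trans[OF _ sym])
    show ?thesis
      by (rule 1)
  next
    case False
    define c where "c = measure ?\<alpha> (space ?\<alpha>)"
    have c: "c \<noteq> 0" using False by (simp add: c_def)
    \<comment> \<open>A two-point factor places both sides of the identity on one measure space, as a signed
      measure with density \<open>w\<close> whose image under \<open>Z\<close> has vanishing Fourier transform.  The first
      side, a measure on \<open>R\<close> alone, is pulled back to the product, which costs the factor \<open>c\<close>.\<close>
    let ?B = "count_space (UNIV :: bool set)"
    interpret B: finite_measure ?B by (rule finite_measure_count_space) simp
    interpret T: pair_sigma_finite "?\<alpha> \<Otimes>\<^sub>M R" ?B ..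
    let ?T = "(?\<alpha> \<Otimes>\<^sub>M R) \<Otimes>\<^sub>M ?B"
    have split: "integrable ?T (\<lambda>(z, i). if i then g (snd z) else k z)"
        "(\<integral>(z, i). (if i then g (snd z) else k z) \<partial>?T) = c *\<^sub>R (\<integral>x. g x \<partial>R) + (\<integral>z. k z \<partial>(?\<alpha> \<Otimes>\<^sub>M R))"
      if g: "integrable R g" and k: "integrable (?\<alpha> \<Otimes>\<^sub>M R) k"
      for g :: "real \<Rightarrow> 'b::{banach,second_countable_topology}" and k
    proof -
      have [measurable]: "g \<in> borel_measurable R" "k \<in> borel_measurable (?\<alpha> \<Otimes>\<^sub>M R)" using g k by auto
      have gi: "integrable (?\<alpha> \<Otimes>\<^sub>M R) (\<lambda>z. g (snd z))"
        by (rule AR.Fubini_integrable) (use g in \<open>auto simp: A.emeasure_eq_measure\<close>)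
      show i: "integrable ?T (\<lambda>(z, i). if i then g (snd z) else k z)"
      proof (rule T.Fubini_integrable)
        show "integrable (?\<alpha> \<Otimes>\<^sub>M R) (\<lambda>z. \<integral>i. norm (case (z, i) of (z, i) \<Rightarrow> if i then g (snd z) else k z) \<partial>?B)"
          using Bochner_Integration.integrable_add[OF integrable_norm[OF gi] integrable_norm[OF k]]
          by (simp add: lebesgue_integral_count_space_finite UNIV_bool add.commute)
        show "AE z in ?\<alpha> \<Otimes>\<^sub>M R. integrable ?B (\<lambda>i. case (z, i) of (z, i) \<Rightarrow> if i then g (snd z) else k z)"
          by (intro AE_I2 integrable_count_space) simp
      qed measurable
      show "(\<integral>(z, i). (if i then g (snd z) else k z) \<partial>?T) = c *\<^sub>R (\<integral>x. g x \<partial>R) + (\<integral>z. k z \<partial>(?\<alpha> \<Otimes>\<^sub>M R))"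
      proof -
        have "(\<integral>(z, i). (if i then g (snd z) else k z) \<partial>?T) = (\<integral>z. (\<integral>i. (if i then g (snd z) else k z) \<partial>?B) \<partial>(?\<alpha> \<Otimes>\<^sub>M R))"
          using T.integral_fst'[OF i] by simp
        also have "\<dots> = (\<integral>z. g (snd z) + k z \<partial>(?\<alpha> \<Otimes>\<^sub>M R))"
          by (simp add: lebesgue_integral_count_space_finite UNIV_bool add.commute)
        also have "\<dots> = (\<integral>z. g (snd z) \<partial>(?\<alpha> \<Otimes>\<^sub>M R)) + (\<integral>z. k z \<partial>(?\<alpha> \<Otimes>\<^sub>M R))"
          using gi k by (rule Bochner_Integration.integral_add)
        also have "(\<integral>z. g (snd z) \<partial>(?\<alpha> \<Otimes>\<^sub>M R)) = c *\<^sub>R (\<integral>x. g x \<partial>R)"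
          using AR.integral_fst'[OF gi] by (simp add: c_def)
        finally show ?thesis .
      qed
    qed
    define w where "w = (\<lambda>(z, i). if i then snd z / c else - sgn (fst z :: real))"
    define Z where "Z = (\<lambda>(z, i). if i then snd z else fst z + snd z :: real)"
    have wZ: "(\<lambda>t. w t *\<^sub>R F (Z t)) = (\<lambda>(z, i). if i then (snd z / c) *\<^sub>R F (snd z)
        else - (sgn (fst z) *\<^sub>R F (fst z + snd z)))" for F :: "real \<Rightarrow> 'b::real_vector"
      by (auto simp: w_def Z_def fun_eq_iff)
    have T_int: "integrable ?T (\<lambda>t. w t *\<^sub>R F (Z t))"
        "(\<integral>t. w t *\<^sub>R F (Z t) \<partial>?T) =
          (\<integral>x. x *\<^sub>R F x \<partial>R) - (\<integral>z. sgn (fst z) *\<^sub>R F (fst z + snd z) \<partial>(?\<alpha> \<Otimes>\<^sub>M R))"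
      if "integrable R (\<lambda>x. x *\<^sub>R F x)" "integrable (?\<alpha> \<Otimes>\<^sub>M R) (\<lambda>z. sgn (fst z) *\<^sub>R F (fst z + snd z))"
      for F :: "real \<Rightarrow> 'b::{banach,second_countable_topology}"
    proof -
      have 1: "integrable R (\<lambda>x. (x / c) *\<^sub>R F x)"
        using integrable_scaleR_right[OF that(1), of "inverse c"] by (simp add: divide_inverse mult.commute)
      have "(\<integral>x. (x / c) *\<^sub>R F x \<partial>R) = (\<integral>x. inverse c *\<^sub>R (x *\<^sub>R F x) \<partial>R)"
        by (simp add: divide_inverse mult.commute)
      also have "\<dots> = inverse c *\<^sub>R (\<integral>x. x *\<^sub>R F x \<partial>R)" by (rule integral_scaleR_right)
      finally have 2: "c *\<^sub>R (\<integral>x. (x / c) *\<^sub>R F x \<partial>R) = (\<integral>x. x *\<^sub>R F x \<partial>R)"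
        using c by simp
      note 3 = Bochner_Integration.integrable_minus[OF that(2)]
      show "integrable ?T (\<lambda>t. w t *\<^sub>R F (Z t))"
        unfolding wZ using split(1)[OF 1 3] by simp
      show "(\<integral>t. w t *\<^sub>R F (Z t) \<partial>?T) =
          (\<integral>x. x *\<^sub>R F x \<partial>R) - (\<integral>z. sgn (fst z) *\<^sub>R F (fst z + snd z) \<partial>(?\<alpha> \<Otimes>\<^sub>M R))"
        unfolding wZ using split(2)[OF 1 3] 2 by simp
    qed
    have xf': "integrable R (\<lambda>x. x *\<^sub>R f x)" using xf by simp
    have sf': "integrable (?\<alpha> \<Otimes>\<^sub>M R) (\<lambda>z. sgn (fst z) *\<^sub>R f (fst z + snd z))"
      using sf by (simp add: case_prod_unfold)
    have "integrable (?\<alpha> \<Otimes>\<^sub>M R) (\<lambda>z. sgn (fst z) *\<^sub>R (1::real))"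
      by (rule AR.integrable_const_bound[where B=1]) (auto simp: sgn_if)
    then have w_int: "integrable ?T w"
      using T_int(1)[of "\<lambda>_. 1::real"] R(3) by simp
    have Z_meas: "Z \<in> borel_measurable ?T" unfolding Z_def by measurable
    have w_char: "(CLINT t|?T. of_real (w t) * iexp (u * Z t)) = 0" for u
    proof -
      have "integrable R (\<lambda>x. x *\<^sub>R iexp (u * x))"
        by (rule Bochner_Integration.integrable_bound[OF R(3)]) auto
      moreover have "integrable (?\<alpha> \<Otimes>\<^sub>M R) (\<lambda>z. sgn (fst z) *\<^sub>R iexp (u * (fst z + snd z)))"
        using sgn_int[of u] by (simp only: scaleR_conv_of_real)
      ultimately have "(CLINT t|?T. w t *\<^sub>R iexp (u * Z t)) = (CLINT x|R. x *\<^sub>R iexp (u * x))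
          - (CLINT z|?\<alpha> \<Otimes>\<^sub>M R. sgn (fst z) *\<^sub>R iexp (u * (fst z + snd z)))"
        by (rule T_int(2))
      then show ?thesis using key[of u] by (simp only: scaleR_conv_of_real diff_self)
    qed
    have "integrable ?T (\<lambda>t. w t * f (Z t))"
      using T_int(1)[OF xf' sf'] by simp
    then have "(\<integral>t. w t * f (Z t) \<partial>?T) = 0"
      by (rule signed_char_unique[OF w_int Z_meas w_char f])
    also have "(\<integral>t. w t * f (Z t) \<partial>?T) = (\<integral>x. x * f x \<partial>R) - (\<integral>(a, b). sgn a * f (a + b) \<partial>(?\<alpha> \<Otimes>\<^sub>M R))"
      using T_int(2)[OF xf' sf'] by (simp add: case_prod_unfold)
    finally show ?thesis by simp
  qed
qed

section \<open>Normal approximation of infinitely divisible laws\<close>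

lemma square_le_cube: "(a::real)\<^sup>2 \<le> \<bar>a\<bar> + \<bar>a\<bar> ^ 3"
proof -
  have "0 \<le> \<bar>a\<bar> * (\<bar>a\<bar> - 1)\<^sup>2 + \<bar>a\<bar> * \<bar>a\<bar>" by simp
  then show ?thesis by (simp add: power2_eq_square power3_eq_cube algebra_simps flip: abs_mult)
qed

lemma integral_affine:
  fixes p q r :: "'a \<Rightarrow> real"
  assumes "integrable M p" "integrable M q" "integrable M r"
  shows "(\<integral>z. p z \<partial>M) / s - ((\<integral>z. q z \<partial>M) - (\<integral>z. r z \<partial>M)) / t = (\<integral>z. p z / s - (q z - r z) / t \<partial>M)"
  using assms by simp

lemma taylor_second_order:
  fixes f f' f'' :: "real \<Rightarrow> real"
  assumes f: "\<And>x. (f has_real_derivative f' x) (at x)" "\<And>x. (f' has_real_derivative f'' x) (at x)"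
    and bd: "\<And>x. \<bar>f'' x\<bar> \<le> 2"
  shows "\<bar>f (x + s) - f x - s * f' x\<bar> \<le> s\<^sup>2"
proof (cases "s = 0")
  case False
  let ?d = "\<lambda>n::nat. if n = 0 then f else if n = 1 then f' else f''"
  have "\<exists>t. (if x + s < x then x + s < t \<and> t < x else x < t \<and> t < x + s) \<and>
     f (x + s) = (\<Sum>m<2. ?d m x / fact m * (x + s - x) ^ m) + ?d 2 t / fact 2 * (x + s - x) ^ 2"
    by (rule Taylor[where a="min x (x + s)" and b="max x (x + s)"])
      (use f False in \<open>auto simp: less_2_cases_iff\<close>)
  then obtain t where "f (x + s) = f x + s * f' x + f'' t / 2 * s\<^sup>2"
    by (auto simp: numeral_2_eq_2 mult.commute)
  then have "\<bar>f (x + s) - f x - s * f' x\<bar> = \<bar>f'' t\<bar> / 2 * s\<^sup>2" by (simp add: abs_mult)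
  also have "\<dots> \<le> 1 * s\<^sup>2" using bd[of t] by (intro mult_right_mono) auto
  finally show ?thesis by simp
qed simp

text \<open>A law \<open>R\<close> with finite variance, Levy measure \<open>L\<close> with a first moment, and no drift; the first moment
  allows the exponent to be written without a compensating term.\<close>

locale infinitely_divisible =
  fixes R L :: "real measure"
  assumes prob_R: "prob_space R" and sets_R[measurable_cong]: "sets R = sets borel"
    and R2: "integrable R (\<lambda>x. x\<^sup>2)"
    and sets_L[measurable_cong]: "sets L = sets borel" and L1: "integrable L (\<lambda>a. a)"
    and char: "\<And>u. char R u = exp (CLINT a|L. (iexp (u * a) - 1))"
begin

sublocale R: prob_space R by (fact prob_R)

abbreviation "\<alpha> \<equiv> density L (\<lambda>a. ennreal \<bar>a\<bar>)"

sublocale A: finite_measure \<alpha>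
proof
  have "(\<integral>\<^sup>+a. ennreal \<bar>a\<bar> \<partial>L) < \<infinity>"
    using L1 unfolding integrable_iff_bounded by simp
  then show "emeasure \<alpha> (space \<alpha>) \<noteq> \<infinity>"
    by (simp add: emeasure_density cong: nn_integral_cong)
qed

sublocale AR: pair_sigma_finite \<alpha> R ..

sublocale AR: finite_measure "\<alpha> \<Otimes>\<^sub>M R"
  by (rule finite_measure_pair_measure) unfold_locales

lemma R1: "integrable R (\<lambda>x. x)"
  by (rule R.square_integrable_imp_integrable) (use R2 in auto)

lemmas identity = stein_identity[OF prob_R sets_R R1 sets_L L1 char]

lemma alpha_integral:
  fixes g :: "real \<Rightarrow> real" assumes [measurable]: "g \<in> borel_measurable borel"
  shows "(\<integral>a. g a \<partial>\<alpha>) = (\<integral>a. \<bar>a\<bar> * g a \<partial>L)"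
    and "integrable \<alpha> g \<longleftrightarrow> integrable L (\<lambda>a. \<bar>a\<bar> * g a)"
  by (subst integral_density integrable_density; simp)+

lemma pair_integral:
  fixes g h :: "real \<Rightarrow> real"
  assumes g: "integrable \<alpha> g" and h: "integrable R h"
  shows "integrable (\<alpha> \<Otimes>\<^sub>M R) (\<lambda>(a, b). g a * h b)"
    and "(\<integral>(a, b). g a * h b \<partial>(\<alpha> \<Otimes>\<^sub>M R)) = (\<integral>a. g a \<partial>\<alpha>) * (\<integral>b. h b \<partial>R)"
proof -
  have [measurable]: "g \<in> borel_measurable \<alpha>" "h \<in> borel_measurable R" using g h by auto
  show i: "integrable (\<alpha> \<Otimes>\<^sub>M R) (\<lambda>(a, b). g a * h b)"
  proof (rule AR.Fubini_integrable)
    show "integrable \<alpha> (\<lambda>x. \<integral>y. norm (case (x, y) of (a, b) \<Rightarrow> g a * h b) \<partial>R)"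
      using g by (simp add: abs_mult)
  qed (use h in auto)
  show "(\<integral>(a, b). g a * h b \<partial>(\<alpha> \<Otimes>\<^sub>M R)) = (\<integral>a. g a \<partial>\<alpha>) * (\<integral>b. h b \<partial>R)"
    using AR.integral_fst'[OF i] by simp
qed

lemma sgn_int: "integrable \<alpha> (\<lambda>a. sgn a :: real)"
  by (rule A.integrable_const_bound[where B=1]) (auto simp: sgn_if)

lemma mean_alpha: "(\<integral>a. sgn a \<partial>\<alpha>) = (\<integral>x. x \<partial>R)"
proof -
  have 1: "integrable R (\<lambda>_. 1 :: real)" by simp
  have 2: "integrable R (\<lambda>x. x * 1)" using R1 by simp
  have "(\<integral>x. x * 1 \<partial>R) = (\<integral>(a, b). sgn a * 1 \<partial>(\<alpha> \<Otimes>\<^sub>M R))"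
    by (rule identity[of "\<lambda>_. 1", OF _ 2 pair_integral(1)[OF sgn_int 1]]) simp
  also have "\<dots> = (\<integral>a. sgn a \<partial>\<alpha>) * (\<integral>b. 1 \<partial>R)"
    by (rule pair_integral(2)[OF sgn_int 1])
  finally show ?thesis by (simp add: R.prob_space)
qed

context
  assumes L3: "integrable L (\<lambda>a. \<bar>a\<bar> ^ 3)"
begin

lemma alpha1: "integrable \<alpha> (\<lambda>a. a)"
  and alpha_abs: "(\<integral>a. \<bar>a\<bar> \<partial>\<alpha>) = (\<integral>a. a\<^sup>2 \<partial>L)"
  and alpha2: "integrable \<alpha> (\<lambda>a. a\<^sup>2)" "(\<integral>a. a\<^sup>2 \<partial>\<alpha>) = (\<integral>a. \<bar>a\<bar> ^ 3 \<partial>L)"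
proof -
  have "integrable L (\<lambda>a. a\<^sup>2)"
  proof (rule Bochner_Integration.integrable_bound)
    show "integrable L (\<lambda>a. \<bar>a\<bar> + \<bar>a\<bar> ^ 3)" using L1 L3 by auto
    show "AE a in L. norm (a\<^sup>2) \<le> norm (\<bar>a\<bar> + \<bar>a\<bar> ^ 3)"
      using square_le_cube by (intro AE_I2) simp
  qed simp
  then have "integrable L (\<lambda>a. \<bar>a\<bar> * a)"
    by (rule Bochner_Integration.integrable_bound) (auto simp: abs_mult power2_eq_square)
  then show "integrable \<alpha> (\<lambda>a. a)" by (subst alpha_integral) auto
  show "(\<integral>a. \<bar>a\<bar> \<partial>\<alpha>) = (\<integral>a. a\<^sup>2 \<partial>L)"
    by (subst alpha_integral) (auto simp: power2_eq_square abs_mult_self_eq)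
  have e: "\<bar>a\<bar> * a\<^sup>2 = \<bar>a\<bar> ^ 3" for a :: real
    by (simp add: abs_if power3_eq_cube power2_eq_square)
  show "integrable \<alpha> (\<lambda>a. a\<^sup>2)" using L3 by (subst alpha_integral) (auto simp: e)
  show "(\<integral>a. a\<^sup>2 \<partial>\<alpha>) = (\<integral>a. \<bar>a\<bar> ^ 3 \<partial>L)" by (subst alpha_integral) (auto simp: e)
qed

lemma second_moment: "(\<integral>x. x\<^sup>2 \<partial>R) = (\<integral>a. a\<^sup>2 \<partial>L) + (\<integral>x. x \<partial>R)\<^sup>2"
proof -
  note a = pair_integral[OF integrable_abs[OF alpha1] R.integrable_const[of "1::real"]]
  note b = pair_integral[OF sgn_int R1]
  have e: "(\<lambda>(a, b). sgn a * (a + b)) = (\<lambda>z. (case z of (a, b) \<Rightarrow> \<bar>a\<bar> * 1) + (case z of (a, b) \<Rightarrow> sgn a * b) :: real)"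
    by (auto simp: fun_eq_iff algebra_simps sgn_if)
  have i: "integrable (\<alpha> \<Otimes>\<^sub>M R) (\<lambda>(a, b). sgn a * (a + b))"
    unfolding e by (rule Bochner_Integration.integrable_add[OF a(1) b(1)])
  have 2: "integrable R (\<lambda>x. x * x)" using R2 by (simp add: power2_eq_square)
  have "(\<integral>x. x * x \<partial>R) = (\<integral>(a, b). sgn a * (a + b) \<partial>(\<alpha> \<Otimes>\<^sub>M R))"
    by (rule identity[of "\<lambda>x. x", OF _ 2 i]) simp
  also have "\<dots> = (\<integral>a. \<bar>a\<bar> \<partial>\<alpha>) * (\<integral>x. 1 \<partial>R) + (\<integral>a. sgn a \<partial>\<alpha>) * (\<integral>x. x \<partial>R)"
    unfolding e a(2)[symmetric] b(2)[symmetric]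
    by (rule Bochner_Integration.integral_add[OF a(1) b(1)])
  finally show ?thesis
    by (simp add: R.prob_space alpha_abs mean_alpha power2_eq_square)
qed

text \<open>The identity for \<open>f(x) = 1\<close> and for \<open>f(x) = x\<close> gives the first two moments of \<open>R\<close>.\<close>

lemma variance_eq: "(\<integral>x. (x - (\<integral>x. x \<partial>R))\<^sup>2 \<partial>R) = (\<integral>a. a\<^sup>2 \<partial>L)"
  using R.variance_eq[OF R1 R2] second_moment by simp

text \<open>With \<open>F(x) = f((x - m) / \<sigma>)\<close> the Stein identity gives \<open>E (Z f(Z)) = \<integral> a E (F(A + a) - F(A)) L(da) / \<sigma>\<close>,
  while \<open>\<sigma>\<^sup>2 = \<integral> a\<^sup>2 L(da)\<close> lets \<open>E (f'(Z))\<close> be written as \<open>\<integral> a E (a F'(A)) L(da) / \<sigma>\<close>.  The integrands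
  differ by the Taylor remainder of \<open>f\<close> for the increment \<open>a / \<sigma>\<close>.\<close>

theorem wasserstein_bound:
  fixes \<sigma> m :: real
  assumes \<sigma>: "0 < \<sigma>" "\<sigma>\<^sup>2 = (\<integral>x. (x - m)\<^sup>2 \<partial>R)" and m: "m = (\<integral>x. x \<partial>R)"
  shows "wasserstein (distr R borel (\<lambda>x. (x - m) / \<sigma>)) \<gamma> \<le> ennreal ((\<integral>a. \<bar>a\<bar> ^ 3 \<partial>L) / \<sigma> ^ 3)"
proof (rule wasserstein_normal_le)
  let ?W = "\<lambda>x. (x - m) / \<sigma>"
  have \<sigma>2: "\<sigma>\<^sup>2 = (\<integral>a. \<bar>a\<bar> \<partial>\<alpha>)"
    using \<sigma> m variance_eq alpha_abs by simp
  show "prob_space (distr R borel ?W)" by (rule R.prob_space_distr) simp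
  show "integrable (distr R borel ?W) (\<lambda>x. x\<^sup>2)"
  proof (subst integrable_distr_eq)
    have "(\<lambda>x. (?W x)\<^sup>2) = (\<lambda>x. (x\<^sup>2 - 2 * m * x + m\<^sup>2) / \<sigma>\<^sup>2)"
      by (rule ext) (simp add: power2_diff power_divide algebra_simps)
    then show "integrable R (\<lambda>x. (?W x)\<^sup>2)" using R1 R2 by simp
  qed auto
  fix f f' f'' :: "real \<Rightarrow> real"
  assume f: "\<And>x. (f has_real_derivative f' x) (at x)" "\<And>x. (f' has_real_derivative f'' x) (at x)"
    and f1: "\<And>x. \<bar>f x\<bar> \<le> 1" and f2: "\<And>x. \<bar>f'' x\<bar> \<le> 2"
  have cont: "continuous_on UNIV f" "continuous_on UNIV f'"
    using f by (meson DERIV_isCont continuous_at_imp_continuous_on)+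
  then have [measurable]: "f \<in> borel_measurable borel" "f' \<in> borel_measurable borel"
    by (auto intro: borel_measurable_continuous_onI)
  define F where "F x = f (?W x)" for x
  have [measurable]: "F \<in> borel_measurable borel" unfolding F_def by measurable
  have F1: "\<bar>F x\<bar> \<le> 1" for x unfolding F_def by (rule f1)
  have Fi: "integrable R F" by (rule R.integrable_const_bound[where B=1]) (auto simp: F1)
  have xF: "integrable R (\<lambda>x. x * F x)"
    by (rule Bochner_Integration.integrable_bound[OF R1]) (auto simp: abs_mult F1 intro!: mult_left_le)
  have sF: "integrable (\<alpha> \<Otimes>\<^sub>M R) (\<lambda>(a, b). sgn a * F (a + b))"
    by (rule AR.integrable_const_bound[where B=1]) (auto simp: abs_mult sgn_if F1)
  note sF0 = pair_integral[OF sgn_int Fi]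
  define G where "G x = f' (?W x)" for x
  have [measurable]: "G \<in> borel_measurable borel" unfolding G_def by measurable
  have f'_bd: "\<bar>f' x\<bar> \<le> \<bar>f' 0\<bar> + 2 * \<bar>x\<bar>" for x
    using field_differentiable_bound[of UNIV f' f'' 2 x 0] f f2 by auto
  have Gi: "integrable R G"
  proof (rule Bochner_Integration.integrable_bound)
    show "integrable R (\<lambda>x. \<bar>f' 0\<bar> + 2 * \<bar>?W x\<bar>)" using R1 by auto
    show "AE x in R. norm (G x) \<le> norm (\<bar>f' 0\<bar> + 2 * \<bar>?W x\<bar>)"
    proof (rule AE_I2)
      show "norm (G x) \<le> norm (\<bar>f' 0\<bar> + 2 * \<bar>?W x\<bar>)" for x
        using f'_bd[of "?W x"] unfolding G_def real_norm_def by linarith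
    qed
  qed simp
  note aG = pair_integral[OF integrable_abs[OF alpha1] Gi]
  have "(\<integral>x. f' x - x * f x \<partial>distr R borel ?W) = (\<integral>x. G x - ?W x * F x \<partial>R)"
    by (subst integral_distr) (auto simp: G_def F_def)
  also have "\<dots> = (\<integral>x. G x - (x * F x - m * F x) / \<sigma> \<partial>R)"
    by (simp add: left_diff_distrib)
  also have "\<dots> = (\<integral>x. G x \<partial>R) - ((\<integral>x. x * F x \<partial>R) - m * (\<integral>x. F x \<partial>R)) / \<sigma>"
    using Gi xF Fi by simp
  also have "(\<integral>x. x * F x \<partial>R) = (\<integral>(a, b). sgn a * F (a + b) \<partial>(\<alpha> \<Otimes>\<^sub>M R))"
    by (rule identity[OF _ xF sF]) simp
  also have "m * (\<integral>x. F x \<partial>R) = (\<integral>(a, b). sgn a * F b \<partial>(\<alpha> \<Otimes>\<^sub>M R))"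
    unfolding sF0(2) mean_alpha m ..
  also have "(\<integral>x. G x \<partial>R) = (\<integral>(a, b). \<bar>a\<bar> * G b \<partial>(\<alpha> \<Otimes>\<^sub>M R)) / \<sigma>\<^sup>2"
    unfolding aG(2) \<sigma>2[symmetric] using \<sigma>(1) by simp
  also have "(\<integral>(a, b). \<bar>a\<bar> * G b \<partial>(\<alpha> \<Otimes>\<^sub>M R)) / \<sigma>\<^sup>2
      - ((\<integral>(a, b). sgn a * F (a + b) \<partial>(\<alpha> \<Otimes>\<^sub>M R)) - (\<integral>(a, b). sgn a * F b \<partial>(\<alpha> \<Otimes>\<^sub>M R))) / \<sigma>
      = (\<integral>z. (case z of (a, b) \<Rightarrow> \<bar>a\<bar> * G b) / \<sigma>\<^sup>2
        - ((case z of (a, b) \<Rightarrow> sgn a * F (a + b)) - (case z of (a, b) \<Rightarrow> sgn a * F b)) / \<sigma> \<partial>(\<alpha> \<Otimes>\<^sub>M R))"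
    by (rule integral_affine[OF aG(1) sF sF0(1)])
  finally have eq: "(\<integral>x. f' x - x * f x \<partial>distr R borel ?W) = \<dots>" .
  have "\<bar>\<integral>x. f' x - x * f x \<partial>distr R borel ?W\<bar> \<le> (\<integral>z. (case z of (a, b) \<Rightarrow> a\<^sup>2 * 1) / \<sigma> ^ 3 \<partial>(\<alpha> \<Otimes>\<^sub>M R))"
    unfolding eq
  proof (rule order_trans[OF integral_abs_bound], rule integral_mono)
    show "integrable (\<alpha> \<Otimes>\<^sub>M R) (\<lambda>z. (case z of (a, b) \<Rightarrow> a\<^sup>2 * 1) / \<sigma> ^ 3)"
      by (rule integrable_divide, rule pair_integral(1)[OF alpha2(1)]) simp
    show "integrable (\<alpha> \<Otimes>\<^sub>M R) (\<lambda>z. \<bar>(case z of (a, b) \<Rightarrow> \<bar>a\<bar> * G b) / \<sigma>\<^sup>2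
        - ((case z of (a, b) \<Rightarrow> sgn a * F (a + b)) - (case z of (a, b) \<Rightarrow> sgn a * F b)) / \<sigma>\<bar>)"
      by (intro integrable_abs Bochner_Integration.integrable_diff integrable_divide aG(1) sF sF0(1))
    fix z :: "real \<times> real"
    obtain a b where z: "z = (a, b)" by (cases z)
    let ?w = "?W b" and ?s = "a / \<sigma>"
    have e: "?W (a + b) = ?w + ?s" using \<sigma> by (simp add: field_simps)
    have "\<bar>a\<bar> * G b / \<sigma>\<^sup>2 - (sgn a * F (a + b) - sgn a * F b) / \<sigma>
        = - (sgn a / \<sigma>) * (f (?w + ?s) - f ?w - ?s * f' ?w)"
      unfolding F_def G_def e using \<sigma>(1) abs_sgn[of a]
      by (simp add: field_simps power2_eq_square)
    also have "\<bar>\<dots>\<bar> \<le> 1 / \<sigma> * ?s\<^sup>2"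
      unfolding abs_mult using \<sigma>
      by (intro mult_mono taylor_second_order[OF f f2]) (auto simp: sgn_if)
    also have "\<dots> = a\<^sup>2 / \<sigma> ^ 3"
      by (simp add: power_divide power3_eq_cube power2_eq_square)
    finally show "\<bar>(case z of (a, b) \<Rightarrow> \<bar>a\<bar> * G b) / \<sigma>\<^sup>2
        - ((case z of (a, b) \<Rightarrow> sgn a * F (a + b)) - (case z of (a, b) \<Rightarrow> sgn a * F b)) / \<sigma>\<bar>
      \<le> (case z of (a, b) \<Rightarrow> a\<^sup>2 * 1) / \<sigma> ^ 3"
      by (simp add: z)
  qed
  also have "\<dots> = (\<integral>(a, b). a\<^sup>2 * 1 \<partial>(\<alpha> \<Otimes>\<^sub>M R)) / \<sigma> ^ 3"
    by (rule integral_divide_zero)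
  also have "(\<integral>(a, b). a\<^sup>2 * 1 \<partial>(\<alpha> \<Otimes>\<^sub>M R)) = (\<integral>a. \<bar>a\<bar> ^ 3 \<partial>L)"
    by (subst pair_integral(2)[OF alpha2(1)]) (simp_all add: alpha2(2) R.prob_space)
  finally show "\<bar>\<integral>x. f' x - x * f x \<partial>distr R borel ?W\<bar> \<le> (\<integral>a. \<bar>a\<bar> ^ 3 \<partial>L) / \<sigma> ^ 3" .
qed simp

end

context
  assumes R_nonneg: "AE x in R. 0 \<le> x" and L_nonneg: "AE a in L. 0 \<le> a"
    and R3: "integrable R (\<lambda>x. x ^ 3)"
begin

lemma alpha_sgn: "AE a in \<alpha>. sgn a = (1::real)"
proof (subst AE_density)
  show "AE a in L. 0 < ennreal \<bar>a\<bar> \<longrightarrow> sgn a = (1::real)"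
    using L_nonneg by eventually_elim (auto simp: sgn_if)
qed simp

lemma pair_sgn: "AE z in \<alpha> \<Otimes>\<^sub>M R. sgn (fst z) = (1::real) \<and> 0 \<le> snd z"
proof (rule AR.AE_pair_measure)
  show "AE x in \<alpha>. AE y in R. sgn (fst (x, y)) = (1::real) \<and> 0 \<le> snd (x, y)"
    using alpha_sgn R_nonneg by auto
qed measurable

text \<open>For nonnegative \<open>R\<close> and \<open>L\<close>, the identity with bounded increasing functions \<open>f\<close> close to \<open>x\<^sup>2\<close> gives
  \<open>\<integral> a f(a) L(da) \<le> \<integral> a E (f(A + a)) L(da) = E (A f(A)) \<le> E (A\<^sup>3)\<close>.\<close>

lemma third_moment_Levy: "integrable L (\<lambda>a. \<bar>a\<bar> ^ 3)"
proof -
  \<comment> \<open>Truncation of \<open>x\<^sup>2\<close> at \<open>0\<close> and at \<open>N\<^sup>2\<close>, chosen bounded, increasing and convergent from below.\<close>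
  define q where "q N x = (min (max 0 x) (real N))\<^sup>2" for N :: nat and x :: real
  have [measurable]: "q N \<in> borel_measurable borel" for N unfolding q_def by measurable
  have q_bd: "0 \<le> q N x" "q N x \<le> (real N)\<^sup>2" for N x
    unfolding q_def by (auto intro!: power_mono)
  have q_mono: "q N x \<le> q M y" if "N \<le> M" "x \<le> y" for N M x y
    unfolding q_def using that by (intro power_mono) auto
  have q_le: "q N x \<le> x\<^sup>2" if "0 \<le> x" for N x
    unfolding q_def using that by (intro power_mono) auto
  have qi: "integrable \<alpha> (q N)" for N
    by (rule A.integrable_const_bound[where B="(real N)\<^sup>2"]) (auto simp: q_bd)
  have bd: "(\<integral>a. q N a \<partial>\<alpha>) \<le> (\<integral>x. x ^ 3 \<partial>R)" for N
  proof -
    have 1: "integrable R (\<lambda>x. x * q N x)"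
    proof (rule Bochner_Integration.integrable_bound)
      show "integrable R (\<lambda>x. x * (real N)\<^sup>2)" using R1 by simp
      show "AE x in R. norm (x * q N x) \<le> norm (x * (real N)\<^sup>2)"
        by (intro AE_I2) (auto simp: abs_mult q_bd intro!: mult_left_mono)
    qed simp
    have 2: "integrable (\<alpha> \<Otimes>\<^sub>M R) (\<lambda>(a, b). sgn a * q N (a + b))"
      by (rule AR.integrable_const_bound[where B="(real N)\<^sup>2"]) (auto simp: abs_mult sgn_if q_bd)
    have 3: "integrable R (\<lambda>_. 1::real)" by simp
    have "(\<integral>a. q N a \<partial>\<alpha>) = (\<integral>(a, b). q N a * 1 \<partial>(\<alpha> \<Otimes>\<^sub>M R))"
      by (subst pair_integral(2)[OF qi 3]) (simp add: R.prob_space)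
    also have "\<dots> \<le> (\<integral>(a, b). sgn a * q N (a + b) \<partial>(\<alpha> \<Otimes>\<^sub>M R))"
    proof (rule integral_mono_AE[OF pair_integral(1)[OF qi 3] 2])
      show "AE z in \<alpha> \<Otimes>\<^sub>M R. (case z of (a, b) \<Rightarrow> q N a * 1) \<le> (case z of (a, b) \<Rightarrow> sgn a * q N (a + b))"
        using pair_sgn by eventually_elim (auto simp: split_beta intro!: q_mono)
    qed
    also have "\<dots> = (\<integral>x. x * q N x \<partial>R)"
      by (rule identity[symmetric, OF _ 1 2]) simp
    also have "\<dots> \<le> (\<integral>x. x ^ 3 \<partial>R)"
    proof (rule integral_mono_AE[OF 1 R3])
      show "AE x in R. x * q N x \<le> x ^ 3"
        using R_nonneg
      proof eventually_elim
        case (elim x)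
        then show ?case using mult_left_mono[OF q_le[OF elim, of N] elim] by (simp add: power2_eq_square power3_eq_cube)
      qed
    qed
    finally show ?thesis .
  qed
  have "incseq (\<lambda>N. \<integral>a. q N a \<partial>\<alpha>)"
    by (intro monoI integral_mono qi) (auto intro: q_mono)
  then obtain l where l: "(\<lambda>N. \<integral>a. q N a \<partial>\<alpha>) \<longlonglongrightarrow> l"
    using incseq_convergent[of "\<lambda>N. \<integral>a. q N a \<partial>\<alpha>" "\<integral>x. x ^ 3 \<partial>R"] bd by blast
  have "integrable \<alpha> (\<lambda>a. a\<^sup>2)"
  proof (rule integrable_monotone_convergence[OF qi _ _ l])
    show "AE a in \<alpha>. mono (\<lambda>N. q N a)" by (intro AE_I2 monoI q_mono) auto
    show "AE a in \<alpha>. (\<lambda>N. q N a) \<longlonglongrightarrow> a\<^sup>2"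
      using alpha_sgn
    proof eventually_elim
      case (elim a)
      then have a: "0 \<le> a" by (simp add: sgn_if split: if_splits)
      obtain M where M: "a \<le> real M" using real_arch_simple by blast
      have "q N a = a\<^sup>2" if "M \<le> N" for N
        using that a M by (auto simp: q_def max_def min_def)
      then show ?case by (intro tendsto_eventually) (auto simp: eventually_sequentially)
    qed
  qed simp
  moreover have "\<bar>a\<bar> * a\<^sup>2 = \<bar>a\<bar> ^ 3" for a :: real
    by (simp add: abs_if power3_eq_cube power2_eq_square)
  ultimately show ?thesis by (subst (asm) alpha_integral) auto
qed

text \<open>The identity for \<open>f(x) = (x - m)\<^sup>2\<close>: expanding \<open>(a + b - m)\<^sup>2\<close> leaves \<open>\<integral> a\<^sup>3 L(da)\<close>, a mixed term that
  vanishes by centring, and \<open>m\<close> times the variance, which also occurs in \<open>E (A (A - m)\<^sup>2)\<close>.\<close>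

theorem third_central_moment:
  "(\<integral>x. (x - (\<integral>x. x \<partial>R)) ^ 3 \<partial>R) = (\<integral>a. \<bar>a\<bar> ^ 3 \<partial>L)"
proof -
  define m where "m = (\<integral>x. x \<partial>R)"
  note al = alpha1[OF third_moment_Levy] alpha2[OF third_moment_Levy]
  define c where "c x = x - m" for x
  have c1: "integrable R c" "(\<integral>x. c x \<partial>R) = 0"
    unfolding c_def using R1 by (auto simp: m_def R.prob_space)
  have c2: "integrable R (\<lambda>x. (c x)\<^sup>2)"
    unfolding c_def power2_diff using R1 R2 by auto
  have "(\<lambda>x. (c x) ^ 3) = (\<lambda>x. x ^ 3 - 3 * m * x\<^sup>2 + 3 * m\<^sup>2 * x - m ^ 3)"
    by (auto simp: c_def fun_eq_iff power3_eq_cube power2_eq_square algebra_simps)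
  then have c3: "integrable R (\<lambda>x. (c x) ^ 3)" using R1 R2 R3 by simp
  have xc: "x * (c x)\<^sup>2 = (c x) ^ 3 + m * (c x)\<^sup>2" for x
    by (simp add: c_def power3_eq_cube power2_eq_square algebra_simps)
  have xi: "integrable R (\<lambda>x. x * (c x)\<^sup>2)" unfolding xc using c2 c3 by auto
  have [measurable]: "c \<in> borel_measurable borel" unfolding c_def by measurable
  have sq: "integrable \<alpha> (\<lambda>a. sgn a * a\<^sup>2)" and sq_eq: "(\<integral>a. sgn a * a\<^sup>2 \<partial>\<alpha>) = (\<integral>a. \<bar>a\<bar> ^ 3 \<partial>L)"
  proof -
    show "integrable \<alpha> (\<lambda>a. sgn a * a\<^sup>2)"
      by (rule Bochner_Integration.integrable_bound[OF al(2)]) (auto simp: abs_mult sgn_if)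
    have "(\<integral>a. sgn a * a\<^sup>2 \<partial>\<alpha>) = (\<integral>a. a\<^sup>2 \<partial>\<alpha>)"
    proof (rule integral_cong_AE)
      show "AE a in \<alpha>. sgn a * a\<^sup>2 = a\<^sup>2" using alpha_sgn by eventually_elim simp
    qed auto
    then show "(\<integral>a. sgn a * a\<^sup>2 \<partial>\<alpha>) = (\<integral>a. \<bar>a\<bar> ^ 3 \<partial>L)" by (simp only: al(3))
  qed
  note p1 = pair_integral[OF sq R.integrable_const[of "1::real"]]
    and p2 = pair_integral[OF integrable_mult_right[OF integrable_abs[OF al(1)], of 2] c1(1)]
    and p3 = pair_integral[OF sgn_int c2]
  have e: "(\<lambda>(a, b). sgn a * (c (a + b))\<^sup>2) = (\<lambda>z. (case z of (a, b) \<Rightarrow> sgn a * a\<^sup>2 * 1)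
      + ((case z of (a, b) \<Rightarrow> 2 * \<bar>a\<bar> * c b) + (case z of (a, b) \<Rightarrow> sgn a * (c b)\<^sup>2)))"
    by (auto simp: fun_eq_iff c_def sgn_if power2_eq_square algebra_simps)
  have i: "integrable (\<alpha> \<Otimes>\<^sub>M R) (\<lambda>(a, b). sgn a * (c (a + b))\<^sup>2)"
    unfolding e by (intro Bochner_Integration.integrable_add p1(1) p2(1) p3(1))
  have "(\<integral>x. x * (c x)\<^sup>2 \<partial>R) = (\<integral>(a, b). sgn a * (c (a + b))\<^sup>2 \<partial>(\<alpha> \<Otimes>\<^sub>M R))"
    by (rule identity[OF _ xi i]) simp
  also have "\<dots> = (\<integral>a. \<bar>a\<bar> ^ 3 \<partial>L) + m * (\<integral>x. (c x)\<^sup>2 \<partial>R)"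
    unfolding e
    by (subst Bochner_Integration.integral_add, rule p1(1), intro Bochner_Integration.integrable_add p2(1) p3(1),
        subst Bochner_Integration.integral_add, rule p2(1), rule p3(1))
      (simp only: p1(2) p2(2) p3(2), simp only: c1(2) sq_eq mean_alpha m_def[symmetric] lebesgue_integral_const R.prob_space
        mult_zero_right add_0_left scaleR_one mult_1_right)
  finally have "(\<integral>x. (c x) ^ 3 \<partial>R) + m * (\<integral>x. (c x)\<^sup>2 \<partial>R) = (\<integral>a. \<bar>a\<bar> ^ 3 \<partial>L) + m * (\<integral>x. (c x)\<^sup>2 \<partial>R)"
    unfolding xc using c2 c3 by simp
  then show ?thesis by (simp add: c_def m_def)
qed

end

end

section \<open>Counting measures\<close>

lemma space_evaluation_algebra: "space (evaluation_algebra S M) = S"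
  by (auto simp add: evaluation_algebra_def space_Sup_eq_UN)

lemma measurable_emeasure_evaluation_algebra:
  "B \<in> sets M \<Longrightarrow> (\<lambda>m. emeasure m B) \<in> borel_measurable (evaluation_algebra S M)"
  by (auto intro!: measurable_Sup1 measurable_vimage_algebra1 simp: evaluation_algebra_def)

lemma measurable_evaluation_algebra:
  "(\<And>a. a \<in> space N \<Longrightarrow> K a \<in> S) \<Longrightarrow>
  (\<And>B. B \<in> sets M \<Longrightarrow> (\<lambda>a. emeasure (K a) B) \<in> borel_measurable N) \<Longrightarrow>
  K \<in> N \<rightarrow>\<^sub>M evaluation_algebra S M"
  by (auto intro!: measurable_Sup2 measurable_vimage_algebra2 simp: evaluation_algebra_def)

lemma space_counting_measure_algebra: "space (counting_measure_algebra X) = counting_measures X"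
  by (simp add: counting_measure_algebra_def space_evaluation_algebra)

lemma counting_measures_sets:
  assumes "m \<in> counting_measures X"
  shows "sets m = sets (restrict_space borel X)" "space m = X"
proof -
  show 1: "sets m = sets (restrict_space borel X)"
    using assms by (auto simp: counting_measures_def radon_measure_def)
  show "space m = X" using sets_eq_imp_space_eq[OF 1] by (simp add: space_restrict_space)
qed

lemma counting_measures_values:
  assumes "m \<in> counting_measures X" "B \<in> sets m" "emeasure m B < \<infinity>"
  obtains k :: nat where "emeasure m B = of_nat k"
  using assms unfolding counting_measures_def by fastforce

lemma singleton_sets_restrict: "x \<in> X \<Longrightarrow> {x} \<in> sets (restrict_space (borel :: 'a::t1_space measure) X)"
  by (auto simp: sets_restrict_space intro!: image_eqI[of _ _ "{x}"])

lemma open_sets_restrict: "open U \<Longrightarrow> U \<inter> X \<in> sets (restrict_space borel X)"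
  by (auto simp: sets_restrict_space intro!: image_eqI[of _ _ U])

text \<open>Punctured balls around \<open>x\<close> decrease to the empty set and eventually have finite, integer mass; so the
  mass is \<open>0\<close> from some radius on.\<close>

lemma counting_measure_isolated:
  fixes X :: "'a::euclidean_space set"
  assumes m: "m \<in> counting_measures X" and x: "x \<in> X"
  obtains V where "open V" "x \<in> V" "emeasure m (V \<inter> X - {x}) = 0"
proof -
  note sets = counting_measures_sets[OF m]
  obtain U where U: "open U" "x \<in> U" "emeasure m (U \<inter> X) < \<infinity>"
    using m x unfolding counting_measures_def radon_measure_def by blast
  define V where "V n = ball x (1 / Suc n) \<inter> U" for n :: nat
  have V: "open (V n)" "x \<in> V n" for n unfolding V_def using U by auto
  have Vm: "V n \<inter> X - {x} \<in> sets m" for n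
    unfolding sets(1) using x by (intro sets.Diff open_sets_restrict V singleton_sets_restrict)
  have UX: "U \<inter> X \<in> sets m" unfolding sets(1) by (intro open_sets_restrict U)
  have fin: "emeasure m (V n \<inter> X - {x}) < \<infinity>" for n
    by (rule le_less_trans[OF emeasure_mono[OF _ UX] U(3)]) (auto simp: V_def)
  have "decseq (\<lambda>n. V n \<inter> X - {x})"
  proof (intro decseq_SucI)
    fix n
    have "ball x (1 / Suc (Suc n)) \<subseteq> ball x (1 / Suc n)"
      by (intro subset_ball) (simp add: frac_le)
    then show "V (Suc n) \<inter> X - {x} \<subseteq> V n \<inter> X - {x}" unfolding V_def by blast
  qed
  then have "(\<lambda>n. emeasure m (V n \<inter> X - {x})) \<longlonglongrightarrow> emeasure m (\<Inter>n. V n \<inter> X - {x})"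
    using Vm fin by (intro Lim_emeasure_decseq) (auto simp: less_top)
  moreover have "(\<Inter>n. V n \<inter> X - {x}) = {}"
  proof (rule ccontr)
    assume "(\<Inter>n. V n \<inter> X - {x}) \<noteq> {}"
    then obtain y where y: "\<And>n. y \<in> V n" "y \<noteq> x" by auto
    obtain n :: nat where "1 / Suc n < dist x y"
      using reals_Archimedean[of "dist x y"] y by (auto simp: inverse_eq_divide)
    then show False using y(1)[of n] by (auto simp: V_def)
  qed
  ultimately have "(\<lambda>n. emeasure m (V n \<inter> X - {x})) \<longlonglongrightarrow> 0" by (simp only: emeasure_empty)
  then have "\<forall>\<^sub>F n in sequentially. emeasure m (V n \<inter> X - {x}) < 1"
    by (rule order_tendstoD) simp
  then obtain n where n: "emeasure m (V n \<inter> X - {x}) < 1"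
    by (auto simp: eventually_sequentially)
  obtain k :: nat where "emeasure m (V n \<inter> X - {x}) = of_nat k"
    using counting_measures_values[OF m Vm fin] .
  then have "emeasure m (V n \<inter> X - {x}) = 0" using n by (cases k) auto
  then show thesis using that V by blast
qed

text \<open>By Lindelof's theorem countably many of the neighbourhoods of the preceding lemma cover \<open>X\<close>; their
  centres carry the measure.\<close>

lemma counting_measure_carrier:
  fixes X :: "'a::euclidean_space set"
  assumes m: "m \<in> counting_measures X"
  obtains S where "countable S" "S \<subseteq> X" "X - S \<in> null_sets m"
proof -
  note sets = counting_measures_sets[OF m]
  let ?F = "{V. open V \<and> (\<exists>x\<in>X. emeasure m (V \<inter> X - {x}) = 0)}"
  obtain F' where F': "F' \<subseteq> ?F" "countable F'" "\<Union>F' = \<Union>?F"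
    by (rule Lindelof[of ?F]) auto
  have "\<forall>V\<in>F'. \<exists>x\<in>X. emeasure m (V \<inter> X - {x}) = 0" using F'(1) by auto
  then obtain p where p: "\<And>V. V \<in> F' \<Longrightarrow> p V \<in> X" "\<And>V. V \<in> F' \<Longrightarrow> emeasure m (V \<inter> X - {p V}) = 0"
    by metis
  have cover: "X \<subseteq> \<Union>F'"
  proof
    fix x assume "x \<in> X"
    then obtain V where "open V" "x \<in> V" "emeasure m (V \<inter> X - {x}) = 0"
      using counting_measure_isolated[OF m] by blast
    then show "x \<in> \<Union>F'" unfolding F'(3) using \<open>x \<in> X\<close> by blast
  qed
  let ?S = "p ` F'"
  have null: "V \<inter> X - {p V} \<in> null_sets m" if "V \<in> F'" for V
  proof (rule null_setsI[OF p(2)[OF that]])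
    show "V \<inter> X - {p V} \<in> sets m"
      unfolding sets(1) using p(1)[OF that] F'(1) that
      by (intro sets.Diff open_sets_restrict singleton_sets_restrict) auto
  qed
  have "(\<Union>V\<in>F'. V \<inter> X - {p V}) \<in> null_sets m"
    using F'(2) null by (rule null_sets_UN')
  moreover have "X - ?S \<subseteq> (\<Union>V\<in>F'. V \<inter> X - {p V})" using cover by auto
  moreover have "X - ?S \<in> sets m"
  proof -
    have "?S \<in> sets m"
    proof (rule sets.countable)
      show "{a} \<in> sets m" if "a \<in> ?S" for a
        using that p(1) singleton_sets_restrict unfolding sets(1) by blast
      show "countable ?S" using F'(2) by (rule countable_image)
    qed
    then show ?thesis using sets(2) sets.top[of m] by auto
  qed
  ultimately have "X - ?S \<in> null_sets m" using null_sets_subset by blast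
  then show thesis using that[of ?S] F'(2) p(1) by auto
qed

definition atoms :: "'a measure \<Rightarrow> 'a set" where
  "atoms m = {x\<in>space m. emeasure m {x} \<noteq> 0}"

lemma counting_measure_atoms:
  fixes X :: "'a::euclidean_space set"
  assumes m: "m \<in> counting_measures X"
  shows "countable (atoms m)" "atoms m \<subseteq> X" "AE x in m. x \<in> atoms m"
proof -
  note sets = counting_measures_sets[OF m]
  obtain S where S: "countable S" "S \<subseteq> X" "X - S \<in> null_sets m"
    using counting_measure_carrier[OF m] .
  show X: "atoms m \<subseteq> X" unfolding atoms_def sets(2) by auto
  have "atoms m \<subseteq> S"
  proof (rule ccontr)
    assume "\<not> atoms m \<subseteq> S"
    then obtain x where x: "x \<in> atoms m" "x \<notin> S" by auto
    have "{x} \<in> null_sets m"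
      by (rule null_sets_subset[OF S(3)]) (use x X sets singleton_sets_restrict in auto)
    then show False using x by (auto simp: atoms_def)
  qed
  then show "countable (atoms m)" using S(1) countable_subset by blast
  have "(\<Union>x\<in>S - atoms m. {x}) \<in> null_sets m"
    using S sets by (intro null_sets_UN') (auto simp: atoms_def intro!: null_setsI singleton_sets_restrict)
  then have "(\<Union>x\<in>S - atoms m. {x}) \<union> (X - S) \<in> null_sets m" using S(3) by auto
  then show "AE x in m. x \<in> atoms m"
    by (rule AE_I') (auto simp: sets(2))
qed

text \<open>The function \<open>g\<close> is arbitrary: it differs from a function with countable support, which is measurable,
  only on a null set.  This is what makes the superposition of a nonmeasurable family of measures a
  countable sum.\<close>

lemma nn_integral_counting_measure:
  fixes X :: "'a::euclidean_space set" and g :: "'a \<Rightarrow> ennreal"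
  assumes m: "m \<in> counting_measures X"
  shows "(\<integral>\<^sup>+x. g x \<partial>m) = (\<integral>\<^sup>+x. g x * emeasure m {x} \<partial>count_space (atoms m))"
proof -
  note at = counting_measure_atoms[OF m] and sets = counting_measures_sets[OF m]
  have one: "(\<integral>\<^sup>+s. g s * indicator {s} x \<partial>count_space (atoms m)) = g x * indicator (atoms m) x" for x
  proof -
    have "(\<integral>\<^sup>+s. g s * indicator {s} x \<partial>count_space (atoms m)) =
        (\<integral>\<^sup>+s. g x * indicator (atoms m) x * indicator {x} s \<partial>count_space UNIV)"
      by (subst nn_integral_count_space_indicator, simp, intro nn_integral_cong)
        (auto split: split_indicator)
    then show ?thesis by (simp add: nn_integral_cmult_indicator)
  qed
  have "(\<integral>\<^sup>+x. g x \<partial>m) = (\<integral>\<^sup>+x. (\<integral>\<^sup>+s. g s * indicator {s} x \<partial>count_space (atoms m)) \<partial>m)"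
    unfolding one using at(3) by (intro nn_integral_cong_AE) auto
  also have "\<dots> = (\<integral>\<^sup>+s. (\<integral>\<^sup>+x. g s * indicator {s} x \<partial>m) \<partial>count_space (atoms m))"
  proof (rule nn_integral_count_space_nn_integral)
    fix s assume "s \<in> atoms m"
    then have "{s} \<in> sets m" using at(2) sets singleton_sets_restrict by blast
    then show "(\<lambda>x. g s * indicator {s} x) \<in> borel_measurable m" by simp
  qed (fact at(1))
  also have "\<dots> = (\<integral>\<^sup>+x. g x * emeasure m {x} \<partial>count_space (atoms m))"
  proof (intro nn_integral_cong nn_integral_cmult_indicator)
    fix s assume "s \<in> space (count_space (atoms m))"
    then show "{s} \<in> sets m" using at(2) sets singleton_sets_restrict by auto
  qed
  finally show ?thesis .
qed

definition simple_measure :: "'a measure \<Rightarrow> bool" where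
  "simple_measure m \<longleftrightarrow> (\<forall>x\<in>space m. emeasure m {x} \<le> 1)"

lemma simple_atom:
  fixes X :: "'a::euclidean_space set"
  assumes m: "m \<in> counting_measures X" "simple_measure m" and x: "x \<in> atoms m"
  shows "emeasure m {x} = 1"
proof -
  note sets = counting_measures_sets[OF m(1)]
  have xX: "x \<in> X" using x counting_measure_atoms(2)[OF m(1)] by auto
  have le: "emeasure m {x} \<le> 1" using m(2) xX by (auto simp: simple_measure_def sets)
  then have "emeasure m {x} < \<infinity>" by (auto simp: less_top intro: order.strict_trans1)
  then obtain k :: nat where k: "emeasure m {x} = of_nat k"
    using counting_measures_values[OF m(1)] singleton_sets_restrict[OF xX] sets(1) by metis
  then have "k \<noteq> 0" "k \<le> 1" using x le by (auto simp: atoms_def)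
  then have "k = 1" by simp
  then show ?thesis using k by simp
qed

lemma nn_integral_simple_measure:
  fixes X :: "'a::euclidean_space set" and g :: "'a \<Rightarrow> ennreal"
  assumes m: "m \<in> counting_measures X" "simple_measure m"
  shows "(\<integral>\<^sup>+x. g x \<partial>m) = (\<integral>\<^sup>+x. g x \<partial>count_space (atoms m))"
  unfolding nn_integral_counting_measure[OF m(1)] using simple_atom[OF m]
  by (intro nn_integral_cong) auto

lemma simple_measure_card:
  fixes X :: "'a::euclidean_space set"
  assumes m: "m \<in> counting_measures X" "simple_measure m" and B: "B \<in> sets m" "emeasure m B < \<infinity>"
  shows "finite (atoms m \<inter> B)" "emeasure m B = of_nat (card (atoms m \<inter> B))"
proof -
  have "emeasure m B = (\<integral>\<^sup>+x. indicator B x \<partial>count_space (atoms m))"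
    using B nn_integral_simple_measure[OF m, of "indicator B"] by simp
  also have "\<dots> = emeasure (count_space (atoms m)) (atoms m \<inter> B)"
    by (subst nn_integral_indicator') (auto simp: Int_commute)
  finally have eq: "emeasure m B = emeasure (count_space (atoms m)) (atoms m \<inter> B)" .
  show fin: "finite (atoms m \<inter> B)"
    using B(2) unfolding eq by (metis emeasure_count_space_infinite inf_le1 infinity_ennreal_def less_irrefl)
  show "emeasure m B = of_nat (card (atoms m \<inter> B))"
    unfolding eq using fin by (simp add: emeasure_count_space_finite)
qed

lemma dirac_counting_measure:
  fixes X :: "'a::euclidean_space set"
  assumes x: "x \<in> X"
  shows "return (restrict_space borel X) x \<in> counting_measures X"
proof -
  let ?r = "return (restrict_space borel X) x"
  have e: "emeasure ?r B = indicator B x" if "B \<in> sets (restrict_space borel X)" for B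
    using that by (rule emeasure_return)
  have "emeasure ?r B = (SUP K\<in>{K. compact K \<and> K \<subseteq> B}. emeasure ?r K)" if B: "B \<in> sets ?r" for B
  proof (rule antisym)
    show "emeasure ?r B \<le> (SUP K\<in>{K. compact K \<and> K \<subseteq> B}. emeasure ?r K)"
    proof (cases "x \<in> B")
      case True
      then have "emeasure ?r B = emeasure ?r {x}"
        using B x by (simp add: e singleton_sets_restrict)
      also have "\<dots> \<le> (SUP K\<in>{K. compact K \<and> K \<subseteq> B}. emeasure ?r K)"
        using True by (intro SUP_upper) auto
      finally show ?thesis .
    next
      case False
      then show ?thesis using B by (simp add: e)
    qed
    show "(SUP K\<in>{K. compact K \<and> K \<subseteq> B}. emeasure ?r K) \<le> emeasure ?r B"
      using B by (intro SUP_least emeasure_mono) auto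
  qed
  moreover have "\<exists>U. open U \<and> y \<in> U \<and> emeasure ?r (U \<inter> X) < \<infinity>" for y
    by (rule exI[of _ UNIV]) (simp add: e open_sets_restrict[of UNIV, simplified] indicator_def)
  ultimately have "radon_measure X ?r"
    unfolding radon_measure_def by auto
  moreover have "\<exists>k::nat. emeasure ?r B = of_nat k" if "B \<in> sets ?r" for B
    using that by (intro exI[of _ "if x \<in> B then 1 else 0"]) (auto simp: e)
  ultimately show ?thesis unfolding counting_measures_def by blast
qed

text \<open>Configurations with a single point, depending measurably on that point.\<close>

lemma measurable_dirac:
  fixes X :: "'a::euclidean_space set"
  shows "return (restrict_space borel X) \<in> restrict_space borel X \<rightarrow>\<^sub>M counting_measure_algebra X"
  unfolding counting_measure_algebra_def
proof (rule measurable_evaluation_algebra)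
  fix B assume B: "B \<in> sets (restrict_space borel X)"
  then show "(\<lambda>a. emeasure (return (restrict_space borel X) a) B) \<in> borel_measurable (restrict_space borel X)"
    by simp
qed (simp add: space_restrict_space dirac_counting_measure)

section \<open>Poisson random measures\<close>

locale poisson_input =
  fixes X :: "'x::euclidean_space set" and \<nu> :: "'x measure" and \<theta> :: "'x measure measure"
  assumes X: "X \<in> sets borel" and density: "bounded_density X \<nu>"
    and law: "poisson_random_measure_law X \<nu> \<theta>"
begin

sublocale \<theta>: prob_space \<theta>
  using law by (simp add: poisson_random_measure_law_def)

lemma sets_\<nu>[measurable_cong]: "sets \<nu> = sets (restrict_space borel X)"
proof -
  obtain f where "\<nu> = density (restrict_space lborel X) (\<lambda>x. ennreal (f x))"
    using density unfolding bounded_density_def by blast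
  then have "sets \<nu> = sets (restrict_space lborel X)" by simp
  also have "\<dots> = sets (restrict_space borel X)" by (rule sets_restrict_space_cong) simp
  finally show ?thesis .
qed

lemma space_\<nu>: "space \<nu> = X"
  using sets_eq_imp_space_eq[OF sets_\<nu>] by (simp add: space_restrict_space)

lemma sets_\<nu>_iff: "B \<in> sets \<nu> \<longleftrightarrow> B \<in> sets borel \<and> B \<subseteq> X"
  unfolding sets_\<nu> using X by (subst sets_restrict_space_iff) auto

lemma sets_\<theta>[measurable_cong]: "sets \<theta> = sets (counting_measure_algebra X)"
  using law by (simp add: poisson_random_measure_law_def)

lemma space_\<theta>: "space \<theta> = counting_measures X"
  using sets_eq_imp_space_eq[OF sets_\<theta>] by (simp add: space_counting_measure_algebra)

lemma sets_config: "\<xi> \<in> space \<theta> \<Longrightarrow> sets \<xi> = sets \<nu>" "\<xi> \<in> space \<theta> \<Longrightarrow> space \<xi> = X"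
  using counting_measures_sets[of \<xi> X] sets_\<nu> space_\<theta> by auto

lemma measurable_eval[measurable]: "B \<in> sets \<nu> \<Longrightarrow> (\<lambda>\<xi>. emeasure \<xi> B) \<in> borel_measurable \<theta>"
  using measurable_emeasure_evaluation_algebra[of B "restrict_space borel X" "counting_measures X"]
  by (simp add: sets_\<nu> counting_measure_algebra_def[symmetric] cong: measurable_cong_sets[OF sets_\<theta> refl])

lemma poisson_prob:
  assumes "B \<in> sets \<nu>" "emeasure \<nu> B < \<infinity>"
  shows "measure \<theta> {\<xi>\<in>space \<theta>. emeasure \<xi> B = of_nat k} = exp (- measure \<nu> B) * measure \<nu> B ^ k / fact k"
  using law assms by (simp add: poisson_random_measure_law_def)

text \<open>This comparison makes windows finite and thin slices small.\<close>

lemma \<nu>_le_lebesgue: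
  obtains C :: real where "0 \<le> C" "\<And>B. B \<in> sets \<nu> \<Longrightarrow> emeasure \<nu> B \<le> ennreal C * emeasure lborel B"
proof -
  obtain f c C where f: "f \<in> borel_measurable (restrict_space borel X)" "0 < c"
      "\<And>x. x \<in> X \<Longrightarrow> c \<le> f x" "\<And>x. x \<in> X \<Longrightarrow> f x \<le> C"
    and \<nu>: "\<nu> = density (restrict_space lborel X) (\<lambda>x. ennreal (f x))"
    using density unfolding bounded_density_def by blast
  have [measurable]: "f \<in> borel_measurable (restrict_space lborel X)"
    using f(1) by (simp cong: measurable_cong_sets[OF sets_restrict_space_cong refl])
  show thesis
  proof (rule that[of "max 0 C"])
    fix B assume B: "B \<in> sets \<nu>"
    then have B': "B \<in> sets (restrict_space lborel X)" unfolding \<nu> by simp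
    have "emeasure \<nu> B = (\<integral>\<^sup>+x. ennreal (f x) * indicator B x \<partial>restrict_space lborel X)"
      unfolding \<nu> using B' by (intro emeasure_density) auto
    also have "\<dots> \<le> (\<integral>\<^sup>+x. ennreal (max 0 C) * indicator B x \<partial>restrict_space lborel X)"
    proof (intro nn_integral_mono mult_right_mono ennreal_leI)
      fix x assume "x \<in> space (restrict_space lborel X)"
      then have "x \<in> X" by (simp add: space_restrict_space)
      then show "f x \<le> max 0 C" using f(4)[of x] by simp
    qed simp
    also have "\<dots> = ennreal (max 0 C) * emeasure (restrict_space lborel X) B"
      using B' by (rule nn_integral_cmult_indicator)
    also have "emeasure (restrict_space lborel X) B = emeasure lborel B"
      using X B by (intro emeasure_restrict_space) (auto simp: sets_\<nu>_iff)
    finally show "emeasure \<nu> B \<le> ennreal (max 0 C) * emeasure lborel B" .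
  qed simp
qed

text \<open>An exhaustion of \<open>X\<close> by sets of finite intensity.\<close>

definition window :: "nat \<Rightarrow> 'x set" where
  "window n = X \<inter> cbox (- (real n *\<^sub>R One)) (real n *\<^sub>R One)"

lemma window_sets[measurable]: "window n \<in> sets \<nu>"
  unfolding window_def sets_\<nu>_iff using X by auto

lemma window_finite: "emeasure \<nu> (window n) < \<infinity>"
proof -
  obtain C :: real where C: "0 \<le> C" "\<And>B. B \<in> sets \<nu> \<Longrightarrow> emeasure \<nu> B \<le> ennreal C * emeasure lborel B"
    using \<nu>_le_lebesgue by blast
  have "emeasure \<nu> (window n) \<le> ennreal C * emeasure lborel (window n)" by (intro C(2) window_sets)
  also have "\<dots> \<le> ennreal C * emeasure lborel (cbox (- (real n *\<^sub>R One)) (real n *\<^sub>R One :: 'x))"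
    by (intro mult_left_mono emeasure_mono) (auto simp: window_def)
  also have "\<dots> < \<infinity>"
    using emeasure_lborel_cbox_finite[of "- (real n *\<^sub>R One)" "real n *\<^sub>R One :: 'x"]
    by (simp add: ennreal_mult_less_top)
  finally show ?thesis .
qed

lemma window_mono: "n \<le> m \<Longrightarrow> window n \<subseteq> window m"
  unfolding window_def by (auto simp: mem_box inner_diff_left) (force+)

lemma window_UN: "(\<Union>n. window n) = X"
proof
  show "X \<subseteq> (\<Union>n. window n)"
  proof
    fix x assume x: "x \<in> X"
    obtain n :: nat where n: "norm x \<le> real n" using real_arch_simple by blast
    have "\<bar>x \<bullet> i\<bar> \<le> real n" if "i \<in> Basis" for i
      using Basis_le_norm[OF that, of x] n by linarith
    then have "x \<in> cbox (- (real n *\<^sub>R One)) (real n *\<^sub>R One)"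
      by (auto simp: mem_box abs_le_iff) (force+)
    then show "x \<in> (\<Union>n. window n)" using x by (auto simp: window_def)
  qed
qed (auto simp: window_def)

lemma window_eventually: "x \<in> X \<Longrightarrow> \<forall>\<^sub>F n in sequentially. x \<in> window n"
  using window_UN window_mono unfolding eventually_sequentially by blast

sublocale \<nu>: sigma_finite_measure \<nu>
proof
  show "\<exists>A. countable A \<and> A \<subseteq> sets \<nu> \<and> \<Union>A = space \<nu> \<and> (\<forall>a\<in>A. emeasure \<nu> a \<noteq> \<infinity>)"
    using window_UN window_finite window_sets
    by (intro exI[of _ "range window"]) (auto simp: space_\<nu> less_top)
qed

lemma AE_finite:
  assumes B[measurable]: "B \<in> sets \<nu>" and fin: "emeasure \<nu> B < \<infinity>"
  shows "AE \<xi> in \<theta>. emeasure \<xi> B < \<infinity>"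
proof -
  let ?p = "measure \<nu> B"
  let ?A = "\<lambda>k::nat. {\<xi>\<in>space \<theta>. emeasure \<xi> B = of_nat k}"
  have "(\<lambda>k. measure \<theta> (?A k)) sums measure \<theta> (\<Union>k. ?A k)"
    by (rule \<theta>.finite_measure_UNION) (auto simp: disjoint_family_on_def)
  moreover have "(\<lambda>k. measure \<theta> (?A k)) sums (exp (- ?p) * exp ?p)"
    unfolding poisson_prob[OF assms]
    using sums_mult[OF exp_converges[of ?p], of "exp (- ?p)"] by (simp add: divide_inverse mult_ac)
  ultimately have "measure \<theta> (\<Union>k. ?A k) = 1"
    using sums_unique2 by (fastforce simp flip: exp_add)
  moreover have "(\<Union>k. ?A k) \<in> sets \<theta>" by measurable
  ultimately have "AE \<xi> in \<theta>. \<xi> \<in> (\<Union>k. ?A k)"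
    using \<theta>.AE_prob_1 by blast
  then show ?thesis
    by eventually_elim (auto simp: of_nat_less_top)
qed

lemma prob_two_points:
  assumes B[measurable]: "B \<in> sets \<nu>" and fin: "emeasure \<nu> B < \<infinity>"
  shows "measure \<theta> {\<xi>\<in>space \<theta>. \<not> emeasure \<xi> B \<le> 1} \<le> (measure \<nu> B)\<^sup>2"
proof -
  let ?p = "measure \<nu> B"
  let ?A = "\<lambda>k::nat. {\<xi>\<in>space \<theta>. emeasure \<xi> B = of_nat k}"
  have "measure \<theta> {\<xi>\<in>space \<theta>. \<not> emeasure \<xi> B \<le> 1} \<le> measure \<theta> (space \<theta> - (?A 0 \<union> ?A 1))"
    by (intro \<theta>.finite_measure_mono) auto
  also have "\<dots> = 1 - measure \<theta> (?A 0 \<union> ?A 1)"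
    by (intro \<theta>.prob_compl) measurable
  also have "measure \<theta> (?A 0 \<union> ?A 1) = measure \<theta> (?A 0) + measure \<theta> (?A 1)"
    by (intro \<theta>.finite_measure_Union) auto
  also have "\<dots> = (1 + ?p) * exp (- ?p)"
    unfolding poisson_prob[OF assms] by (simp add: algebra_simps)
  also have "1 - \<dots> \<le> 1 - (1 + ?p) * (1 - ?p)"
    using exp_ge_add_one_self[of "- ?p"] by (intro diff_left_mono mult_left_mono) auto
  also have "\<dots> = ?p\<^sup>2" by (simp add: power2_eq_square algebra_simps)
  finally show ?thesis .
qed

text \<open>The slabs of width \<open>1 / (m + 1)\<close> orthogonal to \<open>b\<close>.  One direction is enough to cut a window into
  pieces whose intensity is uniformly small.\<close>

definition slice :: "'x \<Rightarrow> nat \<Rightarrow> nat \<Rightarrow> int \<Rightarrow> 'x set" where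
  "slice b n m j = {x \<in> window n. \<lfloor>real (Suc m) * (x \<bullet> b)\<rfloor> = j}"

lemma slice_sets[measurable]: "slice b n m j \<in> sets \<nu>"
proof -
  have [measurable]: "window n \<in> sets borel" using window_sets[of n] by (simp add: sets_\<nu>_iff)
  have "slice b n m j = window n \<inter> {x \<in> space borel. real_of_int j \<le> real (Suc m) * (x \<bullet> b)
      \<and> real (Suc m) * (x \<bullet> b) < real_of_int j + 1}"
    by (auto simp: slice_def floor_eq_iff)
  also have "\<dots> \<in> sets borel" by measurable
  finally show ?thesis by (auto simp: sets_\<nu>_iff slice_def window_def)
qed

lemma slice_measure:
  assumes b: "b \<in> Basis"
  obtains K :: real where "0 \<le> K" "\<And>m j. measure \<nu> (slice b n m j) \<le> K / Suc m"
proof -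
  obtain C :: real where C: "0 \<le> C" "\<And>B. B \<in> sets \<nu> \<Longrightarrow> emeasure \<nu> B \<le> ennreal C * emeasure lborel B"
    using \<nu>_le_lebesgue by blast
  let ?K = "(2 * real n) ^ (DIM('x) - 1)"
  show thesis
  proof (rule that[of "C * ?K"])
    show "0 \<le> C * ?K" using C by simp
    fix m :: nat and j :: int
    define l :: 'x where "l = (\<Sum>i\<in>Basis. (if i = b then j / Suc m else - real n) *\<^sub>R i)"
    define u :: 'x where "u = (\<Sum>i\<in>Basis. (if i = b then (j + 1) / Suc m else real n) *\<^sub>R i)"
    have lu: "l \<bullet> i = (if i = b then j / Suc m else - real n)" "u \<bullet> i = (if i = b then (j + 1) / Suc m else real n)"
      if "i \<in> Basis" for i
      unfolding l_def u_def using that by (simp_all add: inner_sum_left_Basis)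
    have sub: "slice b n m j \<subseteq> cbox l u"
    proof
      fix x assume "x \<in> slice b n m j"
      then have x: "x \<in> cbox (- (real n *\<^sub>R One)) (real n *\<^sub>R One)" "\<lfloor>real (Suc m) * (x \<bullet> b)\<rfloor> = j"
        by (auto simp: slice_def window_def)
      have "j \<le> real (Suc m) * (x \<bullet> b)" "real (Suc m) * (x \<bullet> b) \<le> j + 1"
        using x(2) by linarith+
      then have 1: "j / Suc m \<le> x \<bullet> b" "x \<bullet> b \<le> (j + 1) / Suc m"
        by (simp_all add: pos_divide_le_eq pos_le_divide_eq mult.commute del: of_nat_Suc)
      have 2: "- real n \<le> x \<bullet> i" "x \<bullet> i \<le> real n" if "i \<in> Basis" for i
        using x(1) that by (auto simp: mem_box)
      show "x \<in> cbox l u"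
        unfolding mem_box using 1 2 by (auto simp: lu simp del: of_nat_Suc)
    qed
    have "emeasure lborel (cbox l u) = ennreal (\<Prod>i\<in>Basis. (u - l) \<bullet> i)"
      by (intro emeasure_lborel_cbox) (auto simp: lu divide_right_mono)
    also have "(\<Prod>i\<in>Basis. (u - l) \<bullet> i) = (u - l) \<bullet> b * (\<Prod>i\<in>Basis - {b}. (u - l) \<bullet> i)"
      using b by (intro prod.remove) auto
    also have "(u - l) \<bullet> b = 1 / Suc m" using b by (simp add: inner_diff_left lu add_divide_distrib)
    also have "(\<Prod>i\<in>Basis - {b}. (u - l) \<bullet> i) = (\<Prod>i\<in>Basis - {b}. 2 * real n)"
      by (intro prod.cong) (auto simp: inner_diff_left lu)
    also have "\<dots> = ?K" using b by (simp add: card_Diff_singleton)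
    finally have vol: "emeasure lborel (cbox l u) = ennreal (1 / Suc m * ?K)" .
    have "emeasure \<nu> (slice b n m j) \<le> ennreal C * emeasure lborel (slice b n m j)"
      by (intro C(2) slice_sets)
    also have "\<dots> \<le> ennreal C * emeasure lborel (cbox l u)"
      by (intro mult_left_mono emeasure_mono sub) auto
    also have "\<dots> = ennreal (C * ?K / Suc m)"
      unfolding vol using C(1) by (simp add: ennreal_mult[symmetric] del: of_nat_Suc)
    finally have "emeasure \<nu> (slice b n m j) \<le> ennreal (C * ?K / Suc m)" .
    then show "measure \<nu> (slice b n m j) \<le> C * ?K / Suc m"
      unfolding measure_def using C(1)
      by (intro enn2real_leI) (auto simp del: of_nat_Suc)
  qed
qed

text \<open>If a window contains a double point, then for every \<open>m\<close> some slice contains at least two points.  This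
  has probability at most the sum of the squared intensities of the slices, hence at most their
  maximal intensity times that of the window, which tends to \<open>0\<close>.\<close>

lemma AE_no_double_point: "AE \<xi> in \<theta>. \<forall>x\<in>window n. emeasure \<xi> {x} \<le> 1"
proof -
  obtain b :: 'x where b: "b \<in> Basis" using nonempty_Basis by blast
  obtain K :: real where K: "0 \<le> K" "\<And>m j. measure \<nu> (slice b n m j) \<le> K / Suc m"
    using slice_measure[OF b] by blast
  define J where "J m = {- int (n * Suc m) .. int (n * Suc m)}" for m
  define N where "N m = (\<Union>j\<in>J m. {\<xi>\<in>space \<theta>. \<not> emeasure \<xi> (slice b n m j) \<le> 1})" for m
  have cover: "window n = (\<Union>j\<in>J m. slice b n m j)" for m
  proof
    show "window n \<subseteq> (\<Union>j\<in>J m. slice b n m j)"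
    proof
      fix x assume x: "x \<in> window n"
      then have "- real n \<le> x \<bullet> b" "x \<bullet> b \<le> real n"
        using b by (auto simp: window_def mem_box)
      then have "real (Suc m) * - real n \<le> real (Suc m) * (x \<bullet> b)" "real (Suc m) * (x \<bullet> b) \<le> real (Suc m) * real n"
        by (intro mult_left_mono; simp)+
      then have "of_int (- int (n * Suc m)) \<le> real (Suc m) * (x \<bullet> b)"
          "real (Suc m) * (x \<bullet> b) \<le> of_int (int (n * Suc m))"
        by (simp_all only: of_int_minus of_int_of_nat_eq of_nat_mult of_int_mult mult.commute mult_minus_left)
      then have "\<lfloor>real (Suc m) * (x \<bullet> b)\<rfloor> \<in> J m"
        unfolding J_def atLeastAtMost_iff le_floor_iff floor_le_iff by linarith
      then show "x \<in> (\<Union>j\<in>J m. slice b n m j)" using x by (auto simp: slice_def)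
    qed
  qed (auto simp: slice_def)
  have fin: "emeasure \<nu> (slice b n m j) < \<infinity>" for m j
    by (rule le_less_trans[OF emeasure_mono window_finite[of n]]) (auto simp: slice_def)
  have N_sets[measurable]: "N m \<in> sets \<theta>" for m unfolding N_def J_def by measurable
  have bound: "measure \<theta> (N m) \<le> K * measure \<nu> (window n) / Suc m" for m
  proof -
    have "measure \<theta> (N m) \<le> (\<Sum>j\<in>J m. measure \<theta> {\<xi>\<in>space \<theta>. \<not> emeasure \<xi> (slice b n m j) \<le> 1})"
      unfolding N_def by (intro \<theta>.finite_measure_subadditive_finite) (auto simp: J_def)
    also have "\<dots> \<le> (\<Sum>j\<in>J m. (measure \<nu> (slice b n m j))\<^sup>2)"
      by (intro sum_mono prob_two_points slice_sets fin)
    also have "\<dots> \<le> (\<Sum>j\<in>J m. K / Suc m * measure \<nu> (slice b n m j))"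
      unfolding power2_eq_square by (intro sum_mono mult_right_mono K(2)) simp
    also have "\<dots> = K / Suc m * (\<Sum>j\<in>J m. measure \<nu> (slice b n m j))" by (simp add: sum_distrib_left)
    also have "(\<Sum>j\<in>J m. measure \<nu> (slice b n m j)) = measure \<nu> (window n)"
      unfolding cover[of m]
    proof (rule measure_finite_Union[symmetric])
      show "finite (J m)" unfolding J_def by simp
      show "slice b n m ` J m \<subseteq> sets \<nu>" using slice_sets by blast
      show "disjoint_family_on (slice b n m) (J m)" by (auto simp: disjoint_family_on_def slice_def)
      show "emeasure \<nu> (slice b n m j) \<noteq> \<infinity>" for j using fin[of m j] by simp
    qed
    finally show ?thesis by simp
  qed
  have "measure \<theta> (\<Inter>m. N m) \<le> K * measure \<nu> (window n) / Suc m" for m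
    by (rule order_trans[OF \<theta>.finite_measure_mono bound]) auto
  then have "measure \<theta> (\<Inter>m. N m) \<le> 0"
    by (intro LIMSEQ_le_const[OF LIMSEQ_Suc[OF lim_const_over_n]]) auto
  then have "measure \<theta> (\<Inter>m. N m) = 0"
    using measure_nonneg[of \<theta> "\<Inter>m. N m"] by linarith
  moreover have "(\<Inter>m. N m) \<in> sets \<theta>" by measurable
  ultimately have "(\<Inter>m. N m) \<in> null_sets \<theta>"
    by (simp add: \<theta>.emeasure_eq_measure null_sets_def)
  then have "AE \<xi> in \<theta>. \<xi> \<notin> (\<Inter>m. N m)" by (rule AE_not_in)
  then show ?thesis
    using AE_space
  proof eventually_elim
    case (elim \<xi>)
    then obtain m where m: "\<xi> \<notin> N m" by auto
    show ?case
    proof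
      fix x assume "x \<in> window n"
      then obtain j where j: "j \<in> J m" "x \<in> slice b n m j" using cover by blast
      have "emeasure \<xi> {x} \<le> emeasure \<xi> (slice b n m j)"
        using j(2) sets_config[OF elim(2)] by (intro emeasure_mono) auto
      also have "\<dots> \<le> 1" using m j(1) elim(2) by (auto simp: N_def)
      finally show "emeasure \<xi> {x} \<le> 1" .
    qed
  qed
qed

definition regular :: "'x measure \<Rightarrow> bool" where
  "regular \<xi> \<longleftrightarrow> \<xi> \<in> counting_measures X \<and> simple_measure \<xi> \<and> (\<forall>n. emeasure \<xi> (window n) < \<infinity>)"

lemma AE_regular: "AE \<xi> in \<theta>. regular \<xi>"
proof -
  have "AE \<xi> in \<theta>. (\<forall>n. \<forall>x\<in>window n. emeasure \<xi> {x} \<le> 1) \<and> (\<forall>n. emeasure \<xi> (window n) < \<infinity>)"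
    using AE_no_double_point AE_finite[OF window_sets window_finite] by (simp add: AE_all_countable)
  then show ?thesis using AE_space
  proof eventually_elim
    case (elim \<xi>)
    then show ?case
      using sets_config[OF elim(2)] window_UN
      by (auto simp: regular_def simple_measure_def space_\<theta>)
  qed
qed

text \<open>The number of points as a natural number, with the junk value \<open>0\<close> for infinitely many points.\<close>

definition count :: "'x set \<Rightarrow> 'x measure \<Rightarrow> nat" where
  "count B \<xi> = nat \<lfloor>enn2real (emeasure \<xi> B)\<rfloor>"

lemma count_eq: "emeasure \<xi> B = of_nat k \<Longrightarrow> count B \<xi> = k"
  unfolding count_def by (simp add: ennreal_of_nat_eq_real_of_nat)

lemma count_measurable[measurable]:
  assumes [measurable]: "B \<in> sets \<nu>" shows "count B \<in> \<theta> \<rightarrow>\<^sub>M count_space UNIV"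
  unfolding count_def by measurable

lemma prob_count:
  assumes B[measurable]: "B \<in> sets \<nu>" "emeasure \<nu> B < \<infinity>"
  shows "measure \<theta> {\<xi>\<in>space \<theta>. count B \<xi> = k} = exp (- measure \<nu> B) * measure \<nu> B ^ k / fact k"
proof -
  have "measure \<theta> {\<xi>\<in>space \<theta>. count B \<xi> = k} = measure \<theta> {\<xi>\<in>space \<theta>. emeasure \<xi> B = of_nat k}"
  proof (rule \<theta>.finite_measure_eq_AE)
    show "AE \<xi> in \<theta>. (\<xi> \<in> {\<xi>\<in>space \<theta>. count B \<xi> = k}) = (\<xi> \<in> {\<xi>\<in>space \<theta>. emeasure \<xi> B = of_nat k})"
      using AE_finite[OF B] AE_space
    proof eventually_elim
      case (elim \<xi>)
      then obtain l :: nat where "emeasure \<xi> B = of_nat l"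
        using counting_measures_values[of \<xi> X B] sets_config B by (auto simp: space_\<theta>)
      then show ?case using count_eq[of \<xi> B] by auto
    qed
  qed measurable
  then show ?thesis using poisson_prob[OF assms] by simp
qed

lemma generating_function:
  fixes z :: complex
  assumes B[measurable]: "B \<in> sets \<nu>" "emeasure \<nu> B < \<infinity>" and z: "norm z \<le> 1"
  shows "(\<integral>\<xi>. z ^ count B \<xi> \<partial>\<theta>) = exp (of_real (measure \<nu> B) * (z - 1))"
proof -
  define p where "p = measure \<nu> B"
  have p: "0 \<le> p" unfolding p_def by simp
  define w where "w k = exp (- p) * p ^ k / fact k" for k
  have w: "0 \<le> w k" for k unfolding w_def using p by simp
  let ?D = "distr \<theta> (count_space UNIV) (count B)"
  have D: "?D = density (count_space UNIV) (\<lambda>k. ennreal (w k))"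
  proof (rule measure_eqI_countable[where A=UNIV])
    fix k :: nat
    have "emeasure ?D {k} = ennreal (measure \<theta> {\<xi>\<in>space \<theta>. count B \<xi> = k})"
      by (subst emeasure_distr) (auto simp: \<theta>.emeasure_eq_measure vimage_def Int_def conj_commute)
    also have "\<dots> = ennreal (w k)" unfolding prob_count[OF B] w_def p_def ..
    also have "\<dots> = emeasure (density (count_space UNIV) (\<lambda>k. ennreal (w k))) {k}"
      by (subst emeasure_density) (auto simp: nn_integral_count_space_indicator one_ennreal_def[symmetric])
    finally show "emeasure ?D {k} = emeasure (density (count_space UNIV) (\<lambda>k. ennreal (w k))) {k}" .
  qed auto
  have sum: "(\<lambda>k. w k *\<^sub>R z ^ k) sums (exp (- of_real p) * exp (z * of_real p))"
  proof -
    have "(\<lambda>k. exp (- of_real p) * ((z * of_real p) ^ k /\<^sub>R fact k)) sums (exp (- of_real p) * exp (z * of_real p))"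
      by (intro sums_mult exp_converges)
    moreover have "exp (- of_real p) * ((z * of_real p) ^ k /\<^sub>R fact k) = w k *\<^sub>R z ^ k" for k
      by (simp add: w_def scaleR_conv_of_real power_mult_distrib divide_inverse exp_of_real[symmetric] mult_ac del: exp_of_real)
    ultimately show ?thesis by simp
  qed
  have int: "integrable (count_space UNIV) (\<lambda>k. w k *\<^sub>R z ^ k)"
    unfolding integrable_count_space_nat_iff
  proof (rule summable_comparison_test')
    show "summable w"
      unfolding w_def using summable_mult[OF summable_exp[of p], of "exp (- p)"]
      by (simp add: divide_inverse mult_ac)
    show "norm (norm (w k *\<^sub>R z ^ k)) \<le> w k" if "0 \<le> k" for k
      using w[of k] z by (simp add: norm_power power_le_one mult_left_le)
  qed
  have "(\<integral>\<xi>. z ^ count B \<xi> \<partial>\<theta>) = (\<integral>k. z ^ k \<partial>?D)"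
    by (subst integral_distr) auto
  also have "\<dots> = (\<integral>k. w k *\<^sub>R z ^ k \<partial>count_space UNIV)"
    unfolding D using w by (subst integral_density) auto
  also have "\<dots> = exp (- of_real p) * exp (z * of_real p)"
    using sums_integral_count_space_nat[OF int] sum sums_unique2 by blast
  also have "\<dots> = exp (of_real p * (z - 1))"
    by (simp add: algebra_simps flip: exp_add)
  finally show ?thesis unfolding p_def .
qed

lemma joint_generating_function:
  fixes z :: "nat \<Rightarrow> complex"
  assumes D: "\<And>i. i < n \<Longrightarrow> D i \<in> sets \<nu>" "\<And>i. i < n \<Longrightarrow> emeasure \<nu> (D i) < \<infinity>"
    and disj: "disjoint_family_on D {..<n}" and z: "\<And>i. i < n \<Longrightarrow> norm (z i) \<le> 1"
  shows "(\<integral>\<xi>. (\<Prod>i<n. z i ^ count (D i) \<xi>) \<partial>\<theta>) = exp (\<Sum>i<n. of_real (measure \<nu> (D i)) * (z i - 1))"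
proof -
  have "\<theta>.indep_vars (\<lambda>_. borel) (\<lambda>i \<xi>. emeasure \<xi> (D i)) {..<n}"
    using law D disj by (simp add: poisson_random_measure_law_def)
  then have "\<theta>.indep_vars (\<lambda>_. borel) (\<lambda>i \<xi>. z i ^ nat \<lfloor>enn2real (emeasure \<xi> (D i))\<rfloor>) {..<n}"
    by (rule \<theta>.indep_vars_compose2) measurable
  then have ind: "\<theta>.indep_vars (\<lambda>_. borel) (\<lambda>i \<xi>. z i ^ count (D i) \<xi>) {..<n}"
    unfolding count_def .
  have int: "integrable \<theta> (\<lambda>\<xi>. z i ^ count (D i) \<xi>)" if "i < n" for i
  proof (rule \<theta>.integrable_const_bound[where B=1])
    show "AE \<xi> in \<theta>. norm (z i ^ count (D i) \<xi>) \<le> 1"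
      using z[OF that] by (simp add: norm_power power_le_one)
    have [measurable]: "D i \<in> sets \<nu>" using D(1)[OF that] .
    show "(\<lambda>\<xi>. z i ^ count (D i) \<xi>) \<in> borel_measurable \<theta>" by measurable
  qed
  have "(\<integral>\<xi>. (\<Prod>i<n. z i ^ count (D i) \<xi>) \<partial>\<theta>) = (\<Prod>i<n. \<integral>\<xi>. z i ^ count (D i) \<xi> \<partial>\<theta>)"
    by (rule \<theta>.indep_vars_lebesgue_integral[OF _ ind]) (use int in auto)
  also have "\<dots> = (\<Prod>i<n. exp (of_real (measure \<nu> (D i)) * (z i - 1)))"
    by (intro prod.cong refl generating_function) (use D z in auto)
  also have "\<dots> = exp (\<Sum>i<n. of_real (measure \<nu> (D i)) * (z i - 1))"
    by (simp add: exp_sum)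
  finally show ?thesis .
qed

lemma regular_count:
  assumes \<xi>: "regular \<xi>" and B: "B \<in> sets \<nu>" "emeasure \<xi> B < \<infinity>"
  shows "finite (atoms \<xi> \<inter> B)" "count B \<xi> = card (atoms \<xi> \<inter> B)"
proof -
  have \<xi>': "\<xi> \<in> counting_measures X" "simple_measure \<xi>" using \<xi> by (auto simp: regular_def)
  have "B \<in> sets \<xi>" using B(1) counting_measures_sets[OF \<xi>'(1)] sets_\<nu> by simp
  note * = simple_measure_card[OF \<xi>' this B(2)]
  show "finite (atoms \<xi> \<inter> B)" by (rule *(1))
  show "count B \<xi> = card (atoms \<xi> \<inter> B)" by (rule count_eq[OF *(2)])
qed

text \<open>If \<open>s\<close> takes finitely many values, the product over the points in \<open>B\<close> is a product of powers with the
  numbers of points in the level sets as exponents, and these are independent Poisson variables.\<close>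

lemma product_functional_simple:
  fixes s :: "'x \<Rightarrow> complex"
  assumes B[measurable]: "B \<in> sets \<nu>" "emeasure \<nu> B < \<infinity>"
    and s: "simple_function \<nu> s" "\<And>x. x \<in> X \<Longrightarrow> norm (s x) \<le> 1"
  shows "\<exists>F. F \<in> borel_measurable \<theta> \<and>
    (\<forall>\<xi>. regular \<xi> \<longrightarrow> emeasure \<xi> B < \<infinity> \<longrightarrow> F \<xi> = (\<Prod>x\<in>atoms \<xi> \<inter> B. s x)) \<and>
    (\<integral>\<xi>. F \<xi> \<partial>\<theta>) = exp (\<integral>x. indicator B x *\<^sub>R (s x - 1) \<partial>\<nu>)"
proof -
  define V where "V = s ` X"
  have V: "finite V" using s(1) by (simp add: V_def simple_function_def space_\<nu>)
  define D where "D v = s -` {v} \<inter> X \<inter> B" for v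
  have D: "D v \<in> sets \<nu>" for v
  proof (cases "v \<in> V")
    case True
    then have "s -` {v} \<inter> X \<in> sets \<nu>"
      using s(1) by (auto simp: simple_function_def space_\<nu> V_def)
    then show ?thesis
      unfolding D_def using B(1) by (rule sets.Int)
  next
    case False
    then have "D v = {}" by (auto simp: D_def V_def)
    then show ?thesis by simp
  qed
  have D_fin: "emeasure \<nu> (D v) < \<infinity>" for v
    by (rule le_less_trans[OF emeasure_mono B(2)]) (auto simp: D_def B(1))
  obtain h where h: "bij_betw h {0..<card V} V" using ex_bij_betw_nat_finite[OF V] by blast
  then have h': "bij_betw h {..<card V} V" by (simp add: atLeast0LessThan)
  define F where "F \<xi> = (\<Prod>i<card V. h i ^ count (D (h i)) \<xi>)" for \<xi>
  have F_V: "F \<xi> = (\<Prod>v\<in>V. v ^ count (D v) \<xi>)" for \<xi>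
    unfolding F_def by (rule prod.reindex_bij_betw[OF h'])
  show ?thesis
  proof (intro exI conjI allI impI)
    show "F \<in> borel_measurable \<theta>"
    proof -
      have [measurable]: "D v \<in> sets \<nu>" for v by (rule D)
      show ?thesis unfolding F_def by measurable
    qed
    show "F \<xi> = (\<Prod>x\<in>atoms \<xi> \<inter> B. s x)" if \<xi>: "regular \<xi>" "emeasure \<xi> B < \<infinity>" for \<xi>
    proof -
      have at: "atoms \<xi> \<subseteq> X" using \<xi> by (auto simp: regular_def dest: counting_measure_atoms(2))
      have Bs: "B \<in> sets \<xi>" using \<xi>(1) B(1) counting_measures_sets sets_\<nu> by (auto simp: regular_def)
      have "emeasure \<xi> (D v) < \<infinity>" for v
        by (rule le_less_trans[OF emeasure_mono \<xi>(2)]) (auto simp: D_def Bs)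
      then have c: "count (D v) \<xi> = card (atoms \<xi> \<inter> D v)" for v
        by (rule regular_count(2)[OF \<xi>(1) D])
      have "(\<Prod>x\<in>atoms \<xi> \<inter> B. s x) = (\<Prod>v\<in>V. \<Prod>x\<in>{x \<in> atoms \<xi> \<inter> B. s x = v}. s x)"
        by (rule prod.group[symmetric]) (use regular_count(1)[OF \<xi>(1) B(1) \<xi>(2)] V at in \<open>auto simp: V_def\<close>)
      also have "\<dots> = (\<Prod>v\<in>V. v ^ card (atoms \<xi> \<inter> D v))"
      proof (intro prod.cong refl)
        fix v
        have "{x \<in> atoms \<xi> \<inter> B. s x = v} = atoms \<xi> \<inter> D v" using at by (auto simp: D_def)
        moreover have "(\<Prod>x\<in>{x \<in> atoms \<xi> \<inter> B. s x = v}. s x) = (\<Prod>x\<in>{x \<in> atoms \<xi> \<inter> B. s x = v}. v)"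
          by (intro prod.cong) auto
        ultimately show "(\<Prod>x\<in>{x \<in> atoms \<xi> \<inter> B. s x = v}. s x) = v ^ card (atoms \<xi> \<inter> D v)" by simp
      qed
      finally show ?thesis unfolding F_V c by simp
    qed
    have "(\<integral>\<xi>. F \<xi> \<partial>\<theta>) = exp (\<Sum>i<card V. of_real (measure \<nu> (D (h i))) * (h i - 1))"
      unfolding F_def
    proof (rule joint_generating_function)
      show "disjoint_family_on (\<lambda>i. D (h i)) {..<card V}"
        using bij_betw_imp_inj_on[OF h'] by (auto simp: disjoint_family_on_def D_def inj_on_def)
      show "norm (h i) \<le> 1" if "i < card V" for i
      proof -
        have "h i \<in> V" using bij_betwE[OF h'] that by blast
        then show ?thesis using s(2) by (auto simp: V_def)
      qed
    qed (use D D_fin in auto)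
    also have "(\<Sum>i<card V. of_real (measure \<nu> (D (h i))) * (h i - 1)) = (\<Sum>v\<in>V. of_real (measure \<nu> (D v)) * (v - 1))"
      by (rule sum.reindex_bij_betw[OF h'])
    also have "\<dots> = (\<Sum>v\<in>V. \<integral>x. indicator (D v) x *\<^sub>R (v - 1) \<partial>\<nu>)"
    proof (intro sum.cong refl)
      fix v
      have [measurable]: "D v \<in> sets \<nu>" by (rule D)
      show "of_real (measure \<nu> (D v)) * (v - 1) = (\<integral>x. indicator (D v) x *\<^sub>R (v - 1) \<partial>\<nu>)"
        using D_fin[of v] by (simp add: scaleR_conv_of_real less_top)
    qed
    also have "\<dots> = (\<integral>x. (\<Sum>v\<in>V. indicator (D v) x *\<^sub>R (v - 1)) \<partial>\<nu>)"
      using D D_fin by (intro Bochner_Integration.integral_sum[symmetric] integrable_scaleR_left)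
        (auto simp: less_top intro!: integrable_real_indicator)
    also have "\<dots> = (\<integral>x. indicator B x *\<^sub>R (s x - 1) \<partial>\<nu>)"
    proof (rule Bochner_Integration.integral_cong[OF refl])
      fix x assume "x \<in> space \<nu>"
      then have x: "s x \<in> V" "x \<in> X" by (auto simp: V_def space_\<nu>)
      have "(\<Sum>v\<in>V. indicator (D v) x *\<^sub>R (v - 1)) = (\<Sum>v\<in>V. if v = s x then indicator B x *\<^sub>R (s x - 1) else 0)"
        by (intro sum.cong) (use x in \<open>auto simp: D_def indicator_def\<close>)
      then show "(\<Sum>v\<in>V. indicator (D v) x *\<^sub>R (v - 1)) = indicator B x *\<^sub>R (s x - 1)"
        using x V by (simp add: sum.delta)
    qed
    finally show "(\<integral>\<xi>. F \<xi> \<partial>\<theta>) = exp (\<integral>x. indicator B x *\<^sub>R (s x - 1) \<partial>\<nu>)" .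
  qed
qed

text \<open>The product over the atoms need not be measurable on the null set of irregular configurations, so the
  statement provides a measurable version \<open>F\<close>.\<close>

lemma product_functional:
  fixes \<phi> :: "'x \<Rightarrow> complex"
  assumes B[measurable]: "B \<in> sets \<nu>" "emeasure \<nu> B < \<infinity>"
    and \<phi>[measurable]: "\<phi> \<in> borel_measurable \<nu>" and bd: "\<And>x. x \<in> X \<Longrightarrow> norm (\<phi> x) \<le> 1"
  shows "\<exists>F. F \<in> borel_measurable \<theta> \<and> (AE \<xi> in \<theta>. F \<xi> = (\<Prod>x\<in>atoms \<xi> \<inter> B. \<phi> x)) \<and>
    (\<integral>\<xi>. F \<xi> \<partial>\<theta>) = exp (\<integral>x. indicator B x *\<^sub>R (\<phi> x - 1) \<partial>\<nu>)"
proof -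
  obtain s where s: "\<And>i. simple_function \<nu> (s i)" "\<And>x. x \<in> space \<nu> \<Longrightarrow> (\<lambda>i. s i x) \<longlonglongrightarrow> \<phi> x"
    using borel_measurable_implies_sequence_metric[OF \<phi>, of 0] by metis
  \<comment> \<open>The approximating simple functions may exceed norm \<open>1\<close>; radial projection to the unit disc
    restores the bound and keeps the convergence.\<close>
  define t where "t i x = s i x / of_real (max 1 (norm (s i x)))" for i x
  have t_simple: "simple_function \<nu> (t i)" for i
    unfolding t_def using s(1)[of i]
    by (rule simple_function_compose1[where g="\<lambda>z. z / of_real (max 1 (norm z))"])
  have t1: "norm (t i x) \<le> 1" for i x
    unfolding t_def by (auto simp: norm_divide divide_le_eq_1 max_def)
  have t_lim: "(\<lambda>i. t i x) \<longlonglongrightarrow> \<phi> x" if "x \<in> X" for x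
  proof -
    have "(\<lambda>i. t i x) \<longlonglongrightarrow> \<phi> x / of_real (max 1 (norm (\<phi> x)))"
      unfolding t_def using that
      by (intro tendsto_intros s(2)) (auto simp: space_\<nu>)
    then show ?thesis using bd[OF that] by (simp add: max_absorb1)
  qed
  have "\<exists>F. F \<in> borel_measurable \<theta> \<and>
    (\<forall>\<xi>. regular \<xi> \<longrightarrow> emeasure \<xi> B < \<infinity> \<longrightarrow> F \<xi> = (\<Prod>x\<in>atoms \<xi> \<inter> B. t i x)) \<and>
    (\<integral>\<xi>. F \<xi> \<partial>\<theta>) = exp (\<integral>x. indicator B x *\<^sub>R (t i x - 1) \<partial>\<nu>)" for i
    by (rule product_functional_simple[OF B t_simple t1])
  then have "\<exists>F. \<forall>i. F i \<in> borel_measurable \<theta> \<and>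
    (\<forall>\<xi>. regular \<xi> \<longrightarrow> emeasure \<xi> B < \<infinity> \<longrightarrow> F i \<xi> = (\<Prod>x\<in>atoms \<xi> \<inter> B. t i x)) \<and>
    (\<integral>\<xi>. F i \<xi> \<partial>\<theta>) = exp (\<integral>x. indicator B x *\<^sub>R (t i x - 1) \<partial>\<nu>)"
    by (intro choice allI)
  then obtain G where G[measurable]: "\<And>i. G i \<in> borel_measurable \<theta>"
    and G_eq: "\<And>i \<xi>. regular \<xi> \<Longrightarrow> emeasure \<xi> B < \<infinity> \<Longrightarrow> G i \<xi> = (\<Prod>x\<in>atoms \<xi> \<inter> B. t i x)"
    and G_int: "\<And>i. (\<integral>\<xi>. G i \<xi> \<partial>\<theta>) = exp (\<integral>x. indicator B x *\<^sub>R (t i x - 1) \<partial>\<nu>)"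
    by blast
  define F where "F \<xi> = lim (\<lambda>i. G i \<xi>)" for \<xi>
  have F[measurable]: "F \<in> borel_measurable \<theta>" unfolding F_def by measurable
  have good: "AE \<xi> in \<theta>. regular \<xi> \<and> emeasure \<xi> B < \<infinity>"
    using AE_regular AE_finite[OF B] by auto
  have G_lim: "(\<lambda>i. G i \<xi>) \<longlonglongrightarrow> (\<Prod>x\<in>atoms \<xi> \<inter> B. \<phi> x)" if "regular \<xi>" "emeasure \<xi> B < \<infinity>" for \<xi>
    unfolding G_eq[OF that] using that
    by (intro tendsto_prod t_lim) (auto simp: regular_def dest: counting_measure_atoms(2))
  then have F_eq: "F \<xi> = (\<Prod>x\<in>atoms \<xi> \<inter> B. \<phi> x)" if "regular \<xi>" "emeasure \<xi> B < \<infinity>" for \<xi>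
    unfolding F_def using that by (intro limI) auto
  have 1: "(\<lambda>i. \<integral>\<xi>. G i \<xi> \<partial>\<theta>) \<longlonglongrightarrow> (\<integral>\<xi>. F \<xi> \<partial>\<theta>)"
  proof (rule integral_dominated_convergence[where w="\<lambda>_. 1"])
    show "AE \<xi> in \<theta>. (\<lambda>i. G i \<xi>) \<longlonglongrightarrow> F \<xi>"
      using good by eventually_elim (use G_lim F_eq in auto)
    show "AE \<xi> in \<theta>. norm (G i \<xi>) \<le> 1" for i
      using good
    proof eventually_elim
      case (elim \<xi>)
      then show ?case
        unfolding G_eq[OF conjunct1[OF elim] conjunct2[OF elim]] prod_norm[symmetric]
        by (intro prod_le_1) (auto intro: t1)
    qed
  qed auto
  have 2: "(\<lambda>i. exp (\<integral>x. indicator B x *\<^sub>R (t i x - 1) \<partial>\<nu>)) \<longlonglongrightarrow> exp (\<integral>x. indicator B x *\<^sub>R (\<phi> x - 1) \<partial>\<nu>)"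
  proof (intro tendsto_exp integral_dominated_convergence[where w="\<lambda>x. indicator B x * 2"])
    show "integrable \<nu> (\<lambda>x. indicator B x * 2 :: real)"
      using B by (intro integrable_mult_left integrable_real_indicator) auto
    show "AE x in \<nu>. (\<lambda>i. indicator B x *\<^sub>R (t i x - 1)) \<longlonglongrightarrow> indicator B x *\<^sub>R (\<phi> x - 1)"
      by (intro AE_I2 tendsto_intros t_lim) (simp add: space_\<nu>)
    have [measurable]: "t i \<in> borel_measurable \<nu>" for i
      by (rule borel_measurable_simple_function[OF t_simple])
    show "(\<lambda>x. indicator B x *\<^sub>R (t i x - 1)) \<in> borel_measurable \<nu>" for i by measurable
    show "AE x in \<nu>. norm (indicator B x *\<^sub>R (t i x - 1)) \<le> indicator B x * 2" for i
    proof (rule AE_I2)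
      fix x
      have "norm (t i x - 1) \<le> 2" using norm_triangle_ineq4[of "t i x" 1] t1[of i x] by simp
      then show "norm (indicator B x *\<^sub>R (t i x - 1)) \<le> indicator B x * 2" by (simp add: indicator_def)
    qed
  qed measurable
  show ?thesis
  proof (intro exI conjI, rule F)
    show "AE \<xi> in \<theta>. F \<xi> = (\<Prod>x\<in>atoms \<xi> \<inter> B. \<phi> x)" using good by eventually_elim (use F_eq in auto)
    show "(\<integral>\<xi>. F \<xi> \<partial>\<theta>) = exp (\<integral>x. indicator B x *\<^sub>R (\<phi> x - 1) \<partial>\<nu>)"
      using LIMSEQ_unique[OF 1] 2 unfolding G_int by blast
  qed
qed

text \<open>Over all of \<open>X\<close> the infinite product is only known to converge through a limit along windows, and the
  limit \<open>V\<close> comes without measurability in \<open>\<xi>\<close>; the version \<open>V'\<close> inherits it from the finite products.\<close>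

lemma product_functional_limit:
  fixes \<phi> :: "'x \<Rightarrow> complex" and V :: "'x measure \<Rightarrow> complex"
  assumes \<phi>[measurable]: "\<phi> \<in> borel_measurable \<nu>" and bd: "\<And>x. x \<in> X \<Longrightarrow> norm (\<phi> x) \<le> 1"
    and lim: "AE \<xi> in \<theta>. (\<lambda>n. \<Prod>x\<in>atoms \<xi> \<inter> window n. \<phi> x) \<longlonglongrightarrow> V \<xi>"
  shows "\<exists>V'. V' \<in> borel_measurable \<theta> \<and> (AE \<xi> in \<theta>. V' \<xi> = V \<xi>) \<and>
    (\<lambda>n. exp (\<integral>x. indicator (window n) x *\<^sub>R (\<phi> x - 1) \<partial>\<nu>)) \<longlonglongrightarrow> (\<integral>\<xi>. V' \<xi> \<partial>\<theta>)"
proof -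
  have "\<exists>F. F \<in> borel_measurable \<theta> \<and> (AE \<xi> in \<theta>. F \<xi> = (\<Prod>x\<in>atoms \<xi> \<inter> window n. \<phi> x)) \<and>
    (\<integral>\<xi>. F \<xi> \<partial>\<theta>) = exp (\<integral>x. indicator (window n) x *\<^sub>R (\<phi> x - 1) \<partial>\<nu>)" for n
    by (rule product_functional[OF window_sets window_finite \<phi> bd])
  then have "\<exists>F. \<forall>n. F n \<in> borel_measurable \<theta> \<and> (AE \<xi> in \<theta>. F n \<xi> = (\<Prod>x\<in>atoms \<xi> \<inter> window n. \<phi> x)) \<and>
    (\<integral>\<xi>. F n \<xi> \<partial>\<theta>) = exp (\<integral>x. indicator (window n) x *\<^sub>R (\<phi> x - 1) \<partial>\<nu>)"
    by (intro choice allI)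
  then obtain F where F[measurable]: "\<And>n. F n \<in> borel_measurable \<theta>"
    and F_eq: "\<And>n. AE \<xi> in \<theta>. F n \<xi> = (\<Prod>x\<in>atoms \<xi> \<inter> window n. \<phi> x)"
    and F_int: "\<And>n. (\<integral>\<xi>. F n \<xi> \<partial>\<theta>) = exp (\<integral>x. indicator (window n) x *\<^sub>R (\<phi> x - 1) \<partial>\<nu>)"
    by blast
  have F_all: "AE \<xi> in \<theta>. \<forall>n. F n \<xi> = (\<Prod>x\<in>atoms \<xi> \<inter> window n. \<phi> x)"
    using F_eq by (simp add: AE_all_countable)
  have F_lim: "AE \<xi> in \<theta>. (\<lambda>n. F n \<xi>) \<longlonglongrightarrow> V \<xi>"
    using F_all lim by eventually_elim simp
  let ?V = "\<lambda>\<xi>. lim (\<lambda>n. F n \<xi>)"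
  have V_eq: "AE \<xi> in \<theta>. ?V \<xi> = V \<xi>"
    using F_lim by eventually_elim (rule limI)
  have V_meas: "?V \<in> borel_measurable \<theta>" by measurable
  have "(\<lambda>n. \<integral>\<xi>. F n \<xi> \<partial>\<theta>) \<longlonglongrightarrow> (\<integral>\<xi>. ?V \<xi> \<partial>\<theta>)"
  proof (rule integral_dominated_convergence[where w="\<lambda>_. 1"])
    show "AE \<xi> in \<theta>. (\<lambda>n. F n \<xi>) \<longlonglongrightarrow> ?V \<xi>"
      using F_lim V_eq by eventually_elim simp
    show "AE \<xi> in \<theta>. norm (F n \<xi>) \<le> 1" for n
      using F_eq[of n] AE_regular
    proof eventually_elim
      case (elim \<xi>)
      then have "atoms \<xi> \<subseteq> X" by (auto simp: regular_def dest: counting_measure_atoms(2))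
      then show ?case
        unfolding elim(1) prod_norm[symmetric] by (intro prod_le_1) (auto intro: bd)
    qed
  qed (auto intro: V_meas)
  then show ?thesis using V_meas V_eq unfolding F_int by blast
qed

end

section \<open>Independence of time integrals\<close>

lemma space_sigma_finite_algebra:
  "space (sigma_finite_algebra Y) = {m. sets m = sets Y \<and> sigma_finite_measure m}"
  by (simp add: sigma_finite_algebra_def space_evaluation_algebra)

lemma nn_integral_measurable_sigma_finite_algebra[measurable]:
  assumes f: "f \<in> borel_measurable Y"
  shows "(\<lambda>m. integral\<^sup>N m f) \<in> borel_measurable (sigma_finite_algebra Y)" (is "_ \<in> ?B")
  using f
proof induct
  case (cong f g)
  moreover have "(\<lambda>m. \<integral>\<^sup>+y. f y \<partial>m) \<in> ?B \<longleftrightarrow> (\<lambda>m. \<integral>\<^sup>+y. g y \<partial>m) \<in> ?B"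
    by (intro measurable_cong nn_integral_cong cong)
       (auto simp: space_sigma_finite_algebra dest!: sets_eq_imp_space_eq)
  ultimately show ?case by simp
next
  case (set B)
  then have "(\<lambda>m. \<integral>\<^sup>+y. indicator B y \<partial>m) \<in> ?B \<longleftrightarrow> (\<lambda>m. emeasure m B) \<in> ?B"
    by (intro measurable_cong nn_integral_indicator) (simp add: space_sigma_finite_algebra)
  with set show ?case
    by (simp add: sigma_finite_algebra_def measurable_emeasure_evaluation_algebra)
next
  case (mult f c)
  then have "(\<lambda>m. \<integral>\<^sup>+y. c * f y \<partial>m) \<in> ?B \<longleftrightarrow> (\<lambda>m. c * \<integral>\<^sup>+y. f y \<partial>m) \<in> ?B"
    by (intro measurable_cong nn_integral_cmult) (auto simp add: space_sigma_finite_algebra)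
  with mult show ?case by simp
next
  case (add f g)
  then have "(\<lambda>m. \<integral>\<^sup>+y. f y + g y \<partial>m) \<in> ?B \<longleftrightarrow> (\<lambda>m. (\<integral>\<^sup>+y. f y \<partial>m) + (\<integral>\<^sup>+y. g y \<partial>m)) \<in> ?B"
    by (intro measurable_cong nn_integral_add) (auto simp add: space_sigma_finite_algebra)
  with add show ?case by (simp add: ac_simps)
next
  case (seq F)
  then have "(\<lambda>m. \<integral>\<^sup>+y. (SUP i. F i) y \<partial>m) \<in> ?B \<longleftrightarrow> (\<lambda>m. SUP i. (\<integral>\<^sup>+y. F i y \<partial>m)) \<in> ?B"
    unfolding SUP_apply
    by (intro measurable_cong nn_integral_monotone_convergence_SUP) (auto simp add: space_sigma_finite_algebra)
  with seq show ?case by (simp add: ac_simps)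
qed

lemma integral_measurable_sigma_finite_algebra[measurable]:
  fixes f :: "'y \<Rightarrow> real"
  assumes f[measurable]: "f \<in> borel_measurable Y"
  shows "(\<lambda>m. integral\<^sup>L m f) \<in> borel_measurable (sigma_finite_algebra Y)"
proof -
  let ?g = "\<lambda>m. if (\<integral>\<^sup>+y. ennreal \<bar>f y\<bar> \<partial>m) < \<infinity>
      then enn2real (\<integral>\<^sup>+y. ennreal (f y) \<partial>m) - enn2real (\<integral>\<^sup>+y. ennreal (- f y) \<partial>m) else 0"
  have "?g \<in> borel_measurable (sigma_finite_algebra Y)" by measurable
  moreover have "integral\<^sup>L m f = ?g m" if "m \<in> space (sigma_finite_algebra Y)" for m
  proof -
    have "f \<in> borel_measurable m"
      using that f by (simp add: space_sigma_finite_algebra cong: measurable_cong_sets)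
    then have "integrable m f \<longleftrightarrow> (\<integral>\<^sup>+y. ennreal \<bar>f y\<bar> \<partial>m) < \<infinity>"
      by (simp add: integrable_iff_bounded)
    then show ?thesis
      by (auto simp: real_lebesgue_integral_def not_integrable_integral_eq)
  qed
  ultimately show ?thesis by (simp cong: measurable_cong)
qed

text \<open>The conditional expectation \<open>e\<close> of \<open>a = \<integral> V\<^sub>t dt\<close> given \<open>G\<close> equals \<open>a\<close>: as \<open>V\<^sub>t\<close> is \<open>G\<close>-measurable,
  \<open>E (V\<^sub>t a) = E (V\<^sub>t e)\<close> for each \<open>t\<close>, and integration over \<open>t\<close> yields \<open>E (a\<^sup>2) = E (a e) = E (e\<^sup>2)\<close>.\<close>

lemma (in prob_space) time_integral_version_bounded:
  fixes T :: "'t measure" and V :: "'t \<Rightarrow> 'a \<Rightarrow> real"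
  assumes T: "finite_measure T" and G: "subalgebra M G"
    and V[measurable]: "(\<lambda>(t, \<omega>). V t \<omega>) \<in> borel_measurable (T \<Otimes>\<^sub>M M)"
    and VG: "\<And>t. t \<in> space T \<Longrightarrow> V t \<in> borel_measurable G" and bd: "\<And>t \<omega>. \<bar>V t \<omega>\<bar> \<le> K"
  shows "\<exists>a'\<in>borel_measurable G. AE \<omega> in M. (\<integral>t. V t \<omega> \<partial>T) = a' \<omega>"
proof -
  interpret T: finite_measure T by fact
  interpret P: pair_sigma_finite T M ..
  interpret S: finite_measure_subalgebra M G by unfold_locales (rule G)
  define a where "a \<omega> = (\<integral>t. V t \<omega> \<partial>T)" for \<omega>
  define e where "e = real_cond_exp M G a"
  have [measurable]: "a \<in> borel_measurable M" unfolding a_def by measurable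
  have a_bd: "\<bar>a \<omega>\<bar> \<le> K * measure T (space T)" for \<omega>
  proof -
    have "0 \<le> K" using order_trans[OF abs_ge_zero bd] .
    then have "norm (a \<omega>) \<le> (\<integral>t. K \<partial>T)"
      unfolding a_def by (intro order_trans[OF integral_norm_bound] integral_mono') (auto simp: bd)
    then show ?thesis by (simp add: mult.commute)
  qed
  have a_int: "integrable M a" by (rule integrable_const_bound[OF AE_I2]) (use a_bd in auto)
  have e_int: "integrable M e" unfolding e_def using a_int by (rule S.real_cond_exp_int)
  have mult: "integrable M (\<lambda>\<omega>. h \<omega> * a \<omega>)" if "integrable M h" for h
  proof (rule Bochner_Integration.integrable_bound)
    show "integrable M (\<lambda>\<omega>. h \<omega> * (K * measure T (space T)))" using that by simp
    show "AE \<omega> in M. norm (h \<omega> * a \<omega>) \<le> norm (h \<omega> * (K * measure T (space T)))"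
    proof (rule AE_I2)
      fix \<omega>
      have "\<bar>a \<omega>\<bar> \<le> \<bar>K * measure T (space T)\<bar>" using a_bd[of \<omega>] by linarith
      then show "norm (h \<omega> * a \<omega>) \<le> norm (h \<omega> * (K * measure T (space T)))"
        unfolding real_norm_def abs_mult[of "h \<omega>"] by (rule mult_left_mono) simp
    qed
  qed (use that in measurable)
  have ee: "integrable M (\<lambda>\<omega>. e \<omega> * e \<omega>)" "(\<integral>\<omega>. e \<omega> * e \<omega> \<partial>M) = (\<integral>\<omega>. e \<omega> * a \<omega> \<partial>M)"
    using S.real_cond_exp_intg[OF mult[OF e_int]] unfolding e_def by auto
  have fub: "(\<integral>t. (\<integral>\<omega>. V t \<omega> * h \<omega> \<partial>M) \<partial>T) = (\<integral>\<omega>. a \<omega> * h \<omega> \<partial>M)" if h: "integrable M h" for h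
  proof -
    have [measurable]: "h \<in> borel_measurable M" using h by auto
    have i: "integrable (T \<Otimes>\<^sub>M M) (\<lambda>(t, \<omega>). V t \<omega> * h \<omega>)"
    proof (rule Bochner_Integration.integrable_bound)
      show "integrable (T \<Otimes>\<^sub>M M) (\<lambda>(t, \<omega>). K * h \<omega>)"
        by (rule P.Fubini_integrable) (use h in \<open>auto simp: abs_mult\<close>)
      have "\<bar>V t \<omega>\<bar> \<le> \<bar>K\<bar>" for t \<omega> using bd[of t \<omega>] by linarith
      then show "AE z in T \<Otimes>\<^sub>M M. norm (case z of (t, \<omega>) \<Rightarrow> V t \<omega> * h \<omega>) \<le> norm (case z of (t, \<omega>) \<Rightarrow> K * h \<omega>)"
        by (intro AE_I2) (auto simp: abs_mult split: prod.split intro!: mult_right_mono)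
    qed measurable
    have "(\<integral>t. (\<integral>\<omega>. V t \<omega> * h \<omega> \<partial>M) \<partial>T) = (\<integral>\<omega>. (\<integral>t. V t \<omega> * h \<omega> \<partial>T) \<partial>M)"
      by (rule P.Fubini_integral[OF i, symmetric])
    then show ?thesis by (simp add: a_def)
  qed
  have "(\<integral>\<omega>. a \<omega> * a \<omega> \<partial>M) = (\<integral>t. (\<integral>\<omega>. V t \<omega> * a \<omega> \<partial>M) \<partial>T)"
    by (rule fub[OF a_int, symmetric])
  also have "\<dots> = (\<integral>t. (\<integral>\<omega>. V t \<omega> * e \<omega> \<partial>M) \<partial>T)"
  proof (rule Bochner_Integration.integral_cong[OF refl])
    fix t assume t: "t \<in> space T"
    have [measurable]: "V t \<in> borel_measurable M" using measurable_compose[OF measurable_Pair1'[OF t] V] by simp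
    have "integrable M (V t)" by (rule integrable_const_bound[OF AE_I2]) (use bd in auto)
    from S.real_cond_exp_intg(2)[OF mult[OF this] VG[OF t]]
    show "(\<integral>\<omega>. V t \<omega> * a \<omega> \<partial>M) = (\<integral>\<omega>. V t \<omega> * e \<omega> \<partial>M)"
      unfolding e_def by simp
  qed
  also have "\<dots> = (\<integral>\<omega>. a \<omega> * e \<omega> \<partial>M)" by (rule fub[OF e_int])
  finally have aa: "(\<integral>\<omega>. a \<omega> * a \<omega> \<partial>M) = (\<integral>\<omega>. e \<omega> * a \<omega> \<partial>M)" by (simp add: mult.commute)
  have exp: "(\<lambda>\<omega>. (a \<omega> - e \<omega>)\<^sup>2) = (\<lambda>\<omega>. a \<omega> * a \<omega> - 2 * (e \<omega> * a \<omega>) + e \<omega> * e \<omega>)"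
    by (auto simp: power2_eq_square algebra_simps)
  have int: "integrable M (\<lambda>\<omega>. (a \<omega> - e \<omega>)\<^sup>2)"
    unfolding exp using mult[OF a_int] mult[OF e_int] ee(1) by auto
  have "(\<integral>\<omega>. (a \<omega> - e \<omega>)\<^sup>2 \<partial>M) = 0"
    unfolding exp using mult[OF a_int] mult[OF e_int] ee aa by simp
  then have "AE \<omega> in M. (a \<omega> - e \<omega>)\<^sup>2 = 0"
    using integral_nonneg_eq_0_iff_AE[OF int] by simp
  then have "AE \<omega> in M. (\<integral>t. V t \<omega> \<partial>T) = e \<omega>" unfolding a_def by eventually_elim simp
  moreover have "e \<in> borel_measurable G" unfolding e_def by (rule borel_measurable_cond_exp)
  ultimately show ?thesis by blast
qed

text \<open>Truncation of \<open>V\<close> at height \<open>n\<close> reduces the claim to the bounded case.\<close>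

lemma (in prob_space) time_integral_version:
  fixes T :: "'t measure" and V :: "'t \<Rightarrow> 'a \<Rightarrow> real"
  assumes T: "finite_measure T" and G: "subalgebra M G"
    and V[measurable]: "(\<lambda>(t, \<omega>). V t \<omega>) \<in> borel_measurable (T \<Otimes>\<^sub>M M)"
    and VG: "\<And>t. t \<in> space T \<Longrightarrow> V t \<in> borel_measurable G"
    and int: "AE \<omega> in M. integrable T (\<lambda>t. V t \<omega>)"
  shows "\<exists>a'\<in>borel_measurable G. AE \<omega> in M. (\<integral>t. V t \<omega> \<partial>T) = a' \<omega>"
proof -
  define c where "c n x = max (- real n) (min (real n) x)" for n x
  have [measurable]: "c n \<in> borel_measurable borel" for n unfolding c_def by measurable
  have "\<exists>a'\<in>borel_measurable G. AE \<omega> in M. (\<integral>t. c n (V t \<omega>) \<partial>T) = a' \<omega>" for n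
  proof (rule time_integral_version_bounded[OF T G, where K="real n"])
    show "(\<lambda>\<omega>. c n (V t \<omega>)) \<in> borel_measurable G" if "t \<in> space T" for t
      using VG[OF that] by measurable
    show "\<bar>c n (V t \<omega>)\<bar> \<le> real n" for t \<omega> unfolding c_def by auto
  qed measurable
  then have "\<forall>n. \<exists>a'. a' \<in> borel_measurable G \<and> (AE \<omega> in M. (\<integral>t. c n (V t \<omega>) \<partial>T) = a' \<omega>)" by blast
  from choice[OF this] obtain b where b[measurable]: "\<And>n. b n \<in> borel_measurable G"
    and b_eq: "\<And>n. AE \<omega> in M. (\<integral>t. c n (V t \<omega>) \<partial>T) = b n \<omega>" by auto
  have "AE \<omega> in M. \<forall>n. (\<integral>t. c n (V t \<omega>) \<partial>T) = b n \<omega>"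
    using b_eq by (simp add: AE_all_countable)
  then have "AE \<omega> in M. (\<integral>t. V t \<omega> \<partial>T) = lim (\<lambda>n. b n \<omega>)"
    using int
  proof eventually_elim
    case (elim \<omega>)
    have "(\<lambda>n. \<integral>t. c n (V t \<omega>) \<partial>T) \<longlonglongrightarrow> (\<integral>t. V t \<omega> \<partial>T)"
    proof (rule integral_dominated_convergence[where w="\<lambda>t. \<bar>V t \<omega>\<bar>"])
      have [measurable]: "(\<lambda>t. V t \<omega>) \<in> borel_measurable T" using elim(2) by auto
      show "(\<lambda>t. V t \<omega>) \<in> borel_measurable T" "(\<lambda>t. c n (V t \<omega>)) \<in> borel_measurable T" for n
        by measurable
      show "integrable T (\<lambda>t. \<bar>V t \<omega>\<bar>)" using elim(2) by simp
      show "AE t in T. norm (c n (V t \<omega>)) \<le> \<bar>V t \<omega>\<bar>" for n unfolding c_def by auto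
      show "AE t in T. (\<lambda>n. c n (V t \<omega>)) \<longlonglongrightarrow> V t \<omega>"
      proof (rule AE_I2)
        fix t
        obtain N :: nat where N: "\<bar>V t \<omega>\<bar> \<le> real N" using real_arch_simple by blast
        have "c n (V t \<omega>) = V t \<omega>" if "N \<le> n" for n
          using N that unfolding c_def by (auto simp: max_def min_def)
        then show "(\<lambda>n. c n (V t \<omega>)) \<longlonglongrightarrow> V t \<omega>"
          by (intro tendsto_eventually) (auto simp: eventually_sequentially)
      qed
    qed
    then show ?case unfolding elim(1)[rule_format] by (intro limI[symmetric])
  qed
  moreover have "(\<lambda>\<omega>. lim (\<lambda>n. b n \<omega>)) \<in> borel_measurable G" by measurable
  ultimately show ?thesis by (rule bexI)
qed

locale measure_dynamics = prob_space Q for Q :: "'w measure" +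
  fixes Y :: "'y measure" and X :: "'x set" and \<mu> :: "'x \<Rightarrow> real \<Rightarrow> 'w \<Rightarrow> 'y measure"
    and r :: real and \<psi> :: "'y \<Rightarrow> real"
  assumes dynamics: "independent_measure_processes Q Y X \<mu>"
    and \<psi>[measurable]: "\<psi> \<in> borel_measurable Y"
begin

abbreviation T :: "real measure" where "T \<equiv> restrict_space lborel {0..r}"

abbreviation V :: "'x \<Rightarrow> real \<Rightarrow> 'w \<Rightarrow> real" where "V x t \<omega> \<equiv> (\<integral>y. \<psi> y \<partial>\<mu> x t \<omega>)"

abbreviation U :: "'x \<Rightarrow> real \<Rightarrow> 'w \<Rightarrow> real" where "U x t \<omega> \<equiv> (\<integral>y. \<bar>\<psi> y\<bar> \<partial>\<mu> x t \<omega>)"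

definition contribution :: "'x \<Rightarrow> 'w \<Rightarrow> real" where
  "contribution x \<omega> = time_integral r \<psi> (\<lambda>t. \<mu> x t \<omega>)"

lemma time_integral_T: "time_integral r \<psi> m = (\<integral>t. (\<integral>y. \<psi> y \<partial>m t) \<partial>T)"
  unfolding time_integral_def set_lebesgue_integral_def by (simp add: integral_restrict_space)

lemma time_integrable_T: "time_integrable r \<psi> m \<longleftrightarrow>
  (AE t in T. integrable (m t) \<psi>) \<and> integrable T (\<lambda>t. \<integral>y. \<bar>\<psi> y\<bar> \<partial>m t)"
  unfolding time_integrable_def set_integrable_def
  by (simp add: AE_restrict_space_iff integrable_restrict_space)

lemma space_T: "space T = {0..r}" by (simp add: space_restrict_space)

lemma finite_T: "finite_measure T"
proof (rule finite_measureI)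
  have "emeasure T (space T) = emeasure lborel {0..r}"
    unfolding space_T by (rule emeasure_restrict_space) auto
  also have "\<dots> < \<infinity>" by (simp add: emeasure_lborel_Icc_eq)
  finally show "emeasure T (space T) \<noteq> \<infinity>" by simp
qed

lemma process_measurable:
  "x \<in> X \<Longrightarrow> (\<lambda>(t, \<omega>). \<mu> x t \<omega>) \<in> restrict_space borel {0..} \<Otimes>\<^sub>M Q \<rightarrow>\<^sub>M sigma_finite_algebra Y"
  using dynamics by (simp add: independent_measure_processes_def)

lemma process_space: "x \<in> X \<Longrightarrow> 0 \<le> t \<Longrightarrow> \<omega> \<in> space Q \<Longrightarrow> \<mu> x t \<omega> \<in> space (sigma_finite_algebra Y)"
  using measurable_space[OF process_measurable, of x "(t, \<omega>)"]
  by (simp add: space_pair_measure space_restrict_space)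

lemma process_sets: "x \<in> X \<Longrightarrow> 0 \<le> t \<Longrightarrow> \<omega> \<in> space Q \<Longrightarrow> sets (\<mu> x t \<omega>) = sets Y"
  using process_space by (simp add: space_sigma_finite_algebra)

lemma process_integral_measurable:
  assumes x: "x \<in> X" and f: "f \<in> borel_measurable Y"
  shows "(\<lambda>(t, \<omega>). \<integral>y. f y \<partial>\<mu> x t \<omega> :: real) \<in> borel_measurable (T \<Otimes>\<^sub>M Q)"
proof -
  have "(\<lambda>t. t) \<in> T \<rightarrow>\<^sub>M restrict_space borel {0..}"
    by (intro measurable_restrict_space2 measurable_restrict_space1) (auto simp: space_T)
  then have "(\<lambda>z. (fst z, snd z)) \<in> T \<Otimes>\<^sub>M Q \<rightarrow>\<^sub>M restrict_space borel {0..} \<Otimes>\<^sub>M Q"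
    by (intro measurable_Pair measurable_compose[OF measurable_fst] measurable_snd)
  from measurable_compose[OF measurable_compose[OF this process_measurable[OF x]]
      integral_measurable_sigma_finite_algebra[OF f]]
  show ?thesis by (simp add: case_prod_unfold)
qed

lemma contribution_eq: "contribution x \<omega> = (\<integral>t. V x t \<omega> \<partial>T)"
  unfolding contribution_def time_integral_T ..

lemma contribution_measurable: "x \<in> X \<Longrightarrow> contribution x \<in> borel_measurable Q"
proof -
  assume x: "x \<in> X"
  interpret finite_measure T by (rule finite_T)
  have "(\<lambda>(\<omega>, t). V x t \<omega>) \<in> borel_measurable (Q \<Otimes>\<^sub>M T)"
    using measurable_pair_swap[OF process_integral_measurable[OF x \<psi>]] by (simp add: case_prod_unfold)
  then show ?thesis
    unfolding contribution_eq [abs_def] by (rule borel_measurable_lebesgue_integral)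
qed

abbreviation path_space :: "(real \<Rightarrow> 'y measure) measure" where
  "path_space \<equiv> PiM {0..} (\<lambda>_. sigma_finite_algebra Y)"

abbreviation path :: "'x \<Rightarrow> 'w \<Rightarrow> real \<Rightarrow> 'y measure" where
  "path x \<equiv> (\<lambda>\<omega>. \<lambda>t\<in>{0..}. \<mu> x t \<omega>)"

lemma path_measurable: "x \<in> X \<Longrightarrow> path x \<in> Q \<rightarrow>\<^sub>M path_space"
  using dynamics by (auto simp: independent_measure_processes_def indep_vars_def)

lemma sets_path_algebra:
  assumes "x \<in> X"
  shows "sets (vimage_algebra (space Q) (path x) path_space) = {path x -` A \<inter> space Q | A. A \<in> sets path_space}"
proof (rule sets_vimage_algebra2)
  show "path x \<in> space Q \<rightarrow> space path_space"
    using measurable_space[OF path_measurable[OF assms]] by blast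
qed

lemma subalgebra_path:
  assumes "x \<in> X"
  shows "subalgebra Q (vimage_algebra (space Q) (path x) path_space)"
  unfolding subalgebra_def sets_path_algebra[OF assms]
  using measurable_sets[OF path_measurable[OF assms]] by auto

text \<open>Evaluation of paths at single times generates the product \<open>\<sigma>\<close>-algebra of the path space, and the time
  integral is not a function of countably many of them; only a version of it is measurable with
  respect to the path.\<close>

lemma contribution_version:
  assumes x: "x \<in> X" and int: "AE \<omega> in Q. integrable T (\<lambda>t. V x t \<omega>)"
  shows "\<exists>a'\<in>borel_measurable (vimage_algebra (space Q) (path x) path_space).
    AE \<omega> in Q. contribution x \<omega> = a' \<omega>"
  unfolding contribution_eq
proof (rule time_integral_version[OF finite_T _ process_integral_measurable[OF x \<psi>] _ int])
  show "subalgebra Q (vimage_algebra (space Q) (path x) path_space)"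
    by (rule subalgebra_path[OF x])
  fix t assume "t \<in> space T"
  then have t: "t \<in> {0..}" by (simp add: space_T)
  have "path x \<in> vimage_algebra (space Q) (path x) path_space \<rightarrow>\<^sub>M path_space"
    by (rule measurable_vimage_algebra1) (use measurable_space[OF path_measurable[OF x]] in blast)
  from measurable_compose[OF measurable_compose[OF this measurable_component_singleton[OF t]]
      integral_measurable_sigma_finite_algebra[OF \<psi>]]
  have "(\<lambda>\<omega>. \<integral>y. \<psi> y \<partial>(path x \<omega> t)) \<in> borel_measurable (vimage_algebra (space Q) (path x) path_space)" .
  then show "(\<lambda>\<omega>. V x t \<omega>) \<in> borel_measurable (vimage_algebra (space Q) (path x) path_space)"
    using t by simp
qed

text \<open>Versions that are measurable with respect to the paths are independent because the paths are.\<close>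

lemma expectation_prod_contributions:
  fixes g :: "real \<Rightarrow> complex"
  assumes F: "finite F" "F \<subseteq> X" and int: "\<And>x. x \<in> F \<Longrightarrow> AE \<omega> in Q. integrable T (\<lambda>t. V x t \<omega>)"
    and g[measurable]: "g \<in> borel_measurable borel" and bd: "\<And>z. norm (g z) \<le> 1"
  shows "(\<integral>\<omega>. (\<Prod>x\<in>F. g (contribution x \<omega>)) \<partial>Q) = (\<Prod>x\<in>F. \<integral>\<omega>. g (contribution x \<omega>) \<partial>Q)"
proof -
  let ?G = "\<lambda>x. vimage_algebra (space Q) (path x) path_space"
  have "\<forall>x\<in>F. \<exists>a'. a' \<in> borel_measurable (?G x) \<and> (AE \<omega> in Q. contribution x \<omega> = a' \<omega>)"
    using contribution_version F(2) int unfolding Bex_def by (meson subsetD)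
  from bchoice[OF this] obtain b where b: "\<And>x. x \<in> F \<Longrightarrow> b x \<in> borel_measurable (?G x)"
    and b_eq: "\<And>x. x \<in> F \<Longrightarrow> AE \<omega> in Q. contribution x \<omega> = b x \<omega>" by auto
  have ind: "indep_vars (\<lambda>_. path_space) path X"
    using dynamics by (auto simp: independent_measure_processes_def)
  have b_meas: "b x \<in> borel_measurable Q" if "x \<in> F" for x
    using measurable_from_subalg[OF subalgebra_path b[OF that]] that F(2) by blast
  have "indep_vars (\<lambda>_. borel) b F"
    unfolding indep_vars_def2
  proof (intro conjI ballI)
    show "indep_sets (\<lambda>x. {b x -` A \<inter> space Q |A. A \<in> sets borel}) F"
    proof (rule indep_sets_mono)
      show "indep_sets (\<lambda>x. {path x -` A \<inter> space Q |A. A \<in> sets path_space}) X"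
        using ind unfolding indep_vars_def2 by simp
      show "{b x -` A \<inter> space Q |A. A \<in> sets borel} \<subseteq> {path x -` A \<inter> space Q |A. A \<in> sets path_space}"
        if "x \<in> F" for x
        unfolding sets_path_algebra[symmetric, OF subsetD[OF F(2) that]]
        using measurable_sets[OF b[OF that]] by auto
    qed (rule F(2))
  qed (rule b_meas)
  then have ind_g: "indep_vars (\<lambda>_. borel) (\<lambda>x \<omega>. g (b x \<omega>)) F"
    by (rule indep_vars_compose2) measurable
  have "(\<integral>\<omega>. (\<Prod>x\<in>F. g (contribution x \<omega>)) \<partial>Q) = (\<integral>\<omega>. (\<Prod>x\<in>F. g (b x \<omega>)) \<partial>Q)"
  proof (rule integral_cong_AE)
    have "AE \<omega> in Q. \<forall>x\<in>F. contribution x \<omega> = b x \<omega>"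
      using F(1) b_eq by (intro AE_finite_allI)
    then show "AE \<omega> in Q. (\<Prod>x\<in>F. g (contribution x \<omega>)) = (\<Prod>x\<in>F. g (b x \<omega>))"
      by eventually_elim simp
    show "(\<lambda>\<omega>. \<Prod>x\<in>F. g (contribution x \<omega>)) \<in> borel_measurable Q"
      using contribution_measurable F(2)
      by (intro borel_measurable_prod measurable_compose[OF _ g]) auto
    show "(\<lambda>\<omega>. \<Prod>x\<in>F. g (b x \<omega>)) \<in> borel_measurable Q"
      by (intro borel_measurable_prod measurable_compose[OF _ g] b_meas)
  qed
  also have "\<dots> = (\<Prod>x\<in>F. \<integral>\<omega>. g (b x \<omega>) \<partial>Q)"
  proof (rule indep_vars_lebesgue_integral[OF F(1) ind_g])
    show "integrable Q (\<lambda>\<omega>. g (b x \<omega>))" if "x \<in> F" for x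
      by (rule integrable_const_bound[OF AE_I2, where B=1])
        (use bd measurable_compose[OF b_meas[OF that] g] in auto)
  qed
  also have "\<dots> = (\<Prod>x\<in>F. \<integral>\<omega>. g (contribution x \<omega>) \<partial>Q)"
  proof (intro prod.cong refl integral_cong_AE)
    fix x assume x: "x \<in> F"
    show "AE \<omega> in Q. g (b x \<omega>) = g (contribution x \<omega>)" using b_eq[OF x] by eventually_elim simp
    show "(\<lambda>\<omega>. g (b x \<omega>)) \<in> borel_measurable Q" using b_meas[OF x] by measurable
    show "(\<lambda>\<omega>. g (contribution x \<omega>)) \<in> borel_measurable Q"
      using contribution_measurable[of x] x F(2) by (intro measurable_compose[OF _ g]) auto
  qed
  finally show ?thesis .
qed

end

section \<open>Superpositions\<close>

context
  fixes Y :: "'y measure" and \<xi> :: "'x measure" and S :: "'x set" and M :: "'x \<Rightarrow> 'y measure"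
  assumes S: "countable S" and \<xi>: "\<And>g :: 'x \<Rightarrow> ennreal. (\<integral>\<^sup>+x. g x \<partial>\<xi>) = (\<integral>\<^sup>+x. g x \<partial>count_space S)"
    and M: "\<And>x. x \<in> S \<Longrightarrow> sets (M x) = sets Y"
begin

lemma sets_superposition: "sets (superposition Y \<xi> M) = sets Y"
  by (simp add: superposition_def)

lemma emeasure_superposition:
  assumes "B \<in> sets Y"
  shows "emeasure (superposition Y \<xi> M) B = (\<integral>\<^sup>+x. emeasure (M x) B \<partial>count_space S)"
proof (subst emeasure_measure_of[OF superposition_def])
  show "countably_additive (sets (superposition Y \<xi> M)) (\<lambda>B. \<integral>\<^sup>+x. emeasure (M x) B \<partial>\<xi>)"
    unfolding sets_superposition
  proof (rule countably_additiveI)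
    fix B :: "nat \<Rightarrow> 'y set" assume B: "range B \<subseteq> sets Y" "disjoint_family B"
    have "(\<Sum>i. \<integral>\<^sup>+x. emeasure (M x) (B i) \<partial>count_space S) = (\<integral>\<^sup>+x. (\<Sum>i. emeasure (M x) (B i)) \<partial>count_space S)"
      by (rule nn_integral_suminf[symmetric]) simp
    also have "\<dots> = (\<integral>\<^sup>+x. emeasure (M x) (\<Union>i. B i) \<partial>count_space S)"
      using B M by (intro nn_integral_cong suminf_emeasure) auto
    finally show "(\<Sum>i. \<integral>\<^sup>+x. emeasure (M x) (B i) \<partial>\<xi>) = (\<integral>\<^sup>+x. emeasure (M x) (\<Union>i. B i) \<partial>\<xi>)"
      unfolding \<xi> .
  qed
qed (use assms sets.space_closed in \<open>auto simp: positive_def sets_superposition \<xi>\<close>)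

lemma nn_integral_superposition:
  assumes "f \<in> borel_measurable Y"
  shows "(\<integral>\<^sup>+y. f y \<partial>superposition Y \<xi> M) = (\<integral>\<^sup>+x. (\<integral>\<^sup>+y. f y \<partial>M x) \<partial>count_space S)"
  using assms
proof induct
  case (cong f g)
  have "(\<integral>\<^sup>+y. f y \<partial>superposition Y \<xi> M) = (\<integral>\<^sup>+y. g y \<partial>superposition Y \<xi> M)"
    using cong sets_eq_imp_space_eq[OF sets_superposition] by (intro nn_integral_cong) auto
  moreover have "(\<integral>\<^sup>+y. f y \<partial>M x) = (\<integral>\<^sup>+y. g y \<partial>M x)" if "x \<in> S" for x
    using cong sets_eq_imp_space_eq[OF M[OF that]] by (intro nn_integral_cong) auto
  ultimately show ?case using cong by (simp cong: nn_integral_cong_simp)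
next
  case (set B)
  then show ?case
    using M by (simp add: sets_superposition emeasure_superposition cong: nn_integral_cong_simp)
next
  case (mult f c)
  then have "f \<in> borel_measurable (superposition Y \<xi> M)" "\<And>x. x \<in> S \<Longrightarrow> f \<in> borel_measurable (M x)"
    using M sets_superposition by (auto cong: measurable_cong_sets)
  then show ?case
    using mult by (simp add: nn_integral_cmult cong: nn_integral_cong_simp)
next
  case (add f g)
  then have "f \<in> borel_measurable (superposition Y \<xi> M)" "\<And>x. x \<in> S \<Longrightarrow> f \<in> borel_measurable (M x)"
      "g \<in> borel_measurable (superposition Y \<xi> M)" "\<And>x. x \<in> S \<Longrightarrow> g \<in> borel_measurable (M x)"
    using M sets_superposition by (auto cong: measurable_cong_sets)
  then show ?case
    using add by (simp add: nn_integral_add cong: nn_integral_cong_simp)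
next
  case (seq F)
  then have F: "\<And>i. F i \<in> borel_measurable (superposition Y \<xi> M)" "\<And>i x. x \<in> S \<Longrightarrow> F i \<in> borel_measurable (M x)"
    using M sets_superposition by (auto cong: measurable_cong_sets)
  have "(\<integral>\<^sup>+y. (SUP i. F i y) \<partial>superposition Y \<xi> M) = (SUP i. \<integral>\<^sup>+y. F i y \<partial>superposition Y \<xi> M)"
    by (rule nn_integral_monotone_convergence_SUP) (use seq F in auto)
  also have "\<dots> = (SUP i. \<integral>\<^sup>+x. (\<integral>\<^sup>+y. F i y \<partial>M x) \<partial>count_space S)"
    using seq by simp
  also have "\<dots> = (\<integral>\<^sup>+x. (SUP i. \<integral>\<^sup>+y. F i y \<partial>M x) \<partial>count_space S)"
    using \<open>incseq F\<close>
    by (intro nn_integral_monotone_convergence_SUP[symmetric])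
      (auto simp: incseq_def le_fun_def intro!: nn_integral_mono)
  also have "\<dots> = (\<integral>\<^sup>+x. (\<integral>\<^sup>+y. (SUP i. F i y) \<partial>M x) \<partial>count_space S)"
    by (intro nn_integral_cong nn_integral_monotone_convergence_SUP[symmetric]) (use seq F in auto)
  finally show ?case by (simp add: image_comp)
qed

lemma integral_superposition_nonneg:
  fixes f :: "'y \<Rightarrow> real"
  assumes f: "f \<in> borel_measurable Y" "\<And>y. 0 \<le> f y" and int: "integrable (superposition Y \<xi> M) f"
  shows "\<And>x. x \<in> S \<Longrightarrow> integrable (M x) f"
    and "integrable (count_space S) (\<lambda>x. \<integral>y. f y \<partial>M x)"
    and "(\<integral>y. f y \<partial>superposition Y \<xi> M) = (\<integral>x. (\<integral>y. f y \<partial>M x) \<partial>count_space S)"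
proof -
  have fM: "f \<in> borel_measurable (M x)" if "x \<in> S" for x
    using f(1) M[OF that] by (simp cong: measurable_cong_sets)
  have eq: "(\<integral>\<^sup>+y. f y \<partial>superposition Y \<xi> M) = (\<integral>\<^sup>+x. (\<integral>\<^sup>+y. f y \<partial>M x) \<partial>count_space S)"
    using f(1) by (intro nn_integral_superposition) measurable
  have fin: "(\<integral>\<^sup>+y. f y \<partial>superposition Y \<xi> M) < \<infinity>"
    using int f(2) by (simp add: integrable_iff_bounded)
  have fin_x: "(\<integral>\<^sup>+y. f y \<partial>M x) < \<infinity>" if "x \<in> S" for x
    by (rule le_less_trans[OF _ fin]) (unfold eq, rule nn_integral_ge_point[OF that])
  show i: "integrable (M x) f" if "x \<in> S" for x
    using fin_x[OF that] fM[OF that] f(2) by (simp add: integrable_iff_bounded)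
  have eq': "(\<integral>\<^sup>+x. (\<integral>\<^sup>+y. f y \<partial>M x) \<partial>count_space S) = (\<integral>\<^sup>+x. ennreal (\<integral>y. f y \<partial>M x) \<partial>count_space S)"
    using i f(2) by (intro nn_integral_cong) (auto intro!: nn_integral_eq_integral)
  have nn: "0 \<le> (\<integral>y. f y \<partial>M x)" for x using f(2) by simp
  show "integrable (count_space S) (\<lambda>x. \<integral>y. f y \<partial>M x)"
    using fin unfolding eq eq' by (simp add: integrable_iff_bounded nn)
  show "(\<integral>y. f y \<partial>superposition Y \<xi> M) = (\<integral>x. (\<integral>y. f y \<partial>M x) \<partial>count_space S)"
    using int f(2) nn eq eq' by (simp add: integral_eq_nn_integral)
qed

lemma integral_superposition:
  fixes f :: "'y \<Rightarrow> real"
  assumes f[measurable]: "f \<in> borel_measurable Y" and int: "integrable (superposition Y \<xi> M) f"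
  shows "integrable (count_space S) (\<lambda>x. \<integral>y. \<bar>f y\<bar> \<partial>M x)"
    and "(\<integral>y. \<bar>f y\<bar> \<partial>superposition Y \<xi> M) = (\<integral>x. (\<integral>y. \<bar>f y\<bar> \<partial>M x) \<partial>count_space S)"
    and "(\<integral>y. f y \<partial>superposition Y \<xi> M) = (\<integral>x. (\<integral>y. f y \<partial>M x) \<partial>count_space S)"
proof -
  let ?p = "\<lambda>y. max 0 (f y)" and ?n = "\<lambda>y. max 0 (- f y)"
  have pn: "integrable (superposition Y \<xi> M) ?p" "integrable (superposition Y \<xi> M) ?n"
    using int by auto
  have f_eq: "f = (\<lambda>y. ?p y - ?n y)" by auto
  note p = integral_superposition_nonneg[OF _ _ pn(1)] and n = integral_superposition_nonneg[OF _ _ pn(2)]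
  have "(\<integral>y. f y \<partial>superposition Y \<xi> M) = (\<integral>y. ?p y \<partial>superposition Y \<xi> M) - (\<integral>y. ?n y \<partial>superposition Y \<xi> M)"
    using pn by (subst f_eq) (rule Bochner_Integration.integral_diff)
  also have "\<dots> = (\<integral>x. (\<integral>y. ?p y \<partial>M x) - (\<integral>y. ?n y \<partial>M x) \<partial>count_space S)"
    using p(2,3) n(2,3) by simp
  also have "\<dots> = (\<integral>x. (\<integral>y. f y \<partial>M x) \<partial>count_space S)"
    using p(1) n(1) by (intro Bochner_Integration.integral_cong refl)
      (subst (3) f_eq, simp add: Bochner_Integration.integral_diff)
  finally show "(\<integral>y. f y \<partial>superposition Y \<xi> M) = (\<integral>x. (\<integral>y. f y \<partial>M x) \<partial>count_space S)" .
  show "integrable (count_space S) (\<lambda>x. \<integral>y. \<bar>f y\<bar> \<partial>M x)"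
    "(\<integral>y. \<bar>f y\<bar> \<partial>superposition Y \<xi> M) = (\<integral>x. (\<integral>y. \<bar>f y\<bar> \<partial>M x) \<partial>count_space S)"
    by (rule integral_superposition_nonneg(2,3); use int in auto)+
qed

end

context measure_dynamics
begin

lemma process_section:
  assumes x: "x \<in> X" and \<omega>: "\<omega> \<in> space Q"
  shows "(\<lambda>t. \<mu> x t \<omega>) \<in> T \<rightarrow>\<^sub>M sigma_finite_algebra Y"
proof -
  have "(\<lambda>t. t) \<in> T \<rightarrow>\<^sub>M restrict_space borel {0..}"
    by (intro measurable_restrict_space2 measurable_restrict_space1) (auto simp: space_T)
  from measurable_compose[OF measurable_compose[OF this measurable_Pair2'[OF \<omega>]] process_measurable[OF x]]
  show ?thesis by simp
qed

text \<open>Fubini's theorem for time and the countable set of atoms.  Integrability of the superposed process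
  with \<open>\<bar>\<psi>\<bar>\<close> in place of \<open>\<psi>\<close> is the domination that it requires.\<close>

lemma time_integral_superposition:
  assumes S: "countable S" "S \<subseteq> X"
    and \<xi>: "\<And>g :: 'x \<Rightarrow> ennreal. (\<integral>\<^sup>+x. g x \<partial>\<xi>) = (\<integral>\<^sup>+x. g x \<partial>count_space S)"
    and \<omega>: "\<omega> \<in> space Q"
    and int: "time_integrable r \<psi> (\<lambda>t. superposition Y \<xi> (\<lambda>x. \<mu> x t \<omega>))"
  shows "\<And>x. x \<in> S \<Longrightarrow> integrable T (\<lambda>t. V x t \<omega>)"
    and "integrable (count_space S) (\<lambda>x. contribution x \<omega>)"
    and "time_integral r \<psi> (\<lambda>t. superposition Y \<xi> (\<lambda>x. \<mu> x t \<omega>)) = (\<integral>x. contribution x \<omega> \<partial>count_space S)"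
proof -
  let ?m = "\<lambda>t. superposition Y \<xi> (\<lambda>x. \<mu> x t \<omega>)"
  interpret T: finite_measure T by (rule finite_T)
  interpret CS: sigma_finite_measure "count_space S" using S(1) by (rule sigma_finite_measure_count_space_countable)
  interpret P: pair_sigma_finite T "count_space S" ..
  have M: "sets (\<mu> x t \<omega>) = sets Y" if "x \<in> S" "t \<in> space T" for x t
    using that S(2) \<omega> by (intro process_sets) (auto simp: space_T)
  have V_sec: "(\<lambda>t. V x t \<omega>) \<in> borel_measurable T" if "x \<in> S" for x
    using measurable_compose[OF measurable_Pair2'[OF \<omega>] process_integral_measurable[OF _ \<psi>], of x] that S(2)
    by auto
  have V_joint: "(\<lambda>(t, x). V x t \<omega>) \<in> borel_measurable (T \<Otimes>\<^sub>M count_space S)"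
  proof -
    have "(\<lambda>z. V (fst z) (snd z) \<omega>) \<in> borel_measurable (count_space S \<Otimes>\<^sub>M T)"
      by (rule measurable_pair_measure_countable1[OF S(1)]) (simp add: V_sec)
    from measurable_pair_swap[OF this] show ?thesis by (simp add: case_prod_unfold)
  qed
  have int1: "AE t in T. integrable (?m t) \<psi>" and int2: "integrable T (\<lambda>t. \<integral>y. \<bar>\<psi> y\<bar> \<partial>?m t)"
    using int by (auto simp: time_integrable_T)
  have pt: "AE t in T. integrable (count_space S) (\<lambda>x. U x t \<omega>) \<and>
      (\<integral>y. \<bar>\<psi> y\<bar> \<partial>?m t) = (\<integral>x. U x t \<omega> \<partial>count_space S) \<and>
      (\<integral>y. \<psi> y \<partial>?m t) = (\<integral>x. V x t \<omega> \<partial>count_space S)"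
    using int1 AE_space
  proof eventually_elim
    case (elim t)
    show ?case
      using integral_superposition[OF S(1) \<xi> M[OF _ elim(2)] \<psi> elim(1)] by blast
  qed
  have VU: "\<bar>V x t \<omega>\<bar> \<le> U x t \<omega>" for x t by (rule integral_abs_bound)
  have V_int: "AE t in T. integrable (count_space S) (\<lambda>x. V x t \<omega>)"
    using pt by eventually_elim (rule Bochner_Integration.integrable_bound, use VU in auto)
  have joint: "integrable (T \<Otimes>\<^sub>M count_space S) (\<lambda>(t, x). V x t \<omega>)"
  proof (rule P.Fubini_integrable[OF V_joint])
    show "AE t in T. integrable (count_space S) (\<lambda>x. case (t, x) of (t, x) \<Rightarrow> V x t \<omega>)"
      using V_int by simp
    show "integrable T (\<lambda>t. \<integral>x. norm (case (t, x) of (t, x) \<Rightarrow> V x t \<omega>) \<partial>count_space S)"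
    proof (rule Bochner_Integration.integrable_bound[OF int2])
      show "(\<lambda>t. \<integral>x. norm (case (t, x) of (t, x) \<Rightarrow> V x t \<omega>) \<partial>count_space S) \<in> borel_measurable T"
        using V_joint by (intro CS.borel_measurable_lebesgue_integral) (auto simp: case_prod_unfold)
      show "AE t in T. norm (\<integral>x. norm (case (t, x) of (t, x) \<Rightarrow> V x t \<omega>) \<partial>count_space S) \<le> norm (\<integral>y. \<bar>\<psi> y\<bar> \<partial>?m t)"
        using pt V_int
      proof eventually_elim
        case (elim t)
        then have "(\<integral>x. \<bar>V x t \<omega>\<bar> \<partial>count_space S) \<le> (\<integral>x. U x t \<omega> \<partial>count_space S)"
          by (intro integral_mono VU) auto
        then show ?case using elim by simp
      qed
    qed
  qed
  from P.AE_integrable_snd[OF joint]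
  show "\<And>x. x \<in> S \<Longrightarrow> integrable T (\<lambda>t. V x t \<omega>)" by (simp add: AE_count_space)
  from P.integrable_snd[OF joint]
  show "integrable (count_space S) (\<lambda>x. contribution x \<omega>)" by (simp add: contribution_eq)
  have "time_integral r \<psi> ?m = (\<integral>t. (\<integral>x. V x t \<omega> \<partial>count_space S) \<partial>T)"
    unfolding time_integral_T
  proof (rule integral_cong_AE)
    show "AE t in T. (\<integral>y. \<psi> y \<partial>?m t) = (\<integral>x. V x t \<omega> \<partial>count_space S)" using pt by eventually_elim simp
    show "(\<lambda>t. \<integral>x. V x t \<omega> \<partial>count_space S) \<in> borel_measurable T"
      using V_joint by (rule CS.borel_measurable_lebesgue_integral)
    \<comment> \<open>Equality almost everywhere does not transfer measurability, as the \<open>\<sigma>\<close>-algebra of \<open>T\<close> is not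
      complete.  Both parts of the integral are countable sums of measurable functions of \<open>t\<close>.\<close>
    have N: "(\<lambda>t. \<integral>\<^sup>+y. f y \<partial>?m t) \<in> borel_measurable T" if f: "f \<in> borel_measurable Y" for f
    proof -
      have sec: "(\<lambda>t. \<integral>\<^sup>+y. f y \<partial>\<mu> x t \<omega>) \<in> borel_measurable T" if "x \<in> S" for x
      proof -
        have "x \<in> X" using that S(2) by blast
        from measurable_compose[OF process_section[OF this \<omega>] nn_integral_measurable_sigma_finite_algebra[OF f]]
        show ?thesis .
      qed
      have "(\<lambda>z. \<integral>\<^sup>+y. f y \<partial>\<mu> (fst z) (snd z) \<omega>) \<in> borel_measurable (count_space S \<Otimes>\<^sub>M T)"
        by (rule measurable_pair_measure_countable1[OF S(1)]) (simp add: sec)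
      from measurable_pair_swap[OF this]
      have "(\<lambda>(t, x). \<integral>\<^sup>+y. f y \<partial>\<mu> x t \<omega>) \<in> borel_measurable (T \<Otimes>\<^sub>M count_space S)"
        by (simp add: case_prod_unfold)
      then have "(\<lambda>t. \<integral>\<^sup>+x. (\<integral>\<^sup>+y. f y \<partial>\<mu> x t \<omega>) \<partial>count_space S) \<in> borel_measurable T"
        by (rule CS.borel_measurable_nn_integral)
      moreover have "(\<integral>\<^sup>+y. f y \<partial>?m t) = (\<integral>\<^sup>+x. (\<integral>\<^sup>+y. f y \<partial>\<mu> x t \<omega>) \<partial>count_space S)" if "t \<in> space T" for t
        by (rule nn_integral_superposition[OF S(1) \<xi> M[OF _ that] f])
      ultimately show ?thesis by (rule measurable_cong[THEN iffD2, rotated])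
    qed
    have "integrable (?m t) \<psi> \<longleftrightarrow> (\<integral>\<^sup>+y. ennreal \<bar>\<psi> y\<bar> \<partial>?m t) < \<infinity>" if "t \<in> space T" for t
    proof -
      have "\<psi> \<in> borel_measurable (?m t)"
        using \<psi> sets_superposition[OF S(1) \<xi> M[OF _ that]] by (simp cong: measurable_cong_sets)
      then show ?thesis by (simp add: integrable_iff_bounded)
    qed
    then have "(\<integral>y. \<psi> y \<partial>?m t) = (if (\<integral>\<^sup>+y. ennreal \<bar>\<psi> y\<bar> \<partial>?m t) < \<infinity>
        then enn2real (\<integral>\<^sup>+y. ennreal (\<psi> y) \<partial>?m t) - enn2real (\<integral>\<^sup>+y. ennreal (- \<psi> y) \<partial>?m t) else 0)"
      if "t \<in> space T" for t
      using that by (auto simp: real_lebesgue_integral_def not_integrable_integral_eq)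
    note eq = this
    have "(\<lambda>t. if (\<integral>\<^sup>+y. ennreal \<bar>\<psi> y\<bar> \<partial>?m t) < \<infinity>
        then enn2real (\<integral>\<^sup>+y. ennreal (\<psi> y) \<partial>?m t) - enn2real (\<integral>\<^sup>+y. ennreal (- \<psi> y) \<partial>?m t) else 0)
        \<in> borel_measurable T"
    proof -
      have [measurable]: "(\<lambda>t. \<integral>\<^sup>+y. ennreal \<bar>\<psi> y\<bar> \<partial>?m t) \<in> borel_measurable T"
          "(\<lambda>t. \<integral>\<^sup>+y. ennreal (\<psi> y) \<partial>?m t) \<in> borel_measurable T"
          "(\<lambda>t. \<integral>\<^sup>+y. ennreal (- \<psi> y) \<partial>?m t) \<in> borel_measurable T"
        by (intro N; measurable)+
      show ?thesis by measurable
    qed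
    then show "(\<lambda>t. \<integral>y. \<psi> y \<partial>?m t) \<in> borel_measurable T"
      by (rule measurable_cong[THEN iffD2, rotated]) (rule eq)
  qed
  also have "\<dots> = (\<integral>x. contribution x \<omega> \<partial>count_space S)"
    unfolding contribution_eq by (rule P.Fubini_integral[OF joint, symmetric])
  finally show "time_integral r \<psi> ?m = (\<integral>x. contribution x \<omega> \<partial>count_space S)" .
qed

end

section \<open>Mixtures and iterated integration\<close>

text \<open>The monadic bind, except that the \<open>\<sigma>\<close>-algebra is \<open>N\<close> also when \<open>M\<close> is a measure on the empty space.\<close>

definition mixture :: "'a measure \<Rightarrow> 'b measure \<Rightarrow> ('a \<Rightarrow> 'b measure) \<Rightarrow> 'b measure" where
  "mixture M N K = join (distr M (subprob_algebra N) K)"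

lemma sets_mixture: "sets (mixture M N K) = sets N"
  unfolding mixture_def sets_join by (rule sets_select_sets) simp

lemma nn_integral_mixture:
  assumes K: "K \<in> M \<rightarrow>\<^sub>M subprob_algebra N" and f: "f \<in> borel_measurable N"
  shows "(\<integral>\<^sup>+y. f y \<partial>mixture M N K) = (\<integral>\<^sup>+x. (\<integral>\<^sup>+y. f y \<partial>K x) \<partial>M)"
  unfolding mixture_def
  by (subst nn_integral_join[OF f], simp, subst nn_integral_distr[OF K])
    (auto intro: nn_integral_measurable_subprob_algebra f)

lemma emeasure_mixture:
  assumes K: "K \<in> M \<rightarrow>\<^sub>M subprob_algebra N" and B: "B \<in> sets N"
  shows "emeasure (mixture M N K) B = (\<integral>\<^sup>+x. emeasure (K x) B \<partial>M)"
proof -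
  have "emeasure (mixture M N K) B = (\<integral>\<^sup>+y. indicator B y \<partial>mixture M N K)"
    using B by (simp add: sets_mixture)
  also have "\<dots> = (\<integral>\<^sup>+x. (\<integral>\<^sup>+y. indicator B y \<partial>K x) \<partial>M)"
    using B by (intro nn_integral_mixture[OF K]) simp
  also have "\<dots> = (\<integral>\<^sup>+x. emeasure (K x) B \<partial>M)"
    using B sets_kernel[OF K] by (intro nn_integral_cong) simp
  finally show ?thesis .
qed

lemma integral_mixture_nonneg:
  fixes f :: "'b \<Rightarrow> real"
  assumes K: "K \<in> M \<rightarrow>\<^sub>M subprob_algebra N" and int: "integrable (mixture M N K) f" and nn: "\<And>y. 0 \<le> f y"
  shows "AE x in M. integrable (K x) f" "integrable M (\<lambda>x. \<integral>y. f y \<partial>K x)"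
    "(\<integral>y. f y \<partial>mixture M N K) = (\<integral>x. (\<integral>y. f y \<partial>K x) \<partial>M)"
proof -
  have f[measurable]: "f \<in> borel_measurable N"
    using int sets_mixture[of M N K] by (simp cong: measurable_cong_sets add: borel_measurable_integrable)
  have fK: "f \<in> borel_measurable (K x)" if "x \<in> space M" for x
    using f sets_kernel[OF K that] by (simp cong: measurable_cong_sets)
  have eq: "(\<integral>\<^sup>+y. f y \<partial>mixture M N K) = (\<integral>\<^sup>+x. (\<integral>\<^sup>+y. f y \<partial>K x) \<partial>M)"
    by (rule nn_integral_mixture[OF K]) measurable
  have fin: "(\<integral>\<^sup>+y. f y \<partial>mixture M N K) < \<infinity>"
    using int nn by (simp add: integrable_iff_bounded)
  have meas: "(\<lambda>x. \<integral>\<^sup>+y. f y \<partial>K x) \<in> borel_measurable M"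
    by (rule measurable_compose[OF K nn_integral_measurable_subprob_algebra]) measurable
  have meas': "(\<lambda>x. \<integral>y. f y \<partial>K x) \<in> borel_measurable M"
    by (rule measurable_compose[OF K integral_measurable_subprob_algebra]) (rule f)
  have "AE x in M. (\<integral>\<^sup>+y. f y \<partial>K x) \<noteq> \<infinity>"
    using fin unfolding eq by (intro nn_integral_PInf_AE meas) simp
  then show i: "AE x in M. integrable (K x) f"
    using AE_space
  proof eventually_elim
    case (elim x)
    then show ?case using fK[of x] nn by (simp add: integrable_iff_bounded less_top)
  qed
  have eq': "(\<integral>\<^sup>+x. (\<integral>\<^sup>+y. f y \<partial>K x) \<partial>M) = (\<integral>\<^sup>+x. ennreal (\<integral>y. f y \<partial>K x) \<partial>M)"
    using i nn by (intro nn_integral_cong_AE) (auto elim!: eventually_mono intro!: nn_integral_eq_integral)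
  have nn': "0 \<le> (\<integral>y. f y \<partial>K x)" for x using nn by simp
  show "integrable M (\<lambda>x. \<integral>y. f y \<partial>K x)"
    using fin meas' unfolding eq eq' by (simp add: integrable_iff_bounded nn')
  show "(\<integral>y. f y \<partial>mixture M N K) = (\<integral>x. (\<integral>y. f y \<partial>K x) \<partial>M)"
    using int meas' nn nn' eq eq' by (simp add: integral_eq_nn_integral borel_measurable_integrable)
qed

lemma integral_mixture_real:
  fixes f :: "'b \<Rightarrow> real"
  assumes K: "K \<in> M \<rightarrow>\<^sub>M subprob_algebra N" and int: "integrable (mixture M N K) f"
  shows "AE x in M. integrable (K x) f" "integrable M (\<lambda>x. \<integral>y. f y \<partial>K x)"
    "(\<integral>y. f y \<partial>mixture M N K) = (\<integral>x. (\<integral>y. f y \<partial>K x) \<partial>M)"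
proof -
  let ?p = "\<lambda>y. max 0 (f y)" and ?n = "\<lambda>y. max 0 (- f y)"
  have pn: "integrable (mixture M N K) ?p" "integrable (mixture M N K) ?n" using int by auto
  have f_eq: "f y = ?p y - ?n y" for y by auto
  note p = integral_mixture_nonneg[OF K pn(1) max.cobounded1] and n = integral_mixture_nonneg[OF K pn(2) max.cobounded1]
  have f[measurable]: "f \<in> borel_measurable N"
    using int sets_mixture[of M N K] by (simp cong: measurable_cong_sets add: borel_measurable_integrable)
  have i: "AE x in M. integrable (K x) f \<and> (\<integral>y. f y \<partial>K x) = (\<integral>y. ?p y \<partial>K x) - (\<integral>y. ?n y \<partial>K x)"
    using p(1) n(1)
  proof eventually_elim
    case (elim x)
    then have "integrable (K x) (\<lambda>y. ?p y - ?n y)" by simp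
    moreover have "(\<integral>y. ?p y - ?n y \<partial>K x) = (\<integral>y. ?p y \<partial>K x) - (\<integral>y. ?n y \<partial>K x)"
      using elim by (intro Bochner_Integration.integral_diff) simp_all
    ultimately show ?case unfolding f_eq[symmetric] by simp
  qed
  then show "AE x in M. integrable (K x) f" by auto
  have meas: "(\<lambda>x. \<integral>y. f y \<partial>K x) \<in> borel_measurable M"
    by (rule measurable_compose[OF K integral_measurable_subprob_algebra]) (rule f)
  have d: "integrable M (\<lambda>x. (\<integral>y. ?p y \<partial>K x) - (\<integral>y. ?n y \<partial>K x))" using p(2) n(2) by simp
  show "integrable M (\<lambda>x. \<integral>y. f y \<partial>K x)"
    using i by (subst integrable_cong_AE[OF meas borel_measurable_integrable[OF d]]) (auto intro: d)
  have "(\<integral>y. f y \<partial>mixture M N K) = (\<integral>y. ?p y \<partial>mixture M N K) - (\<integral>y. ?n y \<partial>mixture M N K)"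
    using pn by (subst f_eq) (rule Bochner_Integration.integral_diff)
  also have "\<dots> = (\<integral>x. (\<integral>y. ?p y \<partial>K x) - (\<integral>y. ?n y \<partial>K x) \<partial>M)"
    using p n by simp
  also have "\<dots> = (\<integral>x. (\<integral>y. f y \<partial>K x) \<partial>M)"
    using i by (intro integral_cong_AE meas borel_measurable_integrable[OF d]) auto
  finally show "(\<integral>y. f y \<partial>mixture M N K) = (\<integral>x. (\<integral>y. f y \<partial>K x) \<partial>M)" .
qed

lemma integrable_ComplexI:
  assumes "integrable M f" "integrable M g"
  shows "integrable M (\<lambda>x. Complex (f x) (g x))"
  unfolding Complex_eq using assms
  by (intro Bochner_Integration.integrable_add integrable_mult_right integrable_of_real)

lemma integral_mixture_complex:
  fixes f :: "'b \<Rightarrow> complex"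
  assumes K: "K \<in> M \<rightarrow>\<^sub>M subprob_algebra N" and int: "integrable (mixture M N K) f"
  shows "integrable M (\<lambda>x. \<integral>y. f y \<partial>K x)"
    "(\<integral>y. f y \<partial>mixture M N K) = (\<integral>x. (\<integral>y. f y \<partial>K x) \<partial>M)"
proof -
  have f[measurable]: "f \<in> borel_measurable N"
    using int sets_mixture[of M N K] by (simp cong: measurable_cong_sets add: borel_measurable_integrable)
  have meas: "(\<lambda>x. \<integral>y. f y \<partial>K x) \<in> borel_measurable M"
    by (rule measurable_compose[OF K integral_measurable_subprob_algebra]) (rule f)
  note re = integral_mixture_real[OF K integrable_Re[OF int]]
    and im = integral_mixture_real[OF K integrable_Im[OF int]]
  have i: "AE x in M. (\<integral>y. f y \<partial>K x) = Complex (\<integral>y. Re (f y) \<partial>K x) (\<integral>y. Im (f y) \<partial>K x)"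
    using re(1) im(1) AE_space
  proof eventually_elim
    case (elim x)
    then have "integrable (K x) f" using integrable_ComplexI[of "K x" "\<lambda>y. Re (f y)" "\<lambda>y. Im (f y)"] by simp
    then show ?case by (simp add: complex_eq_iff integral_Re integral_Im)
  qed
  have C: "integrable M (\<lambda>x. Complex (\<integral>y. Re (f y) \<partial>K x) (\<integral>y. Im (f y) \<partial>K x))"
    using re(2) im(2) by (rule integrable_ComplexI)
  show i': "integrable M (\<lambda>x. \<integral>y. f y \<partial>K x)"
    using i by (subst integrable_cong_AE[OF meas borel_measurable_integrable[OF C]]) (auto intro: C)
  have "(\<integral>x. (\<integral>y. f y \<partial>K x) \<partial>M) = (\<integral>x. Complex (\<integral>y. Re (f y) \<partial>K x) (\<integral>y. Im (f y) \<partial>K x) \<partial>M)"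
    using i by (intro integral_cong_AE meas borel_measurable_integrable[OF C])
  also have "\<dots> = Complex (\<integral>x. (\<integral>y. Re (f y) \<partial>K x) \<partial>M) (\<integral>x. (\<integral>y. Im (f y) \<partial>K x) \<partial>M)"
    using integral_Re[OF C] integral_Im[OF C] by (simp add: complex_eq_iff)
  also have "\<dots> = (\<integral>y. f y \<partial>mixture M N K)"
    unfolding re(3)[symmetric] im(3)[symmetric] using int by (simp add: complex_eq_iff integral_Re integral_Im)
  finally show "(\<integral>y. f y \<partial>mixture M N K) = (\<integral>x. (\<integral>y. f y \<partial>K x) \<partial>M)" by simp
qed

context
  fixes M :: "'a measure" and N :: "'b measure" and P :: "('a \<times> 'b) measure"
  assumes P: "product_measure M N P"
begin

lemma product_measure_AE:
  assumes "AE z in P. R z"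
  shows "AE x in M. AE y in N. R (x, y)"
proof -
  obtain E where E: "{z \<in> space P. \<not> R z} \<subseteq> E" "emeasure P E = 0" "E \<in> sets P"
    using AE_E[OF assms] by blast
  have "(\<integral>\<^sup>+x. emeasure N (Pair x -` E) \<partial>M) = 0"
    and meas: "(\<lambda>x. emeasure N (Pair x -` E)) \<in> borel_measurable M"
    and sec: "\<And>x. x \<in> space M \<Longrightarrow> Pair x -` E \<in> sets N"
    using P E unfolding product_measure_def by auto
  then have "AE x in M. emeasure N (Pair x -` E) = 0"
    by (simp add: nn_integral_0_iff_AE)
  then show ?thesis
    using AE_space
  proof eventually_elim
    case (elim x)
    then have "Pair x -` E \<in> null_sets N" using sec by (intro null_setsI) auto
    then show ?case
      by (rule AE_I') (use E(1) elim(2) P in \<open>auto simp: product_measure_def\<close>)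
  qed
qed

lemma product_measure_section:
  fixes f :: "'a \<times> 'b \<Rightarrow> real"
  assumes f: "f \<in> borel_measurable P" and B: "B \<in> sets borel"
  shows "x \<in> space M \<Longrightarrow> (\<lambda>y. f (x, y)) -` B \<inter> space N \<in> sets N"
    and "(\<lambda>x. emeasure N ((\<lambda>y. f (x, y)) -` B \<inter> space N)) \<in> borel_measurable M"
    and "emeasure P (f -` B \<inter> space P) = (\<integral>\<^sup>+x. emeasure N ((\<lambda>y. f (x, y)) -` B \<inter> space N) \<partial>M)"
proof -
  have E: "f -` B \<inter> space P \<in> sets P" using f B by (rule measurable_sets)
  have eq: "Pair x -` (f -` B \<inter> space P) = (\<lambda>y. f (x, y)) -` B \<inter> space N" if "x \<in> space M" for x
    using P that by (auto simp: product_measure_def)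
  show "(\<lambda>y. f (x, y)) -` B \<inter> space N \<in> sets N" if "x \<in> space M" for x
    using P E eq[OF that] that unfolding product_measure_def by metis
  have "(\<lambda>x. emeasure N (Pair x -` (f -` B \<inter> space P))) \<in> borel_measurable M"
    using P E unfolding product_measure_def by blast
  then show "(\<lambda>x. emeasure N ((\<lambda>y. f (x, y)) -` B \<inter> space N)) \<in> borel_measurable M"
    by (rule measurable_cong[THEN iffD2, rotated]) (simp only: eq)
  have "emeasure P (f -` B \<inter> space P) = (\<integral>\<^sup>+x. emeasure N (Pair x -` (f -` B \<inter> space P)) \<partial>M)"
    using P E unfolding product_measure_def by blast
  also have "\<dots> = (\<integral>\<^sup>+x. emeasure N ((\<lambda>y. f (x, y)) -` B \<inter> space N) \<partial>M)"
    by (intro nn_integral_cong) (simp only: eq)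
  finally show "emeasure P (f -` B \<inter> space P) = \<dots>" .
qed

lemma product_measure_section_measurable:
  fixes f :: "'a \<times> 'b \<Rightarrow> real"
  assumes f: "f \<in> borel_measurable P" and x: "x \<in> space M"
  shows "(\<lambda>y. f (x, y)) \<in> borel_measurable N"
  by (rule measurableI) (use product_measure_section(1)[OF f _ x] in auto)

lemma product_measure_kernel:
  fixes f :: "'a \<times> 'b \<Rightarrow> real"
  assumes f: "f \<in> borel_measurable P" and N: "prob_space N"
  shows "(\<lambda>x. distr N borel (\<lambda>y. f (x, y))) \<in> M \<rightarrow>\<^sub>M subprob_algebra borel"
proof (rule measurable_subprob_algebra)
  fix x assume x: "x \<in> space M"
  show "subprob_space (distr N borel (\<lambda>y. f (x, y)))"
    by (intro prob_space_imp_subprob_space prob_space.prob_space_distr[OF N]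
        product_measure_section_measurable[OF f x])
next
  fix B :: "real set" assume B: "B \<in> sets borel"
  show "(\<lambda>x. emeasure (distr N borel (\<lambda>y. f (x, y))) B) \<in> borel_measurable M"
    using product_measure_section(2)[OF f B]
    by (rule measurable_cong[THEN iffD2, rotated])
      (use B in \<open>auto intro!: emeasure_distr product_measure_section_measurable[OF f]\<close>)
qed simp

text \<open>The law of a variable on the extended product is the mixture of the laws of its sections, as for the
  ordinary product.\<close>

lemma product_measure_distr:
  fixes f :: "'a \<times> 'b \<Rightarrow> real"
  assumes f: "f \<in> borel_measurable P" and N: "prob_space N"
  shows "distr P borel f = mixture M borel (\<lambda>x. distr N borel (\<lambda>y. f (x, y)))"
proof (rule measure_eqI)
  fix B assume "B \<in> sets (distr P borel f)"
  then have B: "B \<in> sets borel" by simp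
  have "emeasure (distr P borel f) B = (\<integral>\<^sup>+x. emeasure N ((\<lambda>y. f (x, y)) -` B \<inter> space N) \<partial>M)"
    using product_measure_section(3)[OF f B] emeasure_distr[OF f B] by simp
  also have "\<dots> = (\<integral>\<^sup>+x. emeasure (distr N borel (\<lambda>y. f (x, y))) B \<partial>M)"
    by (intro nn_integral_cong emeasure_distr[symmetric] B product_measure_section_measurable[OF f])
  also have "\<dots> = emeasure (mixture M borel (\<lambda>x. distr N borel (\<lambda>y. f (x, y)))) B"
    by (rule emeasure_mixture[OF product_measure_kernel[OF f N] B, symmetric])
  finally show "emeasure (distr P borel f) B = \<dots>" .
qed (simp add: sets_mixture)

lemma product_measure_snd:
  assumes M: "prob_space M"
  shows "snd \<in> P \<rightarrow>\<^sub>M N" "distr P N snd = N"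
proof -
  interpret M: prob_space M by fact
  have sp: "space P = space M \<times> space N" using P by (simp add: product_measure_def)
  have vimage: "snd -` B \<inter> space P = space M \<times> B" if "B \<in> sets N" for B
    using sets.sets_into_space[OF that] by (auto simp: sp)
  have sets: "space M \<times> B \<in> sets P" if "B \<in> sets N" for B
    using P that by (auto simp: product_measure_def)
  show 1: "snd \<in> P \<rightarrow>\<^sub>M N"
  proof (rule measurableI)
    show "snd -` B \<inter> space P \<in> sets P" if "B \<in> sets N" for B
      unfolding vimage[OF that] by (rule sets[OF that])
  qed (auto simp: sp)
  show "distr P N snd = N"
  proof (rule measure_eqI)
    fix B assume "B \<in> sets (distr P N snd)"
    then have B: "B \<in> sets N" by simp
    have "emeasure (distr P N snd) B = emeasure P (space M \<times> B)"
      using 1 B by (simp add: emeasure_distr vimage)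
    also have "\<dots> = (\<integral>\<^sup>+x. emeasure N (Pair x -` (space M \<times> B)) \<partial>M)"
      using P sets[OF B] by (auto simp: product_measure_def)
    also have "\<dots> = (\<integral>\<^sup>+x. emeasure N B \<partial>M)"
      by (intro nn_integral_cong arg_cong[where f="emeasure N"]) auto
    finally show "emeasure (distr P N snd) B = emeasure N B"
      by (simp add: M.emeasure_space_1)
  qed simp
qed

lemma product_measure_prob_space:
  assumes M: "prob_space M" and N: "prob_space N"
  shows "prob_space P"
proof
  have "emeasure P (space P) = emeasure (distr P N snd) (space N)"
    using product_measure_snd[OF M]
    by (subst emeasure_distr) (auto intro!: arg_cong[where f="emeasure P"] dest: measurable_space)
  also have "\<dots> = 1" using product_measure_snd[OF M] prob_space.emeasure_space_1[OF N] by simp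
  finally show "emeasure P (space P) = 1" .
qed

end

section \<open>The law of the additive functional\<close>

locale poisson_dynamics =
  poisson_input X \<nu> \<theta> + measure_dynamics Q Y X \<mu> r \<psi>
  for X :: "'x::euclidean_space set" and \<nu> \<theta> and Q :: "'w measure" and Y :: "'y measure" and \<mu> r \<psi> +
  fixes P :: "('x measure \<times> 'w) measure"
  assumes P: "product_measure \<theta> Q P"
    and total_measurable_P: "poisson_additive_functional Y \<mu> r \<psi> \<in> borel_measurable P"
    and wd: "AE (\<xi>, \<omega>) in P. time_integrable r \<psi> (\<lambda>t. superposition Y \<xi> (\<lambda>x. \<mu> x t \<omega>))"
begin

abbreviation total :: "'x measure \<Rightarrow> 'w \<Rightarrow> real" where
  "total \<xi> \<omega> \<equiv> poisson_additive_functional Y \<mu> r \<psi> (\<xi>, \<omega>)"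

lemma total_eq: "total \<xi> \<omega> = time_integral r \<psi> (\<lambda>t. superposition Y \<xi> (\<lambda>x. \<mu> x t \<omega>))"
  by (simp add: poisson_additive_functional_def)

lemma total_measurable: "\<xi> \<in> space \<theta> \<Longrightarrow> total \<xi> \<in> borel_measurable Q"
  by (rule product_measure_section_measurable[OF P total_measurable_P])

definition config_law :: "'x measure \<Rightarrow> real measure" where
  "config_law \<xi> = distr Q borel (total \<xi>)"

definition point_law :: "'x \<Rightarrow> real measure" where
  "point_law x = distr Q borel (contribution x)"

lemma config_law_kernel: "config_law \<in> \<theta> \<rightarrow>\<^sub>M subprob_algebra borel"
  unfolding config_law_def [abs_def]
  by (rule product_measure_kernel[OF P total_measurable_P prob_space_axioms])

lemma distr_total: "distr P borel (poisson_additive_functional Y \<mu> r \<psi>) = mixture \<theta> borel config_law"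
  unfolding config_law_def [abs_def]
  by (rule product_measure_distr[OF P total_measurable_P prob_space_axioms])

text \<open>Since the functional is measurable at every configuration, not just at almost every one, it may be
  evaluated at configurations with one point.  This is the source of all measurability in \<open>x\<close>.\<close>

lemma total_dirac:
  assumes x: "x \<in> X" and \<omega>: "\<omega> \<in> space Q"
  shows "total (return (restrict_space borel X) x) \<omega> = contribution x \<omega>"
proof -
  let ?r = "return (restrict_space borel X) x"
  have x': "x \<in> space (restrict_space borel X)" using x by (simp add: space_restrict_space)
  have sup: "superposition Y ?r (\<lambda>x. \<mu> x t \<omega>) = \<mu> x t \<omega>" if t: "t \<in> space T" for t
  proof -
    have sets: "sets (\<mu> x t \<omega>) = sets Y" using t x \<omega> by (intro process_sets) (auto simp: space_T)
    have "(\<integral>\<^sup>+y. emeasure (\<mu> y t \<omega>) B \<partial>?r) = emeasure (\<mu> x t \<omega>) B" for B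
    proof -
      have D: "X - {x} \<in> sets (restrict_space borel X)"
        using sets.compl_sets[OF singleton_sets_restrict[OF x]] by (simp add: space_restrict_space)
      have "X - {x} \<in> null_sets ?r"
        using D emeasure_return[OF D, of x] by (intro null_setsI) auto
      then have "AE y in ?r. y = x"
        by (rule AE_I') (auto simp: space_restrict_space)
      then have "(\<integral>\<^sup>+y. emeasure (\<mu> y t \<omega>) B \<partial>?r) = (\<integral>\<^sup>+y. emeasure (\<mu> x t \<omega>) B \<partial>?r)"
        by (intro nn_integral_cong_AE) auto
      then show ?thesis
        using prob_space.emeasure_space_1[OF prob_space_return[OF x']] by simp
    qed
    then have "superposition Y ?r (\<lambda>x. \<mu> x t \<omega>) = measure_of (space Y) (sets Y) (emeasure (\<mu> x t \<omega>))"
      by (simp add: superposition_def)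
    also have "\<dots> = \<mu> x t \<omega>"
      using measure_of_of_measure[of "\<mu> x t \<omega>"] sets sets_eq_imp_space_eq[OF sets] by simp
    finally show ?thesis .
  qed
  show ?thesis
    unfolding total_eq contribution_def time_integral_T
    by (rule Bochner_Integration.integral_cong) (simp_all only: sup)
qed

lemma point_law_kernel: "point_law \<in> \<nu> \<rightarrow>\<^sub>M subprob_algebra borel"
proof -
  have "return (restrict_space borel X) \<in> \<nu> \<rightarrow>\<^sub>M \<theta>"
    using measurable_dirac[of X] by (simp cong: measurable_cong_sets[OF sets_\<nu> sets_\<theta>])
  from measurable_compose[OF this config_law_kernel]
  show ?thesis
  proof (rule measurable_cong[THEN iffD2, rotated])
    fix x assume "x \<in> space \<nu>"
    then show "point_law x = config_law (return (restrict_space borel X) x)"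
      unfolding point_law_def config_law_def
      by (intro distr_cong) (auto simp: space_\<nu> total_dirac)
  qed
qed

text \<open>The configurations for which the functional is an absolutely convergent sum over distinct atoms.\<close>

definition typical :: "'x measure \<Rightarrow> bool" where
  "typical \<xi> \<longleftrightarrow> regular \<xi> \<and> \<xi> \<in> space \<theta> \<and>
    (AE \<omega> in Q. time_integrable r \<psi> (\<lambda>t. superposition Y \<xi> (\<lambda>x. \<mu> x t \<omega>)))"

lemma AE_typical: "AE \<xi> in \<theta>. typical \<xi>"
proof -
  have "AE \<xi> in \<theta>. AE \<omega> in Q. time_integrable r \<psi> (\<lambda>t. superposition Y \<xi> (\<lambda>x. \<mu> x t \<omega>))"
    using product_measure_AE[OF P wd] by simp
  then show ?thesis using AE_regular AE_space by eventually_elim (simp add: typical_def)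
qed

lemma typical_atoms:
  assumes "typical \<xi>"
  shows "countable (atoms \<xi>)" "atoms \<xi> \<subseteq> X" "finite (atoms \<xi> \<inter> window n)"
    "(\<integral>\<^sup>+x. g x \<partial>\<xi>) = (\<integral>\<^sup>+x. g x \<partial>count_space (atoms \<xi>))"
  using assms counting_measure_atoms[of \<xi> X] nn_integral_simple_measure[of \<xi> X g]
    regular_count(1)[of \<xi> "window n"] window_sets
  by (auto simp: typical_def regular_def)

lemma typical_sum:
  assumes \<xi>: "typical \<xi>"
  shows "AE \<omega> in Q. (\<forall>x\<in>atoms \<xi>. integrable T (\<lambda>t. V x t \<omega>)) \<and>
    integrable (count_space (atoms \<xi>)) (\<lambda>x. contribution x \<omega>) \<and>
    total \<xi> \<omega> = (\<integral>x. contribution x \<omega> \<partial>count_space (atoms \<xi>))"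
proof -
  have "AE \<omega> in Q. time_integrable r \<psi> (\<lambda>t. superposition Y \<xi> (\<lambda>x. \<mu> x t \<omega>))"
    using \<xi> by (simp add: typical_def)
  then show ?thesis using AE_space
  proof eventually_elim
    case (elim \<omega>)
    note * = time_integral_superposition[OF typical_atoms(1)[OF \<xi>] typical_atoms(2)[OF \<xi>] typical_atoms(4)[OF \<xi>] elim(2,1)]
    show ?case unfolding total_eq using * by blast
  qed
qed

lemma window_sum_limit:
  fixes c :: "'x \<Rightarrow> real"
  assumes \<xi>: "typical \<xi>" and c: "integrable (count_space (atoms \<xi>)) c"
  shows "(\<lambda>n. \<Sum>x\<in>atoms \<xi> \<inter> window n. c x) \<longlonglongrightarrow> (\<integral>x. c x \<partial>count_space (atoms \<xi>))"
proof -
  have "(\<lambda>n. \<integral>x. indicator (window n) x * c x \<partial>count_space (atoms \<xi>)) \<longlonglongrightarrow> (\<integral>x. c x \<partial>count_space (atoms \<xi>))"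
  proof (rule integral_dominated_convergence[where w="\<lambda>x. \<bar>c x\<bar>"])
    show "AE x in count_space (atoms \<xi>). (\<lambda>n. indicator (window n) x * c x) \<longlonglongrightarrow> c x"
    proof (intro AE_I2 tendsto_eventually)
      fix x assume "x \<in> space (count_space (atoms \<xi>))"
      then have "x \<in> X" using typical_atoms(2)[OF \<xi>] by auto
      from window_eventually[OF this]
      show "\<forall>\<^sub>F n in sequentially. indicator (window n) x * c x = c x"
        by eventually_elim simp
    qed
  qed (use c in \<open>auto simp: abs_mult indicator_def\<close>)
  moreover have "(\<integral>x. indicator (window n) x * c x \<partial>count_space (atoms \<xi>)) = (\<Sum>x\<in>atoms \<xi> \<inter> window n. c x)" for n
  proof -
    have "finite {x \<in> atoms \<xi>. indicator (window n) x * c x \<noteq> 0}"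
      by (rule finite_subset[OF _ typical_atoms(3)[OF \<xi>, of n]]) (auto simp: indicator_def)
    then have "(\<integral>x. indicator (window n) x * c x \<partial>count_space (atoms \<xi>)) =
        (\<Sum>x | x \<in> atoms \<xi> \<and> indicator (window n) x * c x \<noteq> 0. indicator (window n) x * c x)"
      by (rule lebesgue_integral_count_space_finite_support)
    also have "\<dots> = (\<Sum>x\<in>atoms \<xi> \<inter> window n. c x)"
      using typical_atoms(3)[OF \<xi>, of n] by (intro sum.mono_neutral_cong_left) (auto simp: indicator_def)
    finally show ?thesis .
  qed
  ultimately show ?thesis by simp
qed

lemma point_law_integral:
  fixes g :: "real \<Rightarrow> 'c::{banach,second_countable_topology}"
  assumes "x \<in> X" "g \<in> borel_measurable borel"
  shows "(\<integral>z. g z \<partial>point_law x) = (\<integral>\<omega>. g (contribution x \<omega>) \<partial>Q)"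
  unfolding point_law_def by (rule integral_distr[OF contribution_measurable[OF assms(1)] assms(2)])

text \<open>Independence on windows, followed by dominated convergence in \<open>\<omega>\<close>.  It is used with \<open>g\<close> a character
  and with \<open>g(z) = exp(- s \<bar>z\<bar>)\<close>.\<close>

lemma product_limit:
  fixes g :: "real \<Rightarrow> complex"
  assumes \<xi>: "typical \<xi>" and g: "g \<in> borel_measurable borel" "\<And>z. norm (g z) \<le> 1"
    and W: "W \<in> borel_measurable Q"
    and lim: "AE \<omega> in Q. (\<lambda>n. \<Prod>x\<in>atoms \<xi> \<inter> window n. g (contribution x \<omega>)) \<longlonglongrightarrow> W \<omega>"
  shows "(\<lambda>n. \<Prod>x\<in>atoms \<xi> \<inter> window n. \<integral>z. g z \<partial>point_law x) \<longlonglongrightarrow> (\<integral>\<omega>. W \<omega> \<partial>Q)"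
proof -
  note at = typical_atoms[OF \<xi>]
  have "(\<integral>\<omega>. (\<Prod>x\<in>atoms \<xi> \<inter> window n. g (contribution x \<omega>)) \<partial>Q) =
      (\<Prod>x\<in>atoms \<xi> \<inter> window n. \<integral>z. g z \<partial>point_law x)" for n
  proof -
    have "(\<integral>\<omega>. (\<Prod>x\<in>atoms \<xi> \<inter> window n. g (contribution x \<omega>)) \<partial>Q) =
        (\<Prod>x\<in>atoms \<xi> \<inter> window n. \<integral>\<omega>. g (contribution x \<omega>) \<partial>Q)"
    proof (rule expectation_prod_contributions[OF at(3) _ _ g])
      show "AE \<omega> in Q. integrable T (\<lambda>t. V x t \<omega>)" if "x \<in> atoms \<xi> \<inter> window n" for x
        using typical_sum[OF \<xi>] by eventually_elim (use that in auto)
    qed (use at(2) in auto)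
    also have "\<dots> = (\<Prod>x\<in>atoms \<xi> \<inter> window n. \<integral>z. g z \<partial>point_law x)"
      using at(2) by (intro prod.cong refl point_law_integral[symmetric] g(1)) auto
    finally show ?thesis .
  qed
  moreover have "(\<lambda>n. \<integral>\<omega>. (\<Prod>x\<in>atoms \<xi> \<inter> window n. g (contribution x \<omega>)) \<partial>Q) \<longlonglongrightarrow> (\<integral>\<omega>. W \<omega> \<partial>Q)"
  proof (rule integral_dominated_convergence[OF W _ _ lim, where w="\<lambda>_. 1"])
    show "(\<lambda>\<omega>. \<Prod>x\<in>atoms \<xi> \<inter> window n. g (contribution x \<omega>)) \<in> borel_measurable Q" for n
      using at(2) by (intro borel_measurable_prod measurable_compose[OF _ g(1)] contribution_measurable) auto
    show "AE \<omega> in Q. norm (\<Prod>x\<in>atoms \<xi> \<inter> window n. g (contribution x \<omega>)) \<le> 1" for n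
      unfolding prod_norm[symmetric] by (intro AE_I2 prod_le_1) (auto intro: g(2))
  qed simp
  ultimately show ?thesis by simp
qed

lemma char_limit:
  assumes \<xi>: "typical \<xi>"
  shows "(\<lambda>n. \<Prod>x\<in>atoms \<xi> \<inter> window n. char (point_law x) u) \<longlonglongrightarrow> char (config_law \<xi>) u"
proof -
  have \<xi>': "\<xi> \<in> space \<theta>" using \<xi> by (simp add: typical_def)
  have [measurable]: "total \<xi> \<in> borel_measurable Q" by (rule total_measurable[OF \<xi>'])
  have "(\<lambda>n. \<Prod>x\<in>atoms \<xi> \<inter> window n. \<integral>z. iexp (u * z) \<partial>point_law x) \<longlonglongrightarrow> (\<integral>\<omega>. iexp (u * total \<xi> \<omega>) \<partial>Q)"
  proof (rule product_limit[OF \<xi>])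
    show "AE \<omega> in Q. (\<lambda>n. \<Prod>x\<in>atoms \<xi> \<inter> window n. iexp (u * contribution x \<omega>)) \<longlonglongrightarrow> iexp (u * total \<xi> \<omega>)"
      using typical_sum[OF \<xi>]
    proof eventually_elim
      case (elim \<omega>)
      then have "(\<lambda>n. \<Sum>x\<in>atoms \<xi> \<inter> window n. contribution x \<omega>) \<longlonglongrightarrow> total \<xi> \<omega>"
        using window_sum_limit[OF \<xi>] by simp
      then have "(\<lambda>n. iexp (u * (\<Sum>x\<in>atoms \<xi> \<inter> window n. contribution x \<omega>))) \<longlonglongrightarrow> iexp (u * total \<xi> \<omega>)"
        by (intro tendsto_intros)
      moreover have "iexp (u * (\<Sum>x\<in>atoms \<xi> \<inter> window n. contribution x \<omega>)) =
          (\<Prod>x\<in>atoms \<xi> \<inter> window n. iexp (u * contribution x \<omega>))" for n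
        using typical_atoms(3)[OF \<xi>, of n] by (simp add: sum_distrib_left exp_sum)
      ultimately show ?case by simp
    qed
  qed auto
  then show ?thesis
    unfolding char_def config_law_def by (simp add: integral_distr)
qed

definition abs_total :: "'x measure \<Rightarrow> 'w \<Rightarrow> real" where
  "abs_total \<xi> \<omega> = (\<integral>x. \<bar>contribution x \<omega>\<bar> \<partial>count_space (atoms \<xi>))"

lemma abs_total_measurable:
  assumes \<xi>: "typical \<xi>" shows "abs_total \<xi> \<in> borel_measurable Q"
proof -
  interpret CS: sigma_finite_measure "count_space (atoms \<xi>)"
    using typical_atoms(1)[OF \<xi>] by (rule sigma_finite_measure_count_space_countable)
  have "(\<lambda>z. \<bar>contribution (fst z) (snd z)\<bar>) \<in> borel_measurable (count_space (atoms \<xi>) \<Otimes>\<^sub>M Q)"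
    using typical_atoms(2)[OF \<xi>] contribution_measurable
    by (intro measurable_pair_measure_countable1[OF typical_atoms(1)[OF \<xi>]]) auto
  from measurable_pair_swap[OF this]
  have "(\<lambda>(\<omega>, x). \<bar>contribution x \<omega>\<bar>) \<in> borel_measurable (Q \<Otimes>\<^sub>M count_space (atoms \<xi>))"
    by (simp add: case_prod_unfold)
  then show ?thesis
    unfolding abs_total_def [abs_def] by (rule CS.borel_measurable_lebesgue_integral)
qed

lemma laplace_limit:
  assumes \<xi>: "typical \<xi>" and s: "0 \<le> s"
  shows "(\<lambda>n. \<Prod>x\<in>atoms \<xi> \<inter> window n. complex_of_real (\<integral>z. exp (- s * \<bar>z\<bar>) \<partial>point_law x))
    \<longlonglongrightarrow> complex_of_real (\<integral>\<omega>. exp (- s * abs_total \<xi> \<omega>) \<partial>Q)"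
proof -
  have [measurable]: "abs_total \<xi> \<in> borel_measurable Q" by (rule abs_total_measurable[OF \<xi>])
  have "(\<lambda>n. \<Prod>x\<in>atoms \<xi> \<inter> window n. \<integral>z. complex_of_real (exp (- s * \<bar>z\<bar>)) \<partial>point_law x)
      \<longlonglongrightarrow> (\<integral>\<omega>. complex_of_real (exp (- s * abs_total \<xi> \<omega>)) \<partial>Q)"
  proof (rule product_limit[OF \<xi>])
    show "norm (complex_of_real (exp (- s * \<bar>z\<bar>))) \<le> 1" for z using s by simp
    show "AE \<omega> in Q. (\<lambda>n. \<Prod>x\<in>atoms \<xi> \<inter> window n. complex_of_real (exp (- s * \<bar>contribution x \<omega>\<bar>)))
        \<longlonglongrightarrow> complex_of_real (exp (- s * abs_total \<xi> \<omega>))"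
      using typical_sum[OF \<xi>]
    proof eventually_elim
      case (elim \<omega>)
      then have "integrable (count_space (atoms \<xi>)) (\<lambda>x. \<bar>contribution x \<omega>\<bar>)" by simp
      from window_sum_limit[OF \<xi> this]
      have "(\<lambda>n. complex_of_real (exp (- s * (\<Sum>x\<in>atoms \<xi> \<inter> window n. \<bar>contribution x \<omega>\<bar>))))
          \<longlonglongrightarrow> complex_of_real (exp (- s * abs_total \<xi> \<omega>))"
        unfolding abs_total_def by (intro tendsto_intros)
      moreover have "complex_of_real (exp (- s * (\<Sum>x\<in>atoms \<xi> \<inter> window n. \<bar>contribution x \<omega>\<bar>))) =
          (\<Prod>x\<in>atoms \<xi> \<inter> window n. complex_of_real (exp (- s * \<bar>contribution x \<omega>\<bar>)))" for n
        using typical_atoms(3)[OF \<xi>, of n]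
        by (simp only: sum_distrib_left exp_sum of_real_prod)
      ultimately show ?case by simp
    qed
  qed auto
  then show ?thesis by (simp only: integral_complex_of_real)
qed

lemma point_law_prob: "x \<in> X \<Longrightarrow> prob_space (point_law x)"
  unfolding point_law_def by (rule prob_space_distr[OF contribution_measurable])

lemma sets_point_law: "sets (point_law x) = sets borel"
  by (simp add: point_law_def)

text \<open>The integrand \<open>1 - exp(- s \<bar>z\<bar>)\<close> is comparable to \<open>min 1 \<bar>z\<bar>\<close>, and after division by \<open>s\<close> it tends to
  \<open>\<bar>z\<bar>\<close> as \<open>s \<rightarrow> 0\<close>; hence the defect controls the first moment of the Levy measure.\<close>

definition laplace_defect :: "real \<Rightarrow> 'x \<Rightarrow> real" where
  "laplace_defect s x = (\<integral>z. 1 - exp (- s * \<bar>z\<bar>) \<partial>point_law x)"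

lemma laplace_defect:
  assumes s: "0 \<le> s"
  shows "laplace_defect s \<in> borel_measurable \<nu>"
    and "\<And>x. 0 \<le> laplace_defect s x" "\<And>x. x \<in> X \<Longrightarrow> laplace_defect s x \<le> 1"
    and "\<And>x. x \<in> X \<Longrightarrow> (\<integral>z. exp (- s * \<bar>z\<bar>) \<partial>point_law x) = 1 - laplace_defect s x"
    and "\<And>x. x \<in> X \<Longrightarrow> (\<integral>\<^sup>+z. ennreal (1 - exp (- s * \<bar>z\<bar>)) \<partial>point_law x) = ennreal (laplace_defect s x)"
proof -
  have e: "0 \<le> exp (- s * \<bar>z\<bar>)" "exp (- s * \<bar>z\<bar>) \<le> 1" for z using s by auto
  have m: "(\<lambda>z. 1 - exp (- s * \<bar>z\<bar>)) \<in> borel_measurable borel" by measurable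
  show "laplace_defect s \<in> borel_measurable \<nu>"
    unfolding laplace_defect_def [abs_def]
    by (rule measurable_compose[OF point_law_kernel integral_measurable_subprob_algebra[OF m]])
  show nn: "0 \<le> laplace_defect s x" for x
    unfolding laplace_defect_def by (rule Bochner_Integration.integral_nonneg) (use e in auto)
  fix x assume x: "x \<in> X"
  interpret L: prob_space "point_law x" by (rule point_law_prob[OF x])
  have [measurable_cong]: "sets (point_law x) = sets borel" by (rule sets_point_law)
  have i: "integrable (point_law x) (\<lambda>z. exp (- s * \<bar>z\<bar>))"
    by (rule L.integrable_const_bound[where B=1]) (use e in auto)
  show eq: "(\<integral>z. exp (- s * \<bar>z\<bar>) \<partial>point_law x) = 1 - laplace_defect s x"
    unfolding laplace_defect_def using i by (simp add: L.prob_space)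
  have "0 \<le> (\<integral>z. exp (- s * \<bar>z\<bar>) \<partial>point_law x)"
    by (rule Bochner_Integration.integral_nonneg) simp
  then show "laplace_defect s x \<le> 1" unfolding eq by simp
  show "(\<integral>\<^sup>+z. ennreal (1 - exp (- s * \<bar>z\<bar>)) \<partial>point_law x) = ennreal (laplace_defect s x)"
    unfolding laplace_defect_def using i e by (intro nn_integral_eq_integral) auto
qed

text \<open>The Laplace transform of the sum of the \<open>\<bar>a\<^sub>x\<bar>\<close> is the limit of \<open>exp(- \<integral> laplace_defect)\<close> over growing
  windows.  It is positive because the sum is finite almost surely; so the integrals stay bounded.\<close>

lemma laplace_functional:
  assumes s: "0 \<le> s"
  obtains W where "W \<in> borel_measurable \<theta>" "AE \<xi> in \<theta>. W \<xi> = (\<integral>\<omega>. exp (- s * abs_total \<xi> \<omega>) \<partial>Q)"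
    "0 < (\<integral>\<xi>. W \<xi> \<partial>\<theta>)" "integrable \<nu> (laplace_defect s)"
    "(\<integral>x. laplace_defect s x \<partial>\<nu>) = - ln (\<integral>\<xi>. W \<xi> \<partial>\<theta>)"
proof -
  note D = laplace_defect[OF s]
  have [measurable]: "laplace_defect s \<in> borel_measurable \<nu>" by (rule D(1))
  let ?\<phi> = "\<lambda>x. complex_of_real (1 - laplace_defect s x)"
  let ?V = "\<lambda>\<xi>. \<integral>\<omega>. exp (- s * abs_total \<xi> \<omega>) \<partial>Q"
  define I where "I n = (\<integral>x. indicator (window n) x * laplace_defect s x \<partial>\<nu>)" for n
  have "\<exists>V'. V' \<in> borel_measurable \<theta> \<and> (AE \<xi> in \<theta>. V' \<xi> = complex_of_real (?V \<xi>)) \<and>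
    (\<lambda>n. exp (\<integral>x. indicator (window n) x *\<^sub>R (?\<phi> x - 1) \<partial>\<nu>)) \<longlonglongrightarrow> (\<integral>\<xi>. V' \<xi> \<partial>\<theta>)"
  proof (rule product_functional_limit)
    show "cmod (?\<phi> x) \<le> 1" if "x \<in> X" for x
      unfolding norm_of_real using D(2)[of x] D(3)[OF that] by linarith
    show "AE \<xi> in \<theta>. (\<lambda>n. \<Prod>x\<in>atoms \<xi> \<inter> window n. ?\<phi> x) \<longlonglongrightarrow> complex_of_real (?V \<xi>)"
      using AE_typical
    proof eventually_elim
      case (elim \<xi>)
      have "(\<Prod>x\<in>atoms \<xi> \<inter> window n. ?\<phi> x) =
          (\<Prod>x\<in>atoms \<xi> \<inter> window n. complex_of_real (\<integral>z. exp (- s * \<bar>z\<bar>) \<partial>point_law x))" for n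
        using typical_atoms(2)[OF elim] by (intro prod.cong refl) (subst D(4), auto)
      then show ?case using laplace_limit[OF elim s] by simp
    qed
  qed measurable
  then obtain V' where V'[measurable]: "V' \<in> borel_measurable \<theta>"
    and V'_eq: "AE \<xi> in \<theta>. V' \<xi> = complex_of_real (?V \<xi>)"
    and V'_lim: "(\<lambda>n. exp (\<integral>x. indicator (window n) x *\<^sub>R (?\<phi> x - 1) \<partial>\<nu>)) \<longlonglongrightarrow> (\<integral>\<xi>. V' \<xi> \<partial>\<theta>)"
    by blast
  let ?W = "\<lambda>\<xi>. Re (V' \<xi>)"
  have V_bounds: "0 < ?V \<xi>" "?V \<xi> \<le> 1" if \<xi>: "typical \<xi>" for \<xi>
  proof -
    have [measurable]: "abs_total \<xi> \<in> borel_measurable Q" by (rule abs_total_measurable[OF \<xi>])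
    have nn: "0 \<le> abs_total \<xi> \<omega>" for \<omega> unfolding abs_total_def by simp
    have i: "integrable Q (\<lambda>\<omega>. exp (- s * abs_total \<xi> \<omega>))"
      by (rule integrable_const_bound[where B=1]) (use s nn in auto)
    show "0 < ?V \<xi>"
      using i by (intro expectation_greater) auto
    have "?V \<xi> \<le> (\<integral>\<omega>. 1 \<partial>Q)" using s nn by (intro integral_mono i) auto
    then show "?V \<xi> \<le> 1" by (simp add: prob_space)
  qed
  have W_AE: "AE \<xi> in \<theta>. ?W \<xi> = ?V \<xi> \<and> 0 < ?W \<xi> \<and> V' \<xi> = complex_of_real (?W \<xi>) \<and> cmod (V' \<xi>) \<le> 1"
    using V'_eq AE_typical
  proof eventually_elim
    case (elim \<xi>)
    then show ?case using V_bounds[OF elim(2)] by simp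
  qed
  have V'_int: "integrable \<theta> V'"
    by (rule \<theta>.integrable_const_bound[where B=1]) (use W_AE in auto)
  have W_int: "integrable \<theta> ?W" using V'_int by simp
  have W_pos: "0 < (\<integral>\<xi>. ?W \<xi> \<partial>\<theta>)"
    by (rule \<theta>.expectation_greater[OF W_int]) (use W_AE in auto)
  have win: "integrable \<nu> (\<lambda>x. indicator (window n) x * laplace_defect s x)" for n
  proof (rule Bochner_Integration.integrable_bound)
    show "integrable \<nu> (\<lambda>x. indicator (window n) x :: real)"
      using window_finite[of n] window_sets by (intro integrable_real_indicator) auto
    show "AE x in \<nu>. norm (indicator (window n) x * laplace_defect s x) \<le> norm (indicator (window n) x :: real)"
      using D(2,3) by (intro AE_I2) (auto simp: indicator_def space_\<nu>)
  qed measurable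
  have "(\<lambda>n. complex_of_real (exp (- I n))) \<longlonglongrightarrow> (\<integral>\<xi>. V' \<xi> \<partial>\<theta>)"
  proof -
    have "(\<integral>x. indicator (window n) x *\<^sub>R (?\<phi> x - 1) \<partial>\<nu>) = complex_of_real (- I n)" for n
    proof -
      have "(\<integral>x. indicator (window n) x *\<^sub>R (?\<phi> x - 1) \<partial>\<nu>)
          = (\<integral>x. complex_of_real (- (indicator (window n) x * laplace_defect s x)) \<partial>\<nu>)"
        by (intro Bochner_Integration.integral_cong) (auto simp: indicator_def)
      also have "\<dots> = complex_of_real (- I n)"
        unfolding I_def integral_complex_of_real Bochner_Integration.integral_minus ..
      finally show ?thesis .
    qed
    then show ?thesis using V'_lim by (simp only: exp_of_real)
  qed
  from tendsto_Re[OF this] have "(\<lambda>n. exp (- I n)) \<longlonglongrightarrow> (\<integral>\<xi>. ?W \<xi> \<partial>\<theta>)"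
    using integral_Re[OF V'_int] by simp
  from tendsto_minus[OF tendsto_ln[OF this]] W_pos
  have I_lim: "I \<longlonglongrightarrow> - ln (\<integral>\<xi>. ?W \<xi> \<partial>\<theta>)" by simp
  have mono: "AE x in \<nu>. mono (\<lambda>n. indicator (window n) x * laplace_defect s x)"
    using D(2) window_mono by (intro AE_I2 monoI) (auto simp: indicator_def)
  have lim: "AE x in \<nu>. (\<lambda>n. indicator (window n) x * laplace_defect s x) \<longlonglongrightarrow> laplace_defect s x"
  proof (intro AE_I2 tendsto_eventually)
    fix x assume "x \<in> space \<nu>"
    then have "x \<in> X" by (simp add: space_\<nu>)
    from window_eventually[OF this]
    show "\<forall>\<^sub>F n in sequentially. indicator (window n) x * laplace_defect s x = laplace_defect s x"
      by eventually_elim simp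
  qed
  note mc = win mono lim I_lim[unfolded I_def [abs_def]] D(1)
  show thesis
  proof (rule that)
    show "?W \<in> borel_measurable \<theta>" by measurable
    show "AE \<xi> in \<theta>. ?W \<xi> = ?V \<xi>" using W_AE by auto
    show "integrable \<nu> (laplace_defect s)" by (rule integrable_monotone_convergence[OF mc])
    show "(\<integral>x. laplace_defect s x \<partial>\<nu>) = - ln (\<integral>\<xi>. ?W \<xi> \<partial>\<theta>)"
      by (rule integral_monotone_convergence[OF mc])
  qed (rule W_pos)
qed

text \<open>Contributions equal to \<open>0\<close> are included, which may produce an infinite mass at the origin.\<close>

definition Levy_measure :: "real measure" where
  "Levy_measure = mixture \<nu> borel point_law"

lemma Levy_nn_integral:
  assumes "f \<in> borel_measurable borel"
  shows "(\<integral>\<^sup>+a. f a \<partial>Levy_measure) = (\<integral>\<^sup>+x. (\<integral>\<^sup>+\<omega>. f (contribution x \<omega>) \<partial>Q) \<partial>\<nu>)"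
proof -
  have "(\<integral>\<^sup>+a. f a \<partial>point_law x) = (\<integral>\<^sup>+\<omega>. f (contribution x \<omega>) \<partial>Q)" if "x \<in> space \<nu>" for x
    unfolding point_law_def using that assms contribution_measurable
    by (intro nn_integral_distr) (auto simp: space_\<nu>)
  then show ?thesis
    unfolding Levy_measure_def nn_integral_mixture[OF point_law_kernel assms]
    by (intro nn_integral_cong)
qed

lemma Levy_laplace:
  assumes s: "0 \<le> s"
  shows "(\<integral>\<^sup>+a. ennreal (1 - exp (- s * \<bar>a\<bar>)) \<partial>Levy_measure) = ennreal (\<integral>x. laplace_defect s x \<partial>\<nu>)"
proof -
  have i: "integrable \<nu> (laplace_defect s)" using laplace_functional[OF s] by blast
  have "(\<integral>\<^sup>+a. ennreal (1 - exp (- s * \<bar>a\<bar>)) \<partial>Levy_measure)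
      = (\<integral>\<^sup>+x. (\<integral>\<^sup>+z. ennreal (1 - exp (- s * \<bar>z\<bar>)) \<partial>point_law x) \<partial>\<nu>)"
    unfolding Levy_measure_def by (rule nn_integral_mixture[OF point_law_kernel]) measurable
  also have "\<dots> = (\<integral>\<^sup>+x. ennreal (laplace_defect s x) \<partial>\<nu>)"
    using laplace_defect(5)[OF s] by (intro nn_integral_cong) (simp add: space_\<nu>)
  also have "\<dots> = ennreal (\<integral>x. laplace_defect s x \<partial>\<nu>)"
    using i laplace_defect(2)[OF s] by (intro nn_integral_eq_integral) auto
  finally show ?thesis .
qed

lemma sets_Levy: "sets Levy_measure = sets borel"
  unfolding Levy_measure_def by (rule sets_mixture)

text \<open>Small jumps are integrable by the Laplace functional, large ones by the third moment.\<close>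

lemma Levy_first_moment:
  assumes "(\<integral>\<^sup>+a. ennreal (\<bar>a\<bar> ^ 3) \<partial>Levy_measure) < \<infinity>"
  shows "integrable Levy_measure (\<lambda>a. a)"
proof -
  have [measurable_cong]: "sets Levy_measure = sets borel" by (rule sets_Levy)
  have le: "\<bar>a\<bar> \<le> 2 * (1 - exp (- 1 * \<bar>a\<bar>)) + \<bar>a\<bar> ^ 3" for a :: real
  proof (cases "\<bar>a\<bar> \<le> 1")
    case True
    \<comment> \<open>\<open>exp(- t) \<le> 1 / (1 + t)\<close>, so \<open>1 - exp(- t) \<ge> t / (1 + t) \<ge> t / 2\<close> for \<open>t \<le> 1\<close>.\<close>
    have "exp (- \<bar>a\<bar>) = 1 / exp \<bar>a\<bar>" by (simp add: exp_minus inverse_eq_divide)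
    also have "\<dots> \<le> 1 / (1 + \<bar>a\<bar>)" by (intro divide_left_mono exp_ge_add_one_self) (auto intro: add_pos_nonneg)
    finally have 1: "1 - 1 / (1 + \<bar>a\<bar>) \<le> 1 - exp (- \<bar>a\<bar>)" by simp
    have "\<bar>a\<bar> / 2 \<le> \<bar>a\<bar> / (1 + \<bar>a\<bar>)" using True by (intro divide_left_mono) auto
    also have "\<dots> = 1 - 1 / (1 + \<bar>a\<bar>)" by (simp add: field_simps)
    also note 1
    finally have "\<bar>a\<bar> \<le> 2 * (1 - exp (- \<bar>a\<bar>))" by simp
    then show ?thesis by (simp add: add_increasing2)
  next
    case False
    then have "\<bar>a\<bar> ^ 1 \<le> \<bar>a\<bar> ^ 3" by (intro power_increasing) auto
    moreover have "0 \<le> 2 * (1 - exp (- 1 * \<bar>a\<bar>))" by simp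
    ultimately show ?thesis using add_mono[of 0 "2 * (1 - exp (- 1 * \<bar>a\<bar>))" "\<bar>a\<bar> ^ 1" "\<bar>a\<bar> ^ 3"] by simp
  qed
  have "(\<integral>\<^sup>+a. ennreal \<bar>a\<bar> \<partial>Levy_measure)
      \<le> (\<integral>\<^sup>+a. 2 * ennreal (1 - exp (- 1 * \<bar>a\<bar>)) + ennreal (\<bar>a\<bar> ^ 3) \<partial>Levy_measure)"
  proof (rule nn_integral_mono)
    fix a :: real
    have "ennreal \<bar>a\<bar> \<le> ennreal (2 * (1 - exp (- 1 * \<bar>a\<bar>)) + \<bar>a\<bar> ^ 3)" by (rule ennreal_leI[OF le])
    also have "\<dots> = 2 * ennreal (1 - exp (- 1 * \<bar>a\<bar>)) + ennreal (\<bar>a\<bar> ^ 3)"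
      by (subst ennreal_plus, simp, simp, subst ennreal_mult) auto
    finally show "ennreal \<bar>a\<bar> \<le> 2 * ennreal (1 - exp (- 1 * \<bar>a\<bar>)) + ennreal (\<bar>a\<bar> ^ 3)" .
  qed
  also have "\<dots> = 2 * (\<integral>\<^sup>+a. ennreal (1 - exp (- 1 * \<bar>a\<bar>)) \<partial>Levy_measure) + (\<integral>\<^sup>+a. ennreal (\<bar>a\<bar> ^ 3) \<partial>Levy_measure)"
    by (subst nn_integral_add, measurable, subst nn_integral_cmult, measurable)
  also have "\<dots> < \<infinity>"
    using assms Levy_laplace[of 1] by (simp add: ennreal_mult_less_top)
  finally show ?thesis by (simp add: integrable_iff_bounded)
qed

abbreviation total_law :: "real measure" where
  "total_law \<equiv> distr P borel (poisson_additive_functional Y \<mu> r \<psi>)"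

lemma prob_P: "prob_space P"
  by (rule product_measure_prob_space[OF P \<theta>.prob_space_axioms prob_space_axioms])

lemma prob_total_law: "prob_space total_law"
  by (rule prob_space.prob_space_distr[OF prob_P total_measurable_P])

lemma total_nonneg: "(\<And>y. 0 \<le> \<psi> y) \<Longrightarrow> 0 \<le> total \<xi> \<omega>"
  unfolding total_eq time_integral_T by (intro Bochner_Integration.integral_nonneg) auto

lemma contribution_nonneg: "(\<And>y. 0 \<le> \<psi> y) \<Longrightarrow> 0 \<le> contribution x \<omega>"
  unfolding contribution_eq by (intro Bochner_Integration.integral_nonneg) auto

text \<open>Jensen's inequality \<open>E (exp(- s A)) \<ge> exp(- s E A)\<close>, with the exponential bounded below by its tangent
  at the mean.\<close>

lemma laplace_defect_le_mean:
  assumes nn: "\<And>y. 0 \<le> \<psi> y" and int: "integrable total_law (\<lambda>x. x)" and s: "0 \<le> s"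
  shows "(\<integral>x. laplace_defect s x \<partial>\<nu>) \<le> s * (\<integral>x. x \<partial>total_law)"
proof -
  interpret R: prob_space total_law by (rule prob_total_law)
  let ?m = "\<integral>x. x \<partial>total_law"
  obtain W where W[measurable]: "W \<in> borel_measurable \<theta>"
    and W_eq: "AE \<xi> in \<theta>. W \<xi> = (\<integral>\<omega>. exp (- s * abs_total \<xi> \<omega>) \<partial>Q)"
    and W_pos: "0 < (\<integral>\<xi>. W \<xi> \<partial>\<theta>)"
    and eq: "(\<integral>x. laplace_defect s x \<partial>\<nu>) = - ln (\<integral>\<xi>. W \<xi> \<partial>\<theta>)"
    using laplace_functional[OF s] by blast
  have e: "(\<lambda>z. exp (- s * \<bar>z\<bar>)) \<in> borel_measurable borel" by measurable
  have i: "integrable total_law (\<lambda>z. exp (- s * \<bar>z\<bar>))"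
    by (rule R.integrable_const_bound[where B=1]) (use s in auto)
  have "AE \<xi> in \<theta>. W \<xi> = (\<integral>z. exp (- s * \<bar>z\<bar>) \<partial>config_law \<xi>)"
    using W_eq AE_typical
  proof eventually_elim
    case (elim \<xi>)
    then have \<xi>: "\<xi> \<in> space \<theta>" by (simp add: typical_def)
    have [measurable]: "total \<xi> \<in> borel_measurable Q" "abs_total \<xi> \<in> borel_measurable Q"
      using total_measurable[OF \<xi>] abs_total_measurable[OF elim(2)] by auto
    have "(\<integral>z. exp (- s * \<bar>z\<bar>) \<partial>config_law \<xi>) = (\<integral>\<omega>. exp (- s * \<bar>total \<xi> \<omega>\<bar>) \<partial>Q)"
      unfolding config_law_def by (rule integral_distr) measurable
    also have "\<dots> = (\<integral>\<omega>. exp (- s * abs_total \<xi> \<omega>) \<partial>Q)"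
    proof (rule integral_cong_AE)
      show "AE \<omega> in Q. exp (- s * \<bar>total \<xi> \<omega>\<bar>) = exp (- s * abs_total \<xi> \<omega>)"
        using typical_sum[OF elim(2)]
        by eventually_elim (simp add: abs_total_def total_nonneg[OF nn] contribution_nonneg[OF nn])
    qed measurable
    finally show ?case using elim(1) by simp
  qed
  then have "(\<integral>\<xi>. W \<xi> \<partial>\<theta>) = (\<integral>\<xi>. (\<integral>z. exp (- s * \<bar>z\<bar>) \<partial>config_law \<xi>) \<partial>\<theta>)"
    by (intro integral_cong_AE W measurable_compose[OF config_law_kernel integral_measurable_subprob_algebra[OF e]])
  also have "\<dots> = (\<integral>z. exp (- s * \<bar>z\<bar>) \<partial>total_law)"
    using integral_mixture_real(3)[OF config_law_kernel] i unfolding distr_total by simp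
  finally have W_law: "(\<integral>\<xi>. W \<xi> \<partial>\<theta>) = (\<integral>z. exp (- s * \<bar>z\<bar>) \<partial>total_law)" .
  have "exp (- (s * ?m)) = (\<integral>z. exp (- (s * ?m)) * (1 - s * (z - ?m)) \<partial>total_law)"
    using int R.prob_space by simp
  also have "\<dots> \<le> (\<integral>z. exp (- s * \<bar>z\<bar>) \<partial>total_law)"
  proof (rule integral_mono_AE[OF _ i])
    show "integrable total_law (\<lambda>z. exp (- (s * ?m)) * (1 - s * (z - ?m)))" using int by simp
    have "AE z in total_law. 0 \<le> z"
      using total_nonneg[OF nn] by (subst AE_distr_iff[OF total_measurable_P]) auto
    then show "AE z in total_law. exp (- (s * ?m)) * (1 - s * (z - ?m)) \<le> exp (- s * \<bar>z\<bar>)"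
    proof eventually_elim
      case (elim z)
      have "exp (- (s * ?m)) * (1 - s * (z - ?m)) \<le> exp (- (s * ?m)) * exp (- (s * (z - ?m)))"
        using exp_ge_add_one_self[of "- (s * (z - ?m))"] by (intro mult_left_mono) auto
      also have "\<dots> = exp (- s * \<bar>z\<bar>)" using elim by (simp add: algebra_simps flip: exp_add)
      finally show ?case .
    qed
  qed
  finally have "exp (- (s * ?m)) \<le> (\<integral>\<xi>. W \<xi> \<partial>\<theta>)" unfolding W_law .
  then have "- (s * ?m) \<le> ln (\<integral>\<xi>. W \<xi> \<partial>\<theta>)" using W_pos by (simp add: ln_ge_iff)
  then show ?thesis unfolding eq by simp
qed

text \<open>Fatou's lemma for \<open>s = 1 / (n + 1)\<close> in the preceding bound, after division by \<open>s\<close>.\<close>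

lemma Levy_first_moment_nonneg:
  assumes nn: "\<And>y. 0 \<le> \<psi> y" and int: "integrable total_law (\<lambda>x. x)"
  shows "integrable Levy_measure (\<lambda>a. a)" "AE a in Levy_measure. 0 \<le> a"
proof -
  have [measurable_cong]: "sets Levy_measure = sets borel" by (rule sets_Levy)
  let ?m = "\<integral>x. x \<partial>total_law"
  define q where "q n a = real (Suc n) * (1 - exp (- (1 / real (Suc n)) * \<bar>a\<bar>))" for n and a :: real
  have [measurable]: "q n \<in> borel_measurable borel" for n unfolding q_def by measurable
  have bd: "(\<integral>\<^sup>+a. ennreal (q n a) \<partial>Levy_measure) \<le> ennreal ?m" for n
  proof -
    let ?s = "1 / real (Suc n)"
    have "(\<integral>\<^sup>+a. ennreal (q n a) \<partial>Levy_measure)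
        = ennreal (real (Suc n)) * (\<integral>\<^sup>+a. ennreal (1 - exp (- ?s * \<bar>a\<bar>)) \<partial>Levy_measure)"
      by (subst nn_integral_cmult[symmetric], measurable) (simp add: q_def ennreal_mult del: of_nat_Suc)
    also have "\<dots> = ennreal (real (Suc n) * (\<integral>x. laplace_defect ?s x \<partial>\<nu>))"
      by (subst Levy_laplace, simp, rule ennreal_mult[symmetric])
        (auto intro!: Bochner_Integration.integral_nonneg laplace_defect(2))
    also have "\<dots> \<le> ennreal ?m"
      using mult_left_mono[OF laplace_defect_le_mean[OF nn int, of ?s], of "real (Suc n)"]
      by (intro ennreal_leI) (simp del: of_nat_Suc)
    finally show ?thesis .
  qed
  have lim: "(\<lambda>n. q n a) \<longlonglongrightarrow> \<bar>a\<bar>" for a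
    unfolding q_def by real_asymp
  have "(\<integral>\<^sup>+a. ennreal \<bar>a\<bar> \<partial>Levy_measure) = (\<integral>\<^sup>+a. liminf (\<lambda>n. ennreal (q n a)) \<partial>Levy_measure)"
    using lim by (intro nn_integral_cong lim_imp_Liminf[symmetric] tendsto_ennrealI) auto
  also have "\<dots> \<le> liminf (\<lambda>n. \<integral>\<^sup>+a. ennreal (q n a) \<partial>Levy_measure)"
    by (rule nn_integral_liminf) measurable
  also have "\<dots> \<le> liminf (\<lambda>n. ennreal ?m)"
    using bd by (intro Liminf_mono always_eventually allI)
  also have "\<dots> < \<infinity>" by (simp add: Liminf_const)
  finally show "integrable Levy_measure (\<lambda>a. a)" by (simp add: integrable_iff_bounded)
  have "emeasure Levy_measure {a. a < 0} = (\<integral>\<^sup>+a. indicator {a. a < 0} a \<partial>Levy_measure)"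
    by (subst nn_integral_indicator) auto
  also have "\<dots> = 0"
    by (subst Levy_nn_integral) (auto simp: contribution_nonneg[OF nn] not_less)
  finally have "{a. a < 0} \<in> null_sets Levy_measure" by (auto simp: null_sets_def)
  then show "AE a in Levy_measure. 0 \<le> a" by (rule AE_I') auto
qed

text \<open>The exponent is first an integral over windows; the first moment of the Levy measure dominates
  \<open>\<bar>char (point_law x) u - 1\<bar>\<close> and lets the windows grow to \<open>X\<close>.\<close>

lemma char_total_law:
  assumes L1: "integrable Levy_measure (\<lambda>a. a)"
  shows "char total_law u = exp (CLINT a|Levy_measure. (iexp (u * a) - 1))"
proof -
  interpret R: prob_space total_law by (rule prob_total_law)
  have [measurable_cong]: "sets Levy_measure = sets borel" by (rule sets_Levy)
  have ie: "(\<lambda>z. iexp (u * z)) \<in> borel_measurable borel" by measurable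
  define c where "c x = char (point_law x) u - 1" for x
  have int: "integrable Levy_measure (\<lambda>a. iexp (u * a) - 1)"
  proof (rule Bochner_Integration.integrable_bound)
    show "integrable Levy_measure (\<lambda>a. u * a)" using L1 by simp
    show "AE a in Levy_measure. norm (iexp (u * a) - 1) \<le> norm (u * a)"
      using norm_iexp_diff[of "u * _" 0] by simp
  qed measurable
  have c_eq: "(\<integral>z. (iexp (u * z) - 1) \<partial>point_law x) = c x" if "x \<in> X" for x
  proof -
    interpret L: prob_space "point_law x" by (rule point_law_prob[OF that])
    have [measurable_cong]: "sets (point_law x) = sets borel" by (rule sets_point_law)
    have "integrable (point_law x) (\<lambda>z. iexp (u * z))"
      by (rule L.integrable_const_bound[where B=1]) auto
    then show ?thesis by (simp add: c_def char_def L.prob_space)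
  qed
  have c_meas[measurable]: "c \<in> borel_measurable \<nu>"
    unfolding c_def [abs_def] char_def
    by (intro borel_measurable_diff borel_measurable_const
        measurable_compose[OF point_law_kernel integral_measurable_subprob_algebra[OF ie]])
  have "integrable \<nu> (\<lambda>x. \<integral>z. (iexp (u * z) - 1) \<partial>point_law x)"
    "(CLINT a|Levy_measure. (iexp (u * a) - 1)) = (\<integral>x. (\<integral>z. (iexp (u * z) - 1) \<partial>point_law x) \<partial>\<nu>)"
    using integral_mixture_complex[OF point_law_kernel] int unfolding Levy_measure_def by auto
  then have c_int: "integrable \<nu> c" and c_Levy: "(CLINT a|Levy_measure. (iexp (u * a) - 1)) = (\<integral>x. c x \<partial>\<nu>)"
    using Bochner_Integration.integrable_cong[OF refl c_eq, of \<nu>]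
      Bochner_Integration.integral_cong[OF refl c_eq, of \<nu>] by (simp_all add: space_\<nu>)
  have "\<exists>V'. V' \<in> borel_measurable \<theta> \<and> (AE \<xi> in \<theta>. V' \<xi> = char (config_law \<xi>) u) \<and>
    (\<lambda>n. exp (\<integral>x. indicator (window n) x *\<^sub>R (char (point_law x) u - 1) \<partial>\<nu>)) \<longlonglongrightarrow> (\<integral>\<xi>. V' \<xi> \<partial>\<theta>)"
  proof (rule product_functional_limit)
    show "(\<lambda>x. char (point_law x) u) \<in> borel_measurable \<nu>"
      unfolding char_def
      by (rule measurable_compose[OF point_law_kernel integral_measurable_subprob_algebra[OF ie]])
    show "cmod (char (point_law x) u) \<le> 1" if "x \<in> X" for x
      unfolding point_law_def
      by (rule real_distribution.cmod_char_le_1[OF real_distribution_distr[OF contribution_measurable[OF that]]])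
    show "AE \<xi> in \<theta>. (\<lambda>n. \<Prod>x\<in>atoms \<xi> \<inter> window n. char (point_law x) u) \<longlonglongrightarrow> char (config_law \<xi>) u"
      using AE_typical by eventually_elim (rule char_limit)
  qed
  then obtain V' where V'[measurable]: "V' \<in> borel_measurable \<theta>"
    and V'_eq: "AE \<xi> in \<theta>. V' \<xi> = char (config_law \<xi>) u"
    and V'_lim: "(\<lambda>n. exp (\<integral>x. indicator (window n) x *\<^sub>R c x \<partial>\<nu>)) \<longlonglongrightarrow> (\<integral>\<xi>. V' \<xi> \<partial>\<theta>)"
    unfolding c_def by blast
  have "(\<integral>\<xi>. V' \<xi> \<partial>\<theta>) = (\<integral>\<xi>. (\<integral>z. iexp (u * z) \<partial>config_law \<xi>) \<partial>\<theta>)"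
    using V'_eq unfolding char_def
    by (intro integral_cong_AE V' measurable_compose[OF config_law_kernel integral_measurable_subprob_algebra[OF ie]])
  also have "\<dots> = char total_law u"
  proof -
    have "integrable total_law (\<lambda>z. iexp (u * z))"
      by (rule R.integrable_const_bound[where B=1]) auto
    then show ?thesis
      using integral_mixture_complex(2)[OF config_law_kernel] unfolding char_def distr_total by simp
  qed
  finally have V'_char: "(\<integral>\<xi>. V' \<xi> \<partial>\<theta>) = char total_law u" .
  have "(\<lambda>n. exp (\<integral>x. indicator (window n) x *\<^sub>R c x \<partial>\<nu>)) \<longlonglongrightarrow> exp (\<integral>x. c x \<partial>\<nu>)"
  proof (intro tendsto_exp integral_dominated_convergence[where w="\<lambda>x. norm (c x)"])
    show "AE x in \<nu>. (\<lambda>n. indicator (window n) x *\<^sub>R c x) \<longlonglongrightarrow> c x"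
    proof (intro AE_I2 tendsto_eventually)
      fix x assume "x \<in> space \<nu>"
      then have "x \<in> X" by (simp add: space_\<nu>)
      from window_eventually[OF this]
      show "\<forall>\<^sub>F n in sequentially. indicator (window n) x *\<^sub>R c x = c x"
        by eventually_elim simp
    qed
  qed (use c_int in \<open>auto simp: indicator_def\<close>)
  from LIMSEQ_unique[OF V'_lim this] show ?thesis unfolding V'_char c_Levy .
qed

end

section \<open>The Wasserstein bounds\<close>

lemma std_dev_eq:
  assumes "f \<in> borel_measurable P"
  shows "std_dev P f = sqrt (\<integral>x. (x - (\<integral>x. x \<partial>distr P borel f))\<^sup>2 \<partial>distr P borel f)"
  unfolding std_dev_def using assms by (simp add: integral_distr)

theorem theorem1:
  fixes X :: "'x::euclidean_space set"
    and \<nu> :: "'x measure"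
    and \<theta> :: "'x measure measure"
    and Y :: "'y::topological_space measure"
    and Q :: "'w measure"
    and \<mu> :: "'x \<Rightarrow> real \<Rightarrow> 'w \<Rightarrow> 'y measure"
    and P :: "('x measure \<times> 'w) measure"
    and r \<sigma> :: real
    and \<psi> :: "'y \<Rightarrow> real"
    and A :: "'x measure \<times> 'w \<Rightarrow> real"
    and \<rho> :: "real measure"
  assumes X: "X \<in> sets borel"
    and \<nu>: "radon_measure X \<nu>" "bounded_density X \<nu>"
    and \<theta>: "poisson_random_measure_law X \<nu> \<theta>"
    and Y: "space Y = UNIV"
    and Q: "prob_space Q"
    and \<mu>: "independent_measure_processes Q Y X \<mu>"
    and P: "product_measure \<theta> Q P"
    and r: "0 < r"
    and \<psi>: "\<psi> \<in> borel_measurable Y" "bounded (range \<psi>)" "compact (closure {y. \<psi> y \<noteq> 0})"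
    and wd1: "AE x in \<nu>. AE \<omega> in Q. time_integrable r \<psi> (\<lambda>t. \<mu> x t \<omega>)"
    and wd2: "AE (\<xi>, \<omega>) in P. time_integrable r \<psi> (\<lambda>t. superposition Y \<xi> (\<lambda>x. \<mu> x t \<omega>))"
    and A_def: "A = poisson_additive_functional Y \<mu> r \<psi>"
    and A: "A \<in> borel_measurable P" "integrable P (\<lambda>z. (A z)\<^sup>2)"
    and \<sigma>_def: "\<sigma> = std_dev P A"
    and \<sigma>: "0 < \<sigma>"
    and \<rho>_def: "\<rho> = distr P borel (\<lambda>z. (A z - (\<integral>z'. A z' \<partial>P)) / \<sigma>)"
  shows "wasserstein \<rho> std_normal_distribution
           \<le> ennreal (sqrt 2 / \<sigma> ^ 3) *
              (\<integral>\<^sup>+x. (\<integral>\<^sup>+(\<xi>, \<omega>). ennreal (\<bar>time_integral r \<psi> (\<lambda>s. \<mu> x s \<omega>)\<bar> ^ 3) \<partial>P) \<partial>\<nu>)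
         \<and> ((\<forall>y. 0 \<le> \<psi> y) \<longrightarrow> integrable \<rho> (\<lambda>x. x ^ 3) \<longrightarrow>
              enn2ereal (wasserstein \<rho> std_normal_distribution) \<le> ereal (sqrt 2 * (\<integral>x. x ^ 3 \<partial>\<rho>)))"
  proof -
  interpret Q: prob_space Q by (rule Q)
  interpret poisson_dynamics X \<nu> \<theta> Q Y \<mu> r \<psi> P
    by unfold_locales (use X \<nu>(2) \<theta> \<mu> \<psi>(1) P wd2 A(1) in \<open>auto simp: A_def\<close>)
  have Am: "A \<in> borel_measurable P" by (rule A(1))
  let ?R = "distr P borel A" and ?L = Levy_measure
  define m where "m = (\<integral>z. A z \<partial>P)"
  have R: "prob_space ?R" "?R = total_law" using prob_total_law by (simp_all add: A_def)
  interpret R: prob_space ?R by (rule R(1))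
  have R2: "integrable ?R (\<lambda>x. x\<^sup>2)" using A(2) Am by (subst integrable_distr_eq) auto
  have R1: "integrable ?R (\<lambda>x. x)"
    by (rule R.square_integrable_imp_integrable) (use R2 in auto)
  have m: "m = (\<integral>x. x \<partial>?R)" unfolding m_def using Am by (simp add: integral_distr)
  have \<sigma>2: "\<sigma>\<^sup>2 = (\<integral>x. (x - m)\<^sup>2 \<partial>?R)"
    using \<sigma> unfolding \<sigma>_def std_dev_eq[OF Am] m by simp
  have \<rho>: "\<rho> = distr ?R borel (\<lambda>x. (x - m) / \<sigma>)"
    unfolding \<rho>_def m_def using Am by (subst distr_distr) (auto simp: comp_def)
  have rhs: "(\<integral>\<^sup>+x. (\<integral>\<^sup>+(\<xi>, \<omega>). ennreal (\<bar>time_integral r \<psi> (\<lambda>s. \<mu> x s \<omega>)\<bar> ^ 3) \<partial>P) \<partial>\<nu>) =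
      (\<integral>\<^sup>+a. ennreal (\<bar>a\<bar> ^ 3) \<partial>?L)"
  proof -
    have "(\<integral>\<^sup>+(\<xi>, \<omega>). ennreal (\<bar>contribution x \<omega>\<bar> ^ 3) \<partial>P) = (\<integral>\<^sup>+\<omega>. ennreal (\<bar>contribution x \<omega>\<bar> ^ 3) \<partial>Q)"
      if "x \<in> X" for x
    proof -
      note sm = product_measure_snd[OF P \<theta>.prob_space_axioms]
      have "(\<integral>\<^sup>+\<omega>. ennreal (\<bar>contribution x \<omega>\<bar> ^ 3) \<partial>distr P Q snd) =
          (\<integral>\<^sup>+z. ennreal (\<bar>contribution x (snd z)\<bar> ^ 3) \<partial>P)"
        using contribution_measurable[OF that] by (intro nn_integral_distr[OF sm(1)]) measurable
      then show ?thesis by (simp add: sm(2) case_prod_unfold)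
    qed
    then show ?thesis
      by (subst Levy_nn_integral) (auto intro!: nn_integral_cong simp: space_\<nu> contribution_def)
  qed
  have key: "wasserstein \<rho> std_normal_distribution \<le> ennreal ((\<integral>a. \<bar>a\<bar> ^ 3 \<partial>?L) / \<sigma> ^ 3)"
    if "integrable ?L (\<lambda>a. a)" "integrable ?L (\<lambda>a. \<bar>a\<bar> ^ 3)"
  proof -
    interpret infinitely_divisible ?R ?L
      using R R2 that(1) sets_Levy char_total_law[OF that(1)] by unfold_locales auto
    \<comment> \<open>The bound holds with constant \<open>1\<close>; \<open>sqrt 2\<close> enters only below.\<close>
    show ?thesis unfolding \<rho> by (rule wasserstein_bound[OF that(2) \<sigma> \<sigma>2 m])
  qed
  have sqrt2: "1 \<le> sqrt 2" by simp
  show ?thesis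
  proof (intro conjI impI)
    show "wasserstein \<rho> std_normal_distribution
        \<le> ennreal (sqrt 2 / \<sigma> ^ 3) *
          (\<integral>\<^sup>+x. (\<integral>\<^sup>+(\<xi>, \<omega>). ennreal (\<bar>time_integral r \<psi> (\<lambda>s. \<mu> x s \<omega>)\<bar> ^ 3) \<partial>P) \<partial>\<nu>)"
    proof (cases "(\<integral>\<^sup>+a. ennreal (\<bar>a\<bar> ^ 3) \<partial>?L) < \<infinity>")
      case True
      let ?c = "\<integral>a. \<bar>a\<bar> ^ 3 \<partial>?L"
      have L3: "integrable ?L (\<lambda>a. \<bar>a\<bar> ^ 3)"
        using True sets_Levy by (intro integrableI_bounded) (auto cong: measurable_cong_sets)
      have c: "0 \<le> ?c" by simp
      have "wasserstein \<rho> std_normal_distribution \<le> ennreal (?c / \<sigma> ^ 3)"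
        by (rule key[OF Levy_first_moment[OF True] L3])
      also have "\<dots> \<le> ennreal (sqrt 2 / \<sigma> ^ 3 * ?c)"
        using mult_right_mono[OF sqrt2 c] \<sigma> by (intro ennreal_leI) (simp add: divide_right_mono)
      also have "\<dots> = ennreal (sqrt 2 / \<sigma> ^ 3) * ennreal ?c"
        using \<sigma> c by (intro ennreal_mult) auto
      also have "ennreal ?c = (\<integral>\<^sup>+a. ennreal (\<bar>a\<bar> ^ 3) \<partial>?L)"
        by (rule nn_integral_eq_integral[OF L3, symmetric]) simp
      finally show ?thesis unfolding rhs .
    next
      case False
      then have "(\<integral>\<^sup>+a. ennreal (\<bar>a\<bar> ^ 3) \<partial>?L) = top" by (simp add: less_top[symmetric])
      then show ?thesis unfolding rhs using \<sigma> by (simp add: ennreal_mult_top)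
    qed
  next
    assume nn: "\<forall>y. 0 \<le> \<psi> y" and \<rho>3: "integrable \<rho> (\<lambda>x. x ^ 3)"
    let ?W = "\<lambda>x. (x - m) / \<sigma>"
    have int: "integrable total_law (\<lambda>x. x)" using R1 R(2) by simp
    have L: "integrable ?L (\<lambda>a. a)" "AE a in ?L. 0 \<le> a"
      using Levy_first_moment_nonneg[OF _ int] nn by auto
    have W3: "integrable ?R (\<lambda>x. ?W x ^ 3)"
      using \<rho>3 unfolding \<rho> by (subst (asm) integrable_distr_eq) auto
    have W2: "integrable ?R (\<lambda>x. (x - m)\<^sup>2)" unfolding power2_diff using R1 R2 by auto
    \<comment> \<open>Third powers of the standardized and of the original variable differ by lower moments.\<close>
    have x3: "x ^ 3 = \<sigma> ^ 3 * ?W x ^ 3 + 3 * m * (x - m)\<^sup>2 + 3 * m\<^sup>2 * x - 2 * m ^ 3" for x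
      using \<sigma> by (simp add: power_divide) (simp add: power2_eq_square power3_eq_cube algebra_simps)
    have "integrable ?R (\<lambda>x. \<sigma> ^ 3 * ?W x ^ 3 + 3 * m * (x - m)\<^sup>2 + 3 * m\<^sup>2 * x - 2 * m ^ 3)"
      using W3 W2 R1 by (intro Bochner_Integration.integrable_add Bochner_Integration.integrable_diff
          integrable_mult_right R.integrable_const)
    then have R3: "integrable ?R (\<lambda>x. x ^ 3)" by (simp only: x3[symmetric])
    interpret infinitely_divisible ?R ?L
      using R R2 L(1) sets_Levy char_total_law[OF L(1)] by unfold_locales auto
    have "AE x in ?R. 0 \<le> x"
      using total_nonneg nn by (subst AE_distr_iff[OF Am]) (auto simp: A_def)
    note third = third_moment_Levy[OF this L(2) R3] third_central_moment[OF this L(2) R3]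
    have "(\<integral>x. x ^ 3 \<partial>\<rho>) = (\<integral>x. ?W x ^ 3 \<partial>?R)" unfolding \<rho> by (subst integral_distr) auto
    also have "\<dots> = (\<integral>x. (x - m) ^ 3 \<partial>?R) / \<sigma> ^ 3" by (simp add: power_divide)
    finally have m3: "(\<integral>x. x ^ 3 \<partial>\<rho>) = (\<integral>a. \<bar>a\<bar> ^ 3 \<partial>?L) / \<sigma> ^ 3"
      using third(2) m by simp
    have nn3: "0 \<le> (\<integral>a. \<bar>a\<bar> ^ 3 \<partial>?L) / \<sigma> ^ 3" using \<sigma> by simp
    have "wasserstein \<rho> std_normal_distribution \<le> ennreal (sqrt 2 * (\<integral>x. x ^ 3 \<partial>\<rho>))"
      using key[OF L(1) third(1)] mult_right_mono[OF sqrt2 nn3]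
      by (intro order_trans[OF key[OF L(1) third(1)]] ennreal_leI) (simp add: m3)
    then have "enn2ereal (wasserstein \<rho> std_normal_distribution) \<le> enn2ereal (ennreal (sqrt 2 * (\<integral>x. x ^ 3 \<partial>\<rho>)))"
      by (simp add: less_eq_ennreal.rep_eq)
    also have "\<dots> = ereal (sqrt 2 * (\<integral>x. x ^ 3 \<partial>\<rho>))"
      using nn3 unfolding m3 by (intro enn2ereal_ennreal mult_nonneg_nonneg) auto
    finally show "enn2ereal (wasserstein \<rho> std_normal_distribution) \<le> ereal (sqrt 2 * (\<integral>x. x ^ 3 \<partial>\<rho>))" .
  qed
qed

end
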